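(* Consider the game with $k-1$ parallel unobservable GI/G/1 queues and balking described in the context ($k\ge2$). Assume that for every $m\in\{1,\ldots,k-1\}$: (i) $\lambda<\mu_m$; (ii) $\mathrm{E}[Y_m^4]<\infty$; and (iii) the function $\nu_m:\mathbb{R}_+\to\mathbb{R}$ is Lipschitz continuous. Then for any initial strategy $\mathbf{p}^{(1)}\in\Delta$ and any positive step-size sequence $\{\gamma_n\}_{n\ge1}$ satisfying $\sum_{n=1}^\infty\gamma_n=\infty$ and $\sum_{n=1}^\infty\gamma_n^2<\infty$, the stochastic approximation algorithm $\mathbf{p}^{(n+1)}=\pi_\Delta\big(\mathbf{p}^{(n)}+\gamma_n\mathbf{G}^{(n)}\big)$, $n\ge1$, converges almost surely to a set of equilibrium strategies; that is, there is a set $\mathcal{S}^e\subseteq\Delta$ of equilibrium strategies such that $\inf_{\mathbf{x}\in\mathcal{S}^e}\Vert\mathbf{p}^{(n)}-\mathbf{x}\Vert\to0$ almost surely as $n\to\infty$.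
   Context: Notation: $\Delta=\{\mathbf{p}\in\mathbb{R}^k:p_i\ge0,\ \sum_ip_i=1\}$; $\Vert\cdot\Vert$ is the Euclidean norm; $\pi_\Delta$ is the Euclidean projection onto $\Delta$; $'$ is transpose. Model: $k-1$ parallel first-come first-served single-server queues (stations) $m=1,\dots,k-1$. Potential customers arrive according to a renewal process whose inter-arrival distribution $\mathcal{D}$ (denoted $H$ in the paper) is continuous with mean $1/\lambda$. Each arriving customer, without observing the state, chooses one of $k$ actions: join queue $m\in\{1,\dots,k-1\}$, or balk (action $k$). Service times at station $m$ are i.i.d. copies of $Y_m\sim F_m$ with mean $1/\mu_m$; service times, arrivals and action choices are independent. A strategy $\mathbf{p}=(p_1,\dots,p_k)\in\Delta$ gives the probabilities of joining each queue ($p_m$, $m\le k-1$) and of balking ($p_k$). The state seen by an arrival is the vector of workloads $x=(x^{[1]},\dots,x^{[k-1]})\in\mathbb{R}_+^{k-1}$ just before the arrival. The value of joining queue $m$ at state $x$ with service time $y_m$ is $\nu_m(x^{[m]}+y_m)$; the value of balking is $0$. Hence the conditional expected value vector $\overline{\mathbf{v}}(x)$ has components $\overline{v}_m(x)=\mathrm{E}[\nu_m(x^{[m]}+Y_m)]$ for $m\le k-1$ and $\overline{v}_k(x)=0$. Let $X(\mathbf{p})$ have the stationary distribution of the workload vector at arrival epochs when all customers use $\mathbf{p}$, and $\mathbf{u}(\mathbf{p})=\mathrm{E}_{\mathbf{p}}[\overline{\mathbf{v}}(X(\mathbf{p}))]$. A strategy $\mathbf{p}$ is a (symmetric Nash)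 equilibrium if $\mathbf{p}\in\arg\max_{\mathbf{q}\in\Delta}\mathbf{u}(\mathbf{p})'\mathbf{q}$. Algorithm: a regeneration cycle under $\mathbf{p}$ starts with an arrival to a completely empty system, $X_1=0$; $X_j$ is the workload vector seen by the $j$-th arrival (balking customers included), and $L=\inf\{n\ge1:X_{n+1}=0\}$. The cycle estimator is $\mathbf{G}=\sum_{j=1}^L\overline{\mathbf{v}}(X_j)$. At iteration $n$, conditionally on the past of the algorithm up to and including $\mathbf{p}^{(n)}$, $\mathbf{G}^{(n)}$ is distributed as $\mathbf{G}$ under strategy $\mathbf{p}^{(n)}$ (a freshly simulated cycle). *)

theory Defs
  imports "HOL-Probability.Probability"
begin

text \<open>
  Stations are the elements of a finite type \<open>'m\<close>, and actions are of type \<open>'m option\<close>: \<open>Some m\<close> is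
  joining queue \<open>m\<close> and \<open>None\<close> is balking. There are thus \<open>CARD('m) + 1 \<ge> 2\<close> actions.
  \<open>H\<close> is the inter-arrival distribution, \<open>F m\<close> the service time distribution and \<open>\<nu> m\<close> the
  value function of station \<open>m\<close>.
\<close>

definition strategies :: "(real ^ ('m::finite option)) set" where
  "strategies = {p. (\<forall>a. 0 \<le> p $ a) \<and> (\<Sum>a\<in>UNIV. p $ a) = 1}"

text \<open>
  The primitives attached to one arrival: the time until the next arrival, the action chosen, and
  the service times, all independent. A service time is drawn for every station; only the one of
  the station joined is used.
\<close>

definition primitives ::
  "real measure \<Rightarrow> ('m::finite \<Rightarrow> real measure) \<Rightarrow> real ^ ('m option) \<Rightarrow>
    (real \<times> 'm option \<times> ('m \<Rightarrow> real)) measure" where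
  "primitives H F p = H \<Otimes>\<^sub>M measure_pmf (embed_pmf (\<lambda>a. p $ a)) \<Otimes>\<^sub>M PiM UNIV F"

text \<open>
  Lindley recursion: workloads seen by the next arrival, given the workloads \<open>x\<close> seen by the
  present one.
\<close>

definition next_workload ::
  "real ^ 'm::finite \<Rightarrow> real \<times> 'm option \<times> ('m \<Rightarrow> real) \<Rightarrow> real ^ 'm" where
  "next_workload x = (\<lambda>(t, a, y). \<chi> m. max 0 (x $ m + (if a = Some m then y m else 0) - t))"

text \<open>
  The argument of \<open>\<nu> m\<close> is almost surely nonnegative; \<open>max 0\<close> only serves to make the definition
  independent of the values of \<open>\<nu> m\<close> outside its domain \<open>{0..}\<close>, where it need not even be measurable.
\<close>

definition mean_value ::
  "('m::finite \<Rightarrow> real measure) \<Rightarrow> ('m \<Rightarrow> real \<Rightarrow> real) \<Rightarrow> real ^ 'm \<Rightarrow> real ^ ('m option)" where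
  "mean_value F \<nu> x =
    (\<chi> a. case a of None \<Rightarrow> 0 | Some m \<Rightarrow> (\<integral>y. \<nu> m (max 0 (x $ m + y)) \<partial>F m))"

definition is_stationary ::
  "real measure \<Rightarrow> ('m::finite \<Rightarrow> real measure) \<Rightarrow> real ^ ('m option) \<Rightarrow> (real ^ 'm) measure \<Rightarrow> bool" where
  "is_stationary H F p \<pi> \<longleftrightarrow> prob_space \<pi> \<and> sets \<pi> = sets borel \<and>
    distr (\<pi> \<Otimes>\<^sub>M primitives H F p) borel (\<lambda>(x, w). next_workload x w) = \<pi>"

definition stationary_dist ::
  "real measure \<Rightarrow> ('m::finite \<Rightarrow> real measure) \<Rightarrow> real ^ ('m option) \<Rightarrow> (real ^ 'm) measure" where
  "stationary_dist H F p = (THE \<pi>. is_stationary H F p \<pi>)"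

definition expected_utility ::
  "real measure \<Rightarrow> ('m::finite \<Rightarrow> real measure) \<Rightarrow> ('m \<Rightarrow> real \<Rightarrow> real) \<Rightarrow>
    real ^ ('m option) \<Rightarrow> real ^ ('m option)" where
  "expected_utility H F \<nu> p = (\<integral>x. mean_value F \<nu> x \<partial>stationary_dist H F p)"

definition is_equilibrium ::
  "real measure \<Rightarrow> ('m::finite \<Rightarrow> real measure) \<Rightarrow> ('m \<Rightarrow> real \<Rightarrow> real) \<Rightarrow>
    real ^ ('m option) \<Rightarrow> bool" where
  "is_equilibrium H F \<nu> p \<longleftrightarrow>
    is_arg_max (\<lambda>q. expected_utility H F \<nu> p \<bullet> q) (\<lambda>q. q \<in> strategies) p"

text \<open>
  A cycle is driven by a sequence \<open>\<omega>\<close> of primitives and starts with an arrival to an empty system.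
  Counting starts at zero: \<open>workload \<omega> j\<close> is $X_{j+1}$.
\<close>

primrec workload ::
  "(nat \<Rightarrow> real \<times> 'm::finite option \<times> ('m \<Rightarrow> real)) \<Rightarrow> nat \<Rightarrow> real ^ 'm" where
  "workload \<omega> 0 = 0"
| "workload \<omega> (Suc j) = next_workload (workload \<omega> j) (\<omega> j)"

text \<open>
  \<open>Inf {} = 0\<close> on the natural numbers, so the value is meaningless if the system never empties.
\<close>

definition cycle_length ::
  "(nat \<Rightarrow> real \<times> 'm::finite option \<times> ('m \<Rightarrow> real)) \<Rightarrow> nat" where
  "cycle_length \<omega> = Inf {n. 1 \<le> n \<and> workload \<omega> n = 0}"

definition cycle_sum ::
  "('m::finite \<Rightarrow> real measure) \<Rightarrow> ('m \<Rightarrow> real \<Rightarrow> real) \<Rightarrow>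
    (nat \<Rightarrow> real \<times> 'm option \<times> ('m \<Rightarrow> real)) \<Rightarrow> real ^ ('m option)" where
  "cycle_sum F \<nu> \<omega> = (\<Sum>j<cycle_length \<omega>. mean_value F \<nu> (workload \<omega> j))"

definition cycle_law ::
  "real measure \<Rightarrow> ('m::finite \<Rightarrow> real measure) \<Rightarrow> ('m \<Rightarrow> real \<Rightarrow> real) \<Rightarrow>
    real ^ ('m option) \<Rightarrow> (real ^ ('m option)) measure" where
  "cycle_law H F \<nu> p = distr (PiM UNIV (\<lambda>_::nat. primitives H F p)) borel (cycle_sum F \<nu>)"

text \<open>The $\sigma$-algebra generated by $P_1, \dots, P_n$ and $G_1, \dots, G_{n-1}$.\<close>

definition past ::
  "'w measure \<Rightarrow> (nat \<Rightarrow> 'w \<Rightarrow> 'v::topological_space) \<Rightarrow> (nat \<Rightarrow> 'w \<Rightarrow> 'v) \<Rightarrow> nat \<Rightarrow> 'w measure" where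
  "past M P G n = sigma (space M)
    ({P i -` A \<inter> space M | i A. 1 \<le> i \<and> i \<le> n \<and> A \<in> sets borel} \<union>
     {G i -` A \<inter> space M | i A. 1 \<le> i \<and> i < n \<and> A \<in> sets borel})"

end

theory Submission
  imports Defs
begin

text \<open>
  Let \<open>L\<close> be the length of a regeneration cycle under the strategy \<open>p\<close> and \<open>u p\<close> the utility
  vector. The cycle formula says that the cycle sum has mean \<open>E L *\<^sub>R u p\<close>, so the algorithm moves,
  on average, along a positive multiple of \<open>u\<close>. The utility of a station depends on \<open>p\<close> only through
  the probability of joining that station: looked at alone, its workload is a Lindley recursion in
  which every arrival joins with this probability (\<open>utility_isolated\<close>). Hence \<open>u\<close> is the gradient of
  the separable potential \<open>\<Phi> p\<close>, the sum over the stations of the integrals of their utilities from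
  \<open>0\<close> to \<open>p $ Some m\<close> (\<open>utility_has_potential\<close>), and the critical points of \<open>\<Phi>\<close> on the simplex, the
  \<open>p\<close> with \<open>u p \<bullet> (q - p) \<le> 0\<close> for all strategies \<open>q\<close>, are exactly the equilibria. The algorithm is
  thus a projected stochastic gradient ascent on \<open>\<Phi>\<close>, with the step sizes multiplied by \<open>E L \<ge> 1\<close>.

  The noise enters before the projection, and a projected noisy step can decrease \<open>\<Phi>\<close> in mean to
  first order. What increases is the Moreau envelope, the maximum over \<open>y\<close> in the simplex of
  \<open>\<Phi> y - c * (norm (y - x))\<^sup>2\<close>: the projection is applied to the distance from the maximiser, which it
  does not increase, and the noise comes out linearly (\<open>envelope_projected_step\<close>). Taking
  expectations bounds the sum of \<open>\<gamma>\<^sub>n * E (d n)\<^sup>2\<close>, where \<open>d n\<close> is the distance of the \<open>n\<close>-th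
  iterate from its maximiser and vanishes exactly at critical points. That \<open>d n\<close> itself tends to
  \<open>0\<close> follows because the total length of the steps taken while \<open>d n \<ge> \<epsilon>\<close> has finite mean, so that
  \<open>d\<close> cannot keep crossing from \<open>\<epsilon>\<close> to a larger level (\<open>crossing_argument\<close>).

  This takes two facts about the queues, both uniform in the strategy: the cycle sum has a bounded
  second moment, and \<open>u\<close> is Lipschitz continuous. They rest on a Lyapunov function for the workload
  chain killed at the empty state (\<open>lyapunov\<close>). Fourth powers of the workloads have negative drift
  far out, because every queue is stable even if all customers join it; near the origin one adds a
  large multiple of a bounded function which decreases because, with a fixed positive probability,
  every workload falls by a fixed amount. Sums of linear functions over a cycle are then of
  quadratic size in the initial workload, and their squares, as well as their derivatives with
  respect to the strategy, of quartic size. The same operator calculus for the killed chain shows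
  that the stationary distribution exists, is unique and is the normalised occupation measure of a
  cycle.
\<close>

section \<open>Chains killed at a regeneration state\<close>

text \<open>
  A sequence of independent copies is its first entry followed by an independent sequence of the
  same law; all first-step analysis goes through this.
\<close>

lemma (in prob_space) nn_integral_stream_split:
  assumes [measurable]: "f \<in> borel_measurable (PiM (UNIV::nat set) (\<lambda>_. M))"
  shows "(\<integral>\<^sup>+\<omega>. f \<omega> \<partial>PiM UNIV (\<lambda>_::nat. M)) =
    (\<integral>\<^sup>+w. (\<integral>\<^sup>+\<omega>. f (case_nat w \<omega>) \<partial>PiM UNIV (\<lambda>_::nat. M)) \<partial>M)"
proof -
  interpret sequence_space M
    by (intro sequence_space.intro product_prob_space.intro product_sigma_finite.intro
          product_prob_space_axioms.intro prob_space_axioms sigma_finite_measure_axioms)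
  have "(\<integral>\<^sup>+\<omega>. f \<omega> \<partial>S) = (\<integral>\<^sup>+\<omega>. f \<omega> \<partial>distr (M \<Otimes>\<^sub>M S) S (\<lambda>(s, \<omega>). case_nat s \<omega>))"
    by (simp add: PiM_iter)
  also have "\<dots> = (\<integral>\<^sup>+p. f (case_nat (fst p) (snd p)) \<partial>(M \<Otimes>\<^sub>M S))"
    by (subst nn_integral_distr) (auto simp: case_prod_beta)
  also have "\<dots> = (\<integral>\<^sup>+w. (\<integral>\<^sup>+\<omega>. f (case_nat w \<omega>) \<partial>S) \<partial>M)"
    by (subst P.nn_integral_fst[symmetric]) auto
  finally show ?thesis .
qed

text \<open>
  A chain driven by independent inputs of law \<open>W\<close>, cut into cycles by its visits to the state \<open>0\<close>.
\<close>

locale regenerative_chain = prob_space W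
  for W :: "'w measure" +
  fixes step :: "'s::euclidean_space \<Rightarrow> 'w \<Rightarrow> 's"
  assumes step_measurable: "(\<lambda>(x, w). step x w) \<in> borel \<Otimes>\<^sub>M W \<rightarrow>\<^sub>M borel"
begin

lemma measurable_step [measurable (raw)]:
  assumes "f \<in> borel_measurable N" "g \<in> N \<rightarrow>\<^sub>M W"
  shows "(\<lambda>x. step (f x) (g x)) \<in> borel_measurable N"
  using measurable_compose[OF measurable_Pair[OF assms] step_measurable] by simp

text \<open>
  The transition operator of the chain killed when it reaches \<open>0\<close>, and its Green operator: \<open>green f x\<close>
  is the expected sum of \<open>f\<close> over the states before the first return to \<open>0\<close>, starting in \<open>x\<close>.
\<close>

definition killed :: "('s \<Rightarrow> ennreal) \<Rightarrow> 's \<Rightarrow> ennreal" where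
  "killed f x = (\<integral>\<^sup>+w. (if step x w = 0 then 0 else f (step x w)) \<partial>W)"

definition green :: "('s \<Rightarrow> ennreal) \<Rightarrow> 's \<Rightarrow> ennreal" where
  "green f x = (\<Sum>j. (killed ^^ j) f x)"

lemma measurable_killed [measurable]:
  assumes [measurable]: "f \<in> borel_measurable borel"
  shows "killed f \<in> borel_measurable borel"
  unfolding killed_def[abs_def] by measurable

lemma measurable_killed_pow [measurable]:
  assumes [measurable]: "f \<in> borel_measurable borel"
  shows "(killed ^^ j) f \<in> borel_measurable borel"
  by (induction j) auto

lemma measurable_green [measurable]:
  assumes [measurable]: "f \<in> borel_measurable borel"
  shows "green f \<in> borel_measurable borel"
  unfolding green_def[abs_def] by measurable

lemma killed_mono: "(\<And>x. f x \<le> g x) \<Longrightarrow> killed f x \<le> killed g x"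
  unfolding killed_def by (intro nn_integral_mono) auto

lemma killed_pow_mono: "(\<And>x. f x \<le> g x) \<Longrightarrow> (killed ^^ j) f x \<le> (killed ^^ j) g x"
  by (induction j arbitrary: x) (auto intro: killed_mono)

lemma green_mono: "(\<And>x. f x \<le> g x) \<Longrightarrow> green f x \<le> green g x"
  unfolding green_def by (intro suminf_le killed_pow_mono) auto

lemma killed_add:
  assumes [measurable]: "f \<in> borel_measurable borel" "g \<in> borel_measurable borel"
  shows "killed (\<lambda>x. f x + g x) x = killed f x + killed g x"
  unfolding killed_def by (subst nn_integral_add[symmetric]) (auto intro!: nn_integral_cong)

lemma killed_cmult:
  assumes [measurable]: "f \<in> borel_measurable borel"
  shows "killed (\<lambda>x. c * f x) x = c * killed f x"
  unfolding killed_def by (subst nn_integral_cmult[symmetric]) (auto intro!: nn_integral_cong)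

lemma killed_suminf:
  assumes [measurable]: "\<And>i. f i \<in> borel_measurable borel"
  shows "killed (\<lambda>x. \<Sum>i. f i x) x = (\<Sum>i. killed (f i) x)"
proof -
  have "killed (\<lambda>x. \<Sum>i. f i x) x = (\<integral>\<^sup>+w. (\<Sum>i. if step x w = 0 then 0 else f i (step x w)) \<partial>W)"
    unfolding killed_def by (intro nn_integral_cong) auto
  also have "\<dots> = (\<Sum>i. killed (f i) x)"
    unfolding killed_def by (intro nn_integral_suminf) auto
  finally show ?thesis .
qed

lemma killed_pow_add:
  assumes [measurable]: "f \<in> borel_measurable borel" "g \<in> borel_measurable borel"
  shows "(killed ^^ j) (\<lambda>x. f x + g x) x = (killed ^^ j) f x + (killed ^^ j) g x"
proof (induction j arbitrary: x)
  case (Suc j)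
  have "(killed ^^ j) (\<lambda>x. f x + g x) = (\<lambda>x. (killed ^^ j) f x + (killed ^^ j) g x)"
    using Suc by auto
  then show ?case by (simp add: killed_add)
qed simp

lemma killed_pow_cmult:
  assumes [measurable]: "f \<in> borel_measurable borel"
  shows "(killed ^^ j) (\<lambda>x. c * f x) x = c * (killed ^^ j) f x"
proof (induction j arbitrary: x)
  case (Suc j)
  have "(killed ^^ j) (\<lambda>x. c * f x) = (\<lambda>x. c * (killed ^^ j) f x)"
    using Suc by auto
  then show ?case by (simp add: killed_cmult)
qed simp

lemma green_add:
  assumes [measurable]: "f \<in> borel_measurable borel" "g \<in> borel_measurable borel"
  shows "green (\<lambda>x. f x + g x) x = green f x + green g x"
  unfolding green_def by (simp add: killed_pow_add suminf_add)

lemma green_cmult: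
  assumes [measurable]: "f \<in> borel_measurable borel"
  shows "green (\<lambda>x. c * f x) x = c * green f x"
  unfolding green_def by (simp add: killed_pow_cmult)

lemma green_last_step: "green f x = f x + green (killed f) x"
  unfolding green_def
  using suminf_offset[of "\<lambda>j. (killed ^^ j) f x" 1] by (simp add: funpow_swap1)

lemma green_first_step:
  assumes [measurable]: "f \<in> borel_measurable borel"
  shows "green f x = f x + killed (green f) x"
proof -
  have "killed (green f) x = (\<Sum>j. killed ((killed ^^ j) f) x)"
    unfolding green_def[abs_def] by (rule killed_suminf) auto
  then show ?thesis
    unfolding green_def using suminf_offset[of "\<lambda>j. (killed ^^ j) f x" 1] by simp
qed

text \<open>
  Iterating the hypothesis, the partial sums of the series plus the expected remaining value of \<open>h\<close>
  never exceed \<open>h x\<close>. Every bound on a cycle below is an application of this comparison.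
\<close>

lemma green_le_superharmonic:
  assumes [measurable]: "f \<in> borel_measurable borel" "h \<in> borel_measurable borel"
    and h: "\<And>x. f x + killed h x \<le> h x"
  shows "green f x \<le> h x"
proof -
  have key: "(\<Sum>j<n. (killed ^^ j) f x) + (killed ^^ n) h x \<le> h x" for n
  proof (induction n)
    case (Suc n)
    have "(\<Sum>j<Suc n. (killed ^^ j) f x) + (killed ^^ Suc n) h x
        = (\<Sum>j<n. (killed ^^ j) f x) + (killed ^^ n) (\<lambda>x. f x + killed h x) x"
      by (simp add: killed_pow_add add.assoc funpow_swap1)
    also have "\<dots> \<le> (\<Sum>j<n. (killed ^^ j) f x) + (killed ^^ n) h x"
      by (intro add_left_mono killed_pow_mono h)
    also note Suc
    finally show ?case .
  qed simp
  have "(\<Sum>j<n. (killed ^^ j) f x) \<le> h x" for n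
    using order_trans[OF _ key[of n], of "\<Sum>j<n. (killed ^^ j) f x"] by simp
  then show ?thesis
    unfolding green_def by (intro suminf_le_const) auto
qed

primrec path :: "'s \<Rightarrow> (nat \<Rightarrow> 'w) \<Rightarrow> nat \<Rightarrow> 's" where
  "path x \<omega> 0 = x"
| "path x \<omega> (Suc j) = step (path x \<omega> j) (\<omega> j)"

text \<open>
  Time \<open>0\<close> is not tested, so that cycles may start in \<open>0\<close>.
\<close>

definition alive :: "'s \<Rightarrow> (nat \<Rightarrow> 'w) \<Rightarrow> nat \<Rightarrow> bool" where
  "alive x \<omega> j \<longleftrightarrow> (\<forall>i\<in>{1..j}. path x \<omega> i \<noteq> 0)"

definition visit :: "('s \<Rightarrow> ennreal) \<Rightarrow> 's \<Rightarrow> (nat \<Rightarrow> 'w) \<Rightarrow> nat \<Rightarrow> ennreal" where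
  "visit f x \<omega> j = (if alive x \<omega> j then f (path x \<omega> j) else 0)"

lemma path_case_nat: "path x (case_nat w \<omega>) (Suc j) = path (step x w) \<omega> j"
  by (induction j) auto

lemma alive_case_nat: "alive x (case_nat w \<omega>) (Suc j) \<longleftrightarrow> step x w \<noteq> 0 \<and> alive (step x w) \<omega> j"
proof -
  have "{1..Suc j} = insert 1 (Suc ` {1..j})"
    by (auto simp: image_Suc_atLeastAtMost)
  then show ?thesis
    unfolding alive_def by (simp add: path_case_nat del: path.simps image_Suc_atLeastAtMost)
      (simp add: path_case_nat flip: One_nat_def)
qed

lemma visit_0: "visit f x \<omega> 0 = f x"
  by (simp add: visit_def alive_def)

lemma visit_case_nat:
  "visit f x (case_nat w \<omega>) (Suc j) = (if step x w = 0 then 0 else visit f (step x w) \<omega> j)"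
  unfolding visit_def alive_case_nat path_case_nat by auto

abbreviation stream :: "(nat \<Rightarrow> 'w) measure" where
  "stream \<equiv> PiM UNIV (\<lambda>_::nat. W)"

lemma measurable_path [measurable (raw)]:
  assumes [measurable]: "f \<in> borel_measurable N" "g \<in> N \<rightarrow>\<^sub>M stream"
  shows "(\<lambda>z. path (f z) (g z) j) \<in> borel_measurable N"
  by (induction j) auto

lemma measurable_alive [measurable (raw)]:
  assumes [measurable]: "f \<in> borel_measurable N" "g \<in> N \<rightarrow>\<^sub>M stream"
  shows "Measurable.pred N (\<lambda>z. alive (f z) (g z) j)"
  unfolding alive_def by measurable

lemma measurable_visit [measurable (raw)]:
  assumes [measurable]: "f \<in> borel_measurable N" "g \<in> N \<rightarrow>\<^sub>M stream" "h \<in> borel_measurable borel"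
  shows "(\<lambda>z. visit h (f z) (g z) j) \<in> borel_measurable N"
  unfolding visit_def by measurable

sublocale stream: prob_space stream
  by (intro prob_space_PiM prob_space_axioms)

lemma nn_integral_visit:
  assumes [measurable]: "f \<in> borel_measurable borel"
  shows "(\<integral>\<^sup>+\<omega>. visit f x \<omega> j \<partial>stream) = (killed ^^ j) f x"
proof (induction j arbitrary: x)
  case 0
  show ?case by (simp add: visit_0 stream.emeasure_space_1)
next
  case (Suc j)
  have "(\<integral>\<^sup>+\<omega>. visit f x \<omega> (Suc j) \<partial>stream)
      = (\<integral>\<^sup>+w. (if step x w = 0 then 0 else \<integral>\<^sup>+\<omega>. visit f (step x w) \<omega> j \<partial>stream) \<partial>W)"
    by (subst nn_integral_stream_split) (auto simp: visit_case_nat intro!: nn_integral_cong)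
  also have "\<dots> = killed ((killed ^^ j) f) x"
    by (simp only: Suc killed_def[of "(killed ^^ j) f"])
  finally show ?case by simp
qed

lemma nn_integral_sum_visit:
  assumes [measurable]: "f \<in> borel_measurable borel"
  shows "(\<integral>\<^sup>+\<omega>. (\<Sum>j. visit f x \<omega> j) \<partial>stream) = green f x"
  unfolding green_def by (subst nn_integral_suminf) (auto simp: nn_integral_visit)

lemma sum_visit_case_nat:
  "(\<Sum>j<Suc n. visit f x (case_nat w \<omega>) j)
    = f x + (if step x w = 0 then 0 else \<Sum>j<n. visit f (step x w) \<omega> j)"
  by (subst sum.lessThan_Suc_shift) (auto simp: visit_0 visit_case_nat)

lemma nn_integral_sum_visit_finite_le:
  assumes [measurable]: "f \<in> borel_measurable borel"
  shows "(\<integral>\<^sup>+\<omega>. (\<Sum>j<n. visit f x \<omega> j) \<partial>stream) \<le> green f x"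
  by (subst nn_integral_sum_visit[symmetric]) (auto intro!: nn_integral_mono sum_le_suminf)

text \<open>
  The cycle sum \<open>S\<close> is \<open>f x\<close> plus the cycle sum \<open>S'\<close> of the killed chain after one step, so that
  \<open>E S\<^sup>2 = (f x)\<^sup>2 + 2 * f x * E S' + E S'\<^sup>2\<close>. Since \<open>f x + E S' = green f x\<close>, the first two terms are
  at most \<open>2 * f x * green f x\<close>, and \<open>h\<close> dominates \<open>E S\<^sup>2\<close> by induction on the length at which the sum
  is truncated.
\<close>

lemma second_moment_le:
  assumes [measurable]: "f \<in> borel_measurable borel" "h \<in> borel_measurable borel"
    and h: "\<And>x. 2 * (f x * green f x) + killed h x \<le> h x"
  shows "(\<integral>\<^sup>+\<omega>. (\<Sum>j. visit f x \<omega> j)\<^sup>2 \<partial>stream) \<le> h x"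
proof -
  let ?S = "\<lambda>n x \<omega>. \<Sum>j<n. visit f x \<omega> j"
  have fin: "(\<integral>\<^sup>+\<omega>. (?S n x \<omega>)\<^sup>2 \<partial>stream) \<le> h x" for n
  proof (induction n arbitrary: x)
    case (Suc n)
    have "(\<integral>\<^sup>+\<omega>. (?S (Suc n) x \<omega>)\<^sup>2 \<partial>stream)
        = (\<integral>\<^sup>+w. (\<integral>\<^sup>+\<omega>. (f x + (if step x w = 0 then 0 else ?S n (step x w) \<omega>))\<^sup>2 \<partial>stream) \<partial>W)"
      by (subst nn_integral_stream_split) (auto simp: sum_visit_case_nat simp del: sum.lessThan_Suc)
    also have "\<dots> \<le> (\<integral>\<^sup>+w. (f x)\<^sup>2 + 2 * (f x * (if step x w = 0 then 0 else green f (step x w)))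
        + (if step x w = 0 then 0 else h (step x w)) \<partial>W)"
    proof (intro nn_integral_mono)
      fix w assume [measurable]: "w \<in> space W"
      show "(\<integral>\<^sup>+\<omega>. (f x + (if step x w = 0 then 0 else ?S n (step x w) \<omega>))\<^sup>2 \<partial>stream)
        \<le> (f x)\<^sup>2 + 2 * (f x * (if step x w = 0 then 0 else green f (step x w)))
        + (if step x w = 0 then 0 else h (step x w))"
      proof (cases "step x w = 0")
        case True
        then show ?thesis by (simp add: stream.emeasure_space_1)
      next
        case False
        have "(\<integral>\<^sup>+\<omega>. (f x + ?S n (step x w) \<omega>)\<^sup>2 \<partial>stream)
          = (\<integral>\<^sup>+\<omega>. (f x)\<^sup>2 + 2 * f x * ?S n (step x w) \<omega> + (?S n (step x w) \<omega>)\<^sup>2 \<partial>stream)"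
          by (intro nn_integral_cong) (simp add: power2_eq_square algebra_simps flip: mult_2)
        also have "\<dots> = (f x)\<^sup>2 + 2 * f x * (\<integral>\<^sup>+\<omega>. ?S n (step x w) \<omega> \<partial>stream)
          + (\<integral>\<^sup>+\<omega>. (?S n (step x w) \<omega>)\<^sup>2 \<partial>stream)"
          by (simp add: nn_integral_add nn_integral_cmult stream.emeasure_space_1)
        also have "\<dots> \<le> (f x)\<^sup>2 + 2 * f x * green f (step x w) + h (step x w)"
          by (intro add_mono mult_left_mono nn_integral_sum_visit_finite_le Suc) auto
        finally show ?thesis using False by (simp add: mult.assoc)
      qed
    qed
    also have "\<dots> = (f x)\<^sup>2 + 2 * (f x * killed (green f) x) + killed h x"
      by (simp add: nn_integral_add nn_integral_cmult killed_def emeasure_space_1)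
    also have "\<dots> \<le> 2 * (f x * green f x) + killed h x"
    proof (intro add_right_mono)
      have "(f x)\<^sup>2 + 2 * (f x * killed (green f) x) \<le> 2 * (f x)\<^sup>2 + 2 * (f x * killed (green f) x)"
        by (intro add_right_mono) (simp add: mult_2)
      then show "(f x)\<^sup>2 + 2 * (f x * killed (green f) x) \<le> 2 * (f x * green f x)"
        by (subst green_first_step) (auto simp: distrib_left power2_eq_square)
    qed
    also have "\<dots> \<le> h x" by (rule h)
    finally show ?case .
  qed simp
  have "(\<lambda>n. ?S n x \<omega>) \<longlonglongrightarrow> (\<Sum>j. visit f x \<omega> j)" for \<omega>
    by (intro summable_LIMSEQ) auto
  then have lim: "(\<lambda>n. (?S n x \<omega>)\<^sup>2) \<longlonglongrightarrow> (\<Sum>j. visit f x \<omega> j)\<^sup>2" for \<omega>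
    unfolding power2_eq_square by (intro tendsto_mult_ennreal) auto
  have inc: "incseq (\<lambda>n. (?S n x \<omega>)\<^sup>2)" for \<omega>
    by (intro incseq_SucI power_mono) auto
  have "(\<Sum>j. visit f x \<omega> j)\<^sup>2 = (SUP n. (?S n x \<omega>)\<^sup>2)" for \<omega>
    using LIMSEQ_SUP[OF inc[of \<omega>]] lim[of \<omega>] LIMSEQ_unique by blast
  then have "(\<integral>\<^sup>+\<omega>. (\<Sum>j. visit f x \<omega> j)\<^sup>2 \<partial>stream) = (SUP n. \<integral>\<^sup>+\<omega>. (?S n x \<omega>)\<^sup>2 \<partial>stream)"
    using inc by (simp add: nn_integral_monotone_convergence_SUP incseq_def le_fun_def)
  also have "\<dots> \<le> h x" by (intro SUP_least fin)
  finally show ?thesis .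
qed


section \<open>The stationary distribution of a regenerative chain\<close>

definition stationary :: "'s measure \<Rightarrow> bool" where
  "stationary \<pi> \<longleftrightarrow> prob_space \<pi> \<and> sets \<pi> = sets borel \<and>
    distr (\<pi> \<Otimes>\<^sub>M W) borel (\<lambda>(x, w). step x w) = \<pi>"

text \<open>
  The occupation measure of a cycle that starts in \<open>0\<close>, normalised by the mean cycle length: the
  density removes the pairs of time and input sequence at which the cycle is over.
\<close>

definition cycle_measure :: "'s measure" where
  "cycle_measure = distr
    (density (count_space UNIV \<Otimes>\<^sub>M stream)
      (\<lambda>(j, \<omega>). visit (\<lambda>_. inverse (green (\<lambda>_. 1) 0)) 0 \<omega> j))
    borel (\<lambda>(j, \<omega>). path 0 \<omega> j)"

definition return_prob :: "'s \<Rightarrow> ennreal" where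
  "return_prob x = (\<integral>\<^sup>+w. (if step x w = 0 then 1 else 0) \<partial>W)"

lemma measurable_return_prob [measurable]: "return_prob \<in> borel_measurable borel"
  unfolding return_prob_def[abs_def] by measurable

text \<open>
  The chain itself moves like the killed chain, except that mass arriving in \<open>0\<close> is kept there.
\<close>

lemma nn_integral_step:
  assumes [measurable]: "f \<in> borel_measurable borel"
  shows "(\<integral>\<^sup>+w. f (step x w) \<partial>W) = killed f x + f 0 * return_prob x"
  unfolding return_prob_def killed_def
  by (subst nn_integral_cmult[symmetric], measurable, subst nn_integral_add[symmetric], measurable)
     (auto intro!: nn_integral_cong)

lemma measurable_path_pair [measurable]:
  "(\<lambda>(j, \<omega>). path x \<omega> j) \<in> borel_measurable (count_space UNIV \<Otimes>\<^sub>M stream)"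
  by (rule measurable_pair_measure_countable1) auto

lemma measurable_visit_pair [measurable]:
  "f \<in> borel_measurable borel \<Longrightarrow>
    (\<lambda>(j, \<omega>). visit f x \<omega> j) \<in> borel_measurable (count_space UNIV \<Otimes>\<^sub>M stream)"
  by (rule measurable_pair_measure_countable1) auto

lemma sets_cycle_measure [simp, measurable_cong]: "sets cycle_measure = sets borel"
  by (simp add: cycle_measure_def)

lemma nn_integral_cycle_measure:
  assumes [measurable]: "f \<in> borel_measurable borel"
  shows "(\<integral>\<^sup>+x. f x \<partial>cycle_measure) = green f 0 / green (\<lambda>_. 1) 0"
proof -
  let ?c = "inverse (green (\<lambda>_. 1) 0)"
  have [measurable]: "(\<lambda>jw. f (path 0 (snd jw) (fst jw))) \<in> borel_measurable (count_space UNIV \<Otimes>\<^sub>M stream)"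
    using measurable_compose[OF measurable_path_pair assms] by (simp add: case_prod_beta)
  have [measurable]: "(\<lambda>jw. visit (\<lambda>_. ?c) 0 (snd jw) (fst jw)) \<in> borel_measurable (count_space UNIV \<Otimes>\<^sub>M stream)"
    using measurable_visit_pair[of "\<lambda>_. ?c" 0] by (simp add: case_prod_beta)
  have "(\<integral>\<^sup>+x. f x \<partial>cycle_measure) = (\<integral>\<^sup>+jw. visit (\<lambda>_. ?c) 0 (snd jw) (fst jw) * f (path 0 (snd jw) (fst jw))
      \<partial>(count_space UNIV \<Otimes>\<^sub>M stream))"
    unfolding cycle_measure_def
    by (subst nn_integral_distr) (auto simp: nn_integral_density case_prod_beta)
  also have "\<dots> = (\<integral>\<^sup>+j. \<integral>\<^sup>+\<omega>. visit (\<lambda>_. ?c) 0 \<omega> j * f (path 0 \<omega> j) \<partial>stream \<partial>count_space UNIV)"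
    by (subst stream.nn_integral_fst[symmetric]) auto
  also have "\<dots> = (\<integral>\<^sup>+j. \<integral>\<^sup>+\<omega>. visit (\<lambda>x. ?c * f x) 0 \<omega> j \<partial>stream \<partial>count_space UNIV)"
    by (intro nn_integral_cong) (auto simp: visit_def)
  also have "\<dots> = green (\<lambda>x. ?c * f x) 0"
    by (simp add: nn_integral_visit nn_integral_count_space_nat green_def)
  also have "\<dots> = green f 0 / green (\<lambda>_. 1) 0"
    unfolding green_cmult[OF assms] by (simp add: divide_ennreal_def mult.commute)
  finally show ?thesis .
qed

text \<open>
  Summed over a cycle, the probability of returning in the next step gives the probability of
  returning at all. It is \<open>1\<close> because summing \<open>1 = killed 1 + return_prob\<close> over a cycle and cancelling
  a finite term leaves only the first step.
\<close>

lemma green_return_prob: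
  assumes fin: "green (\<lambda>_. 1) 0 < \<infinity>"
  shows "green return_prob 0 = 1"
proof -
  have eq: "(1::ennreal) = killed (\<lambda>_. 1) x + return_prob x" for x
    using nn_integral_step[of "\<lambda>_. 1" x] by (simp add: emeasure_space_1)
  have "1 + green (killed (\<lambda>_. 1)) 0 = green (\<lambda>_. 1) 0"
    by (rule green_last_step[symmetric])
  also have "\<dots> = green (\<lambda>x. killed (\<lambda>_. 1) x + return_prob x) 0"
    by (simp flip: eq)
  also have "\<dots> = green return_prob 0 + green (killed (\<lambda>_. 1)) 0"
    by (simp add: green_add add.commute)
  finally have e: "1 + green (killed (\<lambda>_. 1)) 0 = green return_prob 0 + green (killed (\<lambda>_. 1)) 0" .
  have "green (killed (\<lambda>_. 1)) 0 \<le> green (\<lambda>_. 1) 0"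
    by (subst (2) green_last_step) simp
  with fin have "green (killed (\<lambda>_. 1)) 0 \<noteq> \<infinity>" by (auto simp: top_unique)
  with e show ?thesis
    by (metis add.commute ennreal_add_left_cancel infinity_ennreal_def)
qed

lemma green_one_ge_1: "1 \<le> green (\<lambda>_. 1) x"
  by (subst green_last_step) simp

lemma stationaryI:
  assumes prob: "prob_space \<pi>" and sets [measurable_cong]: "sets \<pi> = sets borel"
    and inv: "\<And>A. A \<in> sets borel \<Longrightarrow>
      (\<integral>\<^sup>+x. (\<integral>\<^sup>+w. indicator A (step x w) \<partial>W) \<partial>\<pi>) = emeasure \<pi> A"
  shows "stationary \<pi>"
proof -
  have "distr (\<pi> \<Otimes>\<^sub>M W) borel (\<lambda>(x, w). step x w) = \<pi>" (is "?D = _")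
  proof (rule measure_eqI)
    fix A assume "A \<in> sets ?D"
    then have A[measurable]: "A \<in> sets borel" by simp
    have sm: "(\<lambda>xw. step (fst xw) (snd xw)) \<in> borel_measurable (\<pi> \<Otimes>\<^sub>M W)"
      using step_measurable by (simp add: case_prod_beta cong: measurable_cong_sets)
    have "emeasure ?D A = (\<integral>\<^sup>+x. indicator A x \<partial>?D)" by simp
    also have "\<dots> = (\<integral>\<^sup>+xw. indicator A (step (fst xw) (snd xw)) \<partial>(\<pi> \<Otimes>\<^sub>M W))"
      using sm by (subst nn_integral_distr) (auto simp: case_prod_beta)
    also have "\<dots> = (\<integral>\<^sup>+x. \<integral>\<^sup>+w. indicator A (step x w) \<partial>W \<partial>\<pi>)"
      using sm by (subst nn_integral_fst[symmetric]) (auto intro: measurable_compose)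
    finally show "emeasure ?D A = emeasure \<pi> A" by (simp add: inv)
  qed (simp add: sets)
  with prob sets show ?thesis by (simp add: stationary_def)
qed

text \<open>
  Moving all states of a cycle one step ahead removes the initial \<open>0\<close> and adds the final one, which
  is reached with probability \<open>1\<close>.
\<close>

lemma stationary_cycle_measure:
  assumes fin: "green (\<lambda>_. 1) 0 < \<infinity>"
  shows "stationary cycle_measure"
proof (rule stationaryI)
  have n0: "green (\<lambda>_. 1) 0 \<noteq> 0" using green_one_ge_1[of 0] by auto
  show "prob_space cycle_measure"
  proof
    have "emeasure cycle_measure (space cycle_measure) = (\<integral>\<^sup>+x. 1 \<partial>cycle_measure)" by simp
    also have "\<dots> = 1" using fin n0
      by (subst nn_integral_cycle_measure) (auto simp: ennreal_divide_self)
    finally show "emeasure cycle_measure (space cycle_measure) = 1" .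
  qed
  fix A :: "'s set" assume [measurable]: "A \<in> sets borel"
  let ?f = "indicator A :: 's \<Rightarrow> ennreal"
  have "(\<integral>\<^sup>+x. \<integral>\<^sup>+w. ?f (step x w) \<partial>W \<partial>cycle_measure)
      = (\<integral>\<^sup>+x. killed ?f x + ?f 0 * return_prob x \<partial>cycle_measure)"
    by (simp add: nn_integral_step)
  also have "\<dots> = (green (killed ?f) 0 + ?f 0 * green return_prob 0) / green (\<lambda>_. 1) 0"
    by (subst nn_integral_cycle_measure) (auto simp: green_add green_cmult)
  also have "\<dots> = green ?f 0 / green (\<lambda>_. 1) 0"
    by (subst (3) green_last_step) (simp add: green_return_prob[OF fin] add.commute)
  also have "\<dots> = emeasure cycle_measure A"
    by (subst nn_integral_cycle_measure[symmetric]) auto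
  finally show "(\<integral>\<^sup>+x. \<integral>\<^sup>+w. ?f (step x w) \<partial>W \<partial>cycle_measure) = emeasure cycle_measure A" .
qed simp

lemma nn_integral_stationary:
  assumes st: "stationary \<pi>" and [measurable]: "f \<in> borel_measurable borel"
  shows "(\<integral>\<^sup>+x. f x \<partial>\<pi>) = (\<integral>\<^sup>+x. (\<integral>\<^sup>+w. f (step x w) \<partial>W) \<partial>\<pi>)"
proof -
  have [measurable_cong]: "sets \<pi> = sets borel" using st by (simp add: stationary_def)
  have sm: "(\<lambda>xw. step (fst xw) (snd xw)) \<in> borel_measurable (\<pi> \<Otimes>\<^sub>M W)"
    using step_measurable by (simp add: case_prod_beta cong: measurable_cong_sets)
  have "(\<integral>\<^sup>+x. f x \<partial>\<pi>) = (\<integral>\<^sup>+x. f x \<partial>distr (\<pi> \<Otimes>\<^sub>M W) borel (\<lambda>(x, w). step x w))"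
    using st by (simp add: stationary_def)
  also have "\<dots> = (\<integral>\<^sup>+xw. f (step (fst xw) (snd xw)) \<partial>(\<pi> \<Otimes>\<^sub>M W))"
    using sm by (subst nn_integral_distr) (auto simp: case_prod_beta)
  also have "\<dots> = (\<integral>\<^sup>+x. \<integral>\<^sup>+w. f (step x w) \<partial>W \<partial>\<pi>)"
    using sm by (subst nn_integral_fst[symmetric]) (auto intro: measurable_compose)
  finally show ?thesis .
qed

text \<open>
  If \<open>c\<close> is the mass that enters \<open>0\<close> in one step, stationarity reads
  \<open>\<pi> f = \<pi> (killed f) + c * f 0\<close>. Iterating, \<open>\<pi> f\<close> is \<open>c\<close> times a partial sum of \<open>green f 0\<close>, up to
  the term \<open>\<pi> (killed\<^sup>n f)\<close>, which vanishes in the limit as the chain returns to \<open>0\<close> from everywhere.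
  Thus \<open>\<pi>\<close> is a multiple of the occupation measure of a cycle.
\<close>

lemma stationary_unique:
  assumes fin: "\<And>x. green (\<lambda>_. 1) x < \<infinity>" and st: "stationary \<pi>"
  shows "\<pi> = cycle_measure"
proof -
  have sets[measurable_cong]: "sets \<pi> = sets borel" and "prob_space \<pi>"
    using st by (auto simp: stationary_def)
  interpret \<pi>: prob_space \<pi> by fact
  define c where "c = (\<integral>\<^sup>+x. return_prob x \<partial>\<pi>)"
  have one: "(\<integral>\<^sup>+x. f x \<partial>\<pi>) = (\<integral>\<^sup>+x. killed f x \<partial>\<pi>) + c * f 0"
    if [measurable]: "f \<in> borel_measurable borel" for f
    by (subst nn_integral_stationary[OF st])
       (simp_all add: nn_integral_step nn_integral_add nn_integral_cmult c_def mult.commute)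
  have iter: "(\<integral>\<^sup>+x. f x \<partial>\<pi>) = (\<integral>\<^sup>+x. (killed ^^ n) f x \<partial>\<pi>) + c * (\<Sum>j<n. (killed ^^ j) f 0)"
    if [measurable]: "f \<in> borel_measurable borel" for f n
  proof (induction n)
    case (Suc n)
    then show ?case
      using one[of "(killed ^^ n) f"] by (simp add: distrib_left ac_simps)
  qed simp
  have vanish: "(\<lambda>n. \<integral>\<^sup>+x. (killed ^^ n) (\<lambda>_. 1) x \<partial>\<pi>) \<longlonglongrightarrow> 0"
  proof -
    have le1: "(killed ^^ n) (\<lambda>_. 1) x \<le> 1" for n x
    proof (induction n arbitrary: x)
      case (Suc n)
      have "killed ((killed ^^ n) (\<lambda>_. 1)) x \<le> (\<integral>\<^sup>+w. 1 \<partial>W)"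
        unfolding killed_def[of "(killed ^^ n) (\<lambda>_. 1)"] by (intro nn_integral_mono) (use Suc in auto)
      then show ?case by (simp add: emeasure_space_1)
    qed simp
    have "(\<lambda>n. (killed ^^ n) (\<lambda>_. 1) x) \<longlonglongrightarrow> 0" for x
    proof -
      have f: "(\<Sum>n. (killed ^^ n) (\<lambda>_. 1) x) < \<infinity>" using fin[of x] by (simp add: green_def)
      have "(killed ^^ n) (\<lambda>_. 1) x = ennreal (enn2real ((killed ^^ n) (\<lambda>_. 1) x))" for n
        by (rule ennreal_enn2real[symmetric]) (use le1[of n x] in \<open>auto intro: le_less_trans\<close>)
      then have "summable (\<lambda>n. enn2real ((killed ^^ n) (\<lambda>_. 1) x))"
        using f by (intro summable_suminf_not_top) (auto simp: less_top)
      then have "(\<lambda>n. ennreal (enn2real ((killed ^^ n) (\<lambda>_. 1) x))) \<longlonglongrightarrow> ennreal 0"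
        by (intro tendsto_ennrealI summable_LIMSEQ_zero)
      then show ?thesis
        using \<open>\<And>n. (killed ^^ n) (\<lambda>_. 1) x = ennreal (enn2real ((killed ^^ n) (\<lambda>_. 1) x))\<close> by simp
    qed
    then have "(\<lambda>n. \<integral>\<^sup>+x. (killed ^^ n) (\<lambda>_. 1) x \<partial>\<pi>) \<longlonglongrightarrow> (\<integral>\<^sup>+x. 0 \<partial>\<pi>)"
      by (intro nn_integral_dominated_convergence[where w = "\<lambda>_. 1"])
         (auto simp: le1 \<pi>.emeasure_space_1)
    then show ?thesis by simp
  qed
  have eq: "(\<integral>\<^sup>+x. f x \<partial>\<pi>) = c * green f 0"
    if [measurable]: "f \<in> borel_measurable borel" and f1: "\<And>x. f x \<le> 1" for f
  proof (rule LIMSEQ_unique)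
    show "(\<lambda>n. (\<integral>\<^sup>+x. (killed ^^ n) f x \<partial>\<pi>) + c * (\<Sum>j<n. (killed ^^ j) f 0)) \<longlonglongrightarrow> (\<integral>\<^sup>+x. f x \<partial>\<pi>)"
      by (simp flip: iter)
    have "(\<lambda>n. \<integral>\<^sup>+x. (killed ^^ n) f x \<partial>\<pi>) \<longlonglongrightarrow> 0"
      by (rule tendsto_sandwich[OF _ _ tendsto_const vanish])
         (auto intro!: always_eventually nn_integral_mono killed_pow_mono f1)
    moreover have "c \<noteq> \<infinity>"
    proof -
      have "c \<le> (\<integral>\<^sup>+x. 1 \<partial>\<pi>)" using one[of "\<lambda>_. 1"] by simp
      then show ?thesis by (auto simp: \<pi>.emeasure_space_1 top_unique)
    qed
    then have "(\<lambda>n. c * (\<Sum>j<n. (killed ^^ j) f 0)) \<longlonglongrightarrow> c * green f 0"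
      unfolding green_def by (intro ennreal_tendsto_cmult summable_LIMSEQ) (auto simp: less_top)
    ultimately show "(\<lambda>n. (\<integral>\<^sup>+x. (killed ^^ n) f x \<partial>\<pi>) + c * (\<Sum>j<n. (killed ^^ j) f 0))
        \<longlonglongrightarrow> c * green f 0"
      using tendsto_add by fastforce
  qed
  have "c * green (\<lambda>_. 1) 0 = 1" using eq[of "\<lambda>_. 1"] by (simp add: \<pi>.emeasure_space_1)
  then have c: "c = inverse (green (\<lambda>_. 1) 0)"
    by (metis divide_ennreal_def ennreal_divide_self fin green_one_ge_1 infinity_ennreal_def mult.assoc
        mult.left_neutral mult.right_neutral not_one_le_zero)
  show ?thesis
  proof (rule measure_eqI)
    fix A assume "A \<in> sets \<pi>"
    then have [measurable]: "A \<in> sets borel" by (simp add: sets)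
    have "emeasure \<pi> A = (\<integral>\<^sup>+x. indicator A x \<partial>\<pi>)" by (simp add: sets)
    also have "\<dots> = c * green (indicator A) 0"
      by (rule eq) (auto simp: indicator_def)
    also have "\<dots> = (\<integral>\<^sup>+x. indicator A x \<partial>cycle_measure)"
      by (subst nn_integral_cycle_measure) (auto simp: c divide_ennreal_def mult.commute)
    finally show "emeasure \<pi> A = emeasure cycle_measure A" by simp
  qed (simp add: sets)
qed

definition return_time :: "'s \<Rightarrow> (nat \<Rightarrow> 'w) \<Rightarrow> nat" where
  "return_time x \<omega> = Inf {n. 1 \<le> n \<and> path x \<omega> n = 0}"

text \<open>
  A cycle of finite mean length ends almost surely, so that the infimum in the definition of
  \<open>return_time\<close> is over a nonempty set.
\<close>

lemma AE_alive_iff: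
  assumes fin: "green (\<lambda>_. 1) x < \<infinity>"
  shows "AE \<omega> in stream. \<forall>j. alive x \<omega> j \<longleftrightarrow> j < return_time x \<omega>"
proof -
  have "AE \<omega> in stream. (\<Sum>j. visit (\<lambda>_. 1) x \<omega> j) \<noteq> \<infinity>"
    by (intro nn_integral_PInf_AE) (use fin in \<open>auto simp: nn_integral_sum_visit less_top\<close>)
  then show ?thesis
  proof eventually_elim
    case (elim \<omega>)
    have "\<exists>j. \<not> alive x \<omega> j"
    proof (rule ccontr)
      assume "\<nexists>j. \<not> alive x \<omega> j"
      then have "(\<Sum>j. visit (\<lambda>_. 1) x \<omega> j) = (\<Sum>j::nat. 1)"
        by (simp add: visit_def)
      also have "\<dots> = (\<integral>\<^sup>+(j::nat). 1 \<partial>count_space UNIV)"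
        by (rule nn_integral_count_space_nat[symmetric])
      finally show False using elim by simp
    qed
    then have ne: "{n. 1 \<le> n \<and> path x \<omega> n = 0} \<noteq> {}"
      by (auto simp: alive_def)
    show ?case
    proof safe
      fix j assume "alive x \<omega> j"
      moreover from Inf_nat_def1[OF ne]
      have "1 \<le> return_time x \<omega>" "path x \<omega> (return_time x \<omega>) = 0"
        unfolding return_time_def by simp_all
      ultimately show "j < return_time x \<omega>"
        unfolding alive_def by (meson atLeastAtMost_iff not_le)
    next
      fix j assume j: "j < return_time x \<omega>"
      show "alive x \<omega> j"
        unfolding alive_def
      proof
        fix i assume "i \<in> {1..j}"
        show "path x \<omega> i \<noteq> 0"
        proof
          assume "path x \<omega> i = 0"
          with \<open>i \<in> {1..j}\<close> have "i \<in> {n. 1 \<le> n \<and> path x \<omega> n = 0}" by simp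
          then have "return_time x \<omega> \<le> i"
            unfolding return_time_def by (rule wellorder_Inf_le1)
          with j \<open>i \<in> {1..j}\<close> show False by simp
        qed
      qed
    qed
  qed
qed

lemma AE_sum_visit:
  assumes fin: "green (\<lambda>_. 1) x < \<infinity>"
  shows "AE \<omega> in stream. \<forall>f. (\<Sum>j. visit f x \<omega> j) = (\<Sum>j<return_time x \<omega>. f (path x \<omega> j))"
  using AE_alive_iff[OF fin]
proof eventually_elim
  case (elim \<omega>)
  show ?case
    by (intro allI, subst suminf_finite[of "{..<return_time x \<omega>}"]) (auto simp: visit_def elim)
qed

end

section \<open>Drift of a single station\<close>

lemma borel_measurable_vec_nth [measurable (raw)]:
  fixes f :: "'a \<Rightarrow> real ^ 'n::finite"
  assumes [measurable]: "f \<in> borel_measurable N"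
  shows "(\<lambda>x. f x $ i) \<in> borel_measurable N"
  by (rule measurable_compose[OF assms]) (intro borel_measurable_continuous_onI continuous_intros)

lemma borel_measurable_vec_lambda [measurable (raw)]:
  fixes f :: "'a \<Rightarrow> 'n::finite \<Rightarrow> real"
  assumes "\<And>i. (\<lambda>x. f x i) \<in> borel_measurable N"
  shows "(\<lambda>x. \<chi> i. f x i) \<in> borel_measurable N"
  by (subst borel_measurable_euclidean_space) (auto simp: Basis_vec_def inner_axis assms)

text \<open>
  The absolute values make the drift estimates below valid at every vector, so that the comparison
  principle, which asks for an inequality at all states, applies.
\<close>

definition total_work :: "real ^ 'm::finite \<Rightarrow> real" where
  "total_work x = (\<Sum>m\<in>UNIV. \<bar>x $ m\<bar>)"

lemma total_work_nonneg: "0 \<le> total_work x"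
  by (simp add: total_work_def sum_nonneg)

lemma total_work_0 [simp]: "total_work 0 = 0"
  by (simp add: total_work_def)

lemma measurable_total_work [measurable]: "total_work \<in> borel_measurable borel"
  unfolding total_work_def[abs_def] by measurable

lemma abs_component_le_total_work: "\<bar>x $ m\<bar> \<le> total_work x"
  unfolding total_work_def by (rule member_le_sum) auto

text \<open>
  Both sides are compared with the largest component.
\<close>

lemma power_total_work_le:
  fixes x :: "real ^ 'm::finite"
  assumes "r \<noteq> 0"
  shows "(1 + total_work x) ^ r \<le> (1 + CARD('m)) ^ r * (1 + (\<Sum>m\<in>UNIV. \<bar>x $ m\<bar> ^ r))"
proof -
  obtain m where m: "\<And>i. \<bar>x $ i\<bar> \<le> \<bar>x $ m\<bar>"
  proof -
    have "Max (range (\<lambda>i. \<bar>x $ i\<bar>)) \<in> range (\<lambda>i. \<bar>x $ i\<bar>)" by (rule Max_in) auto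
    then obtain m where "Max (range (\<lambda>i. \<bar>x $ i\<bar>)) = \<bar>x $ m\<bar>" by (rule imageE)
    then show ?thesis by (intro that[of m]) (metis Max_ge finite finite_imageI rangeI)
  qed
  let ?M = "max 1 \<bar>x $ m\<bar>"
  have "total_work x \<le> (\<Sum>i\<in>(UNIV::'m set). ?M)"
    unfolding total_work_def by (intro sum_mono max.coboundedI2 m)
  then have "1 + total_work x \<le> (1 + CARD('m)) * ?M"
    by (simp add: algebra_simps)
  then have "(1 + total_work x) ^ r \<le> ((1 + CARD('m)) * ?M) ^ r"
    by (intro power_mono) (use total_work_nonneg[of x] in auto)
  also have "\<dots> = (1 + CARD('m)) ^ r * ?M ^ r" by (simp add: power_mult_distrib)
  also have "?M ^ r \<le> 1 + \<bar>x $ m\<bar> ^ r" by (simp add: max_def)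
  also have "\<bar>x $ m\<bar> ^ r \<le> (\<Sum>m\<in>UNIV. \<bar>x $ m\<bar> ^ r)" by (rule member_le_sum) auto
  finally show ?thesis by (simp add: mult_left_mono)
qed

lemma power_le_total_work:
  fixes x :: "real ^ 'm::finite"
  shows "(\<Sum>m\<in>UNIV. \<bar>x $ m\<bar> ^ r) \<le> CARD('m) * (1 + total_work x) ^ r"
proof -
  have "(\<Sum>m\<in>UNIV. \<bar>x $ m\<bar> ^ r) \<le> (\<Sum>m\<in>(UNIV::'m set). (1 + total_work x) ^ r)"
    by (intro sum_mono power_mono order_trans[OF abs_component_le_total_work]) auto
  then show ?thesis by simp
qed

text \<open>
  In the binomial expansion of \<open>(x + \<eta>) ^ Suc r\<close> the term of degree \<open>r\<close> has a negative coefficient in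
  mean and absorbs the lower ones, up to a constant.
\<close>

lemma (in prob_space) polynomial_drift:
  fixes \<eta> :: "'a \<Rightarrow> real"
  assumes i1: "integrable M \<eta>" and i: "integrable M (\<lambda>w. (\<eta> w) ^ 4)"
    and neg: "expectation \<eta> < 0" and r: "r = 1 \<or> r = 3"
  shows "\<exists>d>0. \<exists>C\<ge>0. \<forall>x\<ge>0. integrable M (\<lambda>w. (x + \<eta> w) ^ Suc r) \<and>
    expectation (\<lambda>w. (x + \<eta> w) ^ Suc r) \<le> x ^ Suc r - d * x ^ r + C"
proof -
  have [measurable]: "\<eta> \<in> borel_measurable M" using i1 by auto
  have int: "integrable M (\<lambda>w. (\<eta> w) ^ k)" if "k \<le> 4" for k
  proof (rule Bochner_Integration.integrable_bound[of M "\<lambda>w. 1 + (\<eta> w) ^ 4"])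
    show "AE w in M. norm (\<eta> w ^ k) \<le> norm (1 + \<eta> w ^ 4)"
    proof (intro AE_I2)
      fix w
      have "\<bar>\<eta> w\<bar> ^ k \<le> 1 + \<bar>\<eta> w\<bar> ^ 4"
      proof (cases "\<bar>\<eta> w\<bar> \<le> 1")
        case True
        then show ?thesis by (simp add: power_le_one add_increasing2)
      next
        case False
        then have "\<bar>\<eta> w\<bar> ^ k \<le> \<bar>\<eta> w\<bar> ^ 4" by (intro power_increasing that) auto
        then show ?thesis by simp
      qed
      then show "norm (\<eta> w ^ k) \<le> norm (1 + \<eta> w ^ 4)" by (simp add: power_abs)
    qed
  qed (auto intro!: Bochner_Integration.integrable_add i)
  note int2 = int[of 2, simplified] and int3 = int[of 3, simplified]
  define d m2 m3 m4 where "d = - expectation \<eta>" and "m2 = expectation (\<lambda>w. (\<eta> w)\<^sup>2)"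
    and "m3 = \<bar>expectation (\<lambda>w. (\<eta> w) ^ 3)\<bar>" and "m4 = expectation (\<lambda>w. (\<eta> w) ^ 4)"
  have d: "0 < d" using neg by (simp add: d_def)
  have pos: "0 \<le> m2" "0 \<le> m3" "0 \<le> m4"
    by (auto simp: m2_def m3_def m4_def intro!: integral_nonneg)
  from r show ?thesis
  proof
    assume r: "r = 1"
    have e: "(x + \<eta> w)\<^sup>2 = x\<^sup>2 + 2 * x * \<eta> w + (\<eta> w)\<^sup>2" for x w
      by (simp add: power2_eq_square algebra_simps)
    have "integrable M (\<lambda>w. (x + \<eta> w)\<^sup>2)" for x
      unfolding e using i1 int2 by auto
    moreover have "expectation (\<lambda>w. (x + \<eta> w)\<^sup>2) = x\<^sup>2 - 2 * x * d + m2" for x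
      unfolding e using i1 int2 by (simp add: d_def m2_def prob_space)
    moreover have "0 \<le> d * x" if "0 \<le> x" for x
      using d that by simp
    ultimately have "\<forall>x\<ge>0. integrable M (\<lambda>w. (x + \<eta> w)\<^sup>2) \<and>
        expectation (\<lambda>w. (x + \<eta> w)\<^sup>2) \<le> x\<^sup>2 - d * x + m2"
      by (simp add: mult.commute mult.left_commute)
    with d pos show ?thesis
      unfolding r by (auto simp flip: numeral_2_eq_2)
  next
    assume r: "r = 3"
    have e: "(x + \<eta> w) ^ 4 = x ^ 4 + 4 * x ^ 3 * \<eta> w + 6 * x\<^sup>2 * (\<eta> w)\<^sup>2 + 4 * x * (\<eta> w) ^ 3 + (\<eta> w) ^ 4" for x w
      by (simp add: power4_eq_xxxx power3_eq_cube power2_eq_square algebra_simps)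
    have I: "integrable M (\<lambda>w. (x + \<eta> w) ^ 4)" for x
      unfolding e using i1 int2 int3 i by auto
    \<comment> \<open>a quadratic term \<open>a * x\<^sup>2\<close> is at most \<open>d * x ^ 3\<close> for \<open>x \<ge> a / d\<close>, and at most \<open>a ^ 3 / d\<^sup>2\<close> below\<close>
    define a C where "a = 6 * m2 + 4 * m3" and "C = a ^ 3 / d\<^sup>2 + 4 * m3 + m4"
    have bd: "expectation (\<lambda>w. (x + \<eta> w) ^ 4) \<le> x ^ 4 - d * x ^ 3 + C" if x: "0 \<le> x" for x
    proof -
      have "expectation (\<lambda>w. (x + \<eta> w) ^ 4)
          = x ^ 4 - 4 * x ^ 3 * d + 6 * x\<^sup>2 * m2 + 4 * x * expectation (\<lambda>w. (\<eta> w) ^ 3) + m4"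
        unfolding e using i1 int2 int3 i by (simp add: d_def m2_def m4_def prob_space)
      also have "4 * x * expectation (\<lambda>w. (\<eta> w) ^ 3) \<le> 4 * x * m3"
        unfolding m3_def using x by (intro mult_left_mono) auto
      also have "4 * x * m3 \<le> 4 * (1 + x\<^sup>2) * m3"
      proof (intro mult_right_mono mult_left_mono)
        have "0 \<le> (x - 1)\<^sup>2" by simp
        then show "x \<le> 1 + x\<^sup>2" using x by (simp add: power2_eq_square algebra_simps)
      qed (use pos in auto)
      finally have "expectation (\<lambda>w. (x + \<eta> w) ^ 4) \<le> x ^ 4 - 4 * x ^ 3 * d + a * x\<^sup>2 + 4 * m3 + m4"
        by (simp add: a_def algebra_simps)
      moreover have "a * x\<^sup>2 \<le> d * x ^ 3 + a ^ 3 / d\<^sup>2"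
      proof (cases "a \<le> d * x")
        case True
        then have "a * x\<^sup>2 \<le> (d * x) * x\<^sup>2" by (intro mult_right_mono) auto
        moreover have "0 \<le> a ^ 3 / d\<^sup>2" using pos by (auto simp: a_def)
        ultimately show ?thesis by (simp add: power3_eq_cube power2_eq_square mult.assoc)
      next
        case False
        have "x \<le> a / d" using False d by (simp add: pos_le_divide_eq mult.commute)
        then have "a * x\<^sup>2 \<le> a * (a / d)\<^sup>2"
          using x pos by (intro mult_left_mono power_mono) (auto simp: a_def)
        moreover have "0 \<le> d * x ^ 3" using d x by simp
        ultimately show ?thesis by (simp add: power3_eq_cube power2_eq_square)
      qed
      moreover have "0 \<le> d * x ^ 3" using d x by simp
      ultimately show ?thesis by (simp add: C_def algebra_simps)
    qed
    have "0 \<le> C" using pos by (auto simp: C_def a_def)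
    moreover have "Suc 3 = 4" by simp
    ultimately show ?thesis
      unfolding r using d I bd by metis
  qed
qed

lemma (in prob_space) prob_ge_mean:
  fixes X :: "'a \<Rightarrow> real"
  assumes "integrable M X"
  shows "0 < prob {w\<in>space M. expectation X \<le> X w}"
proof (rule ccontr)
  have [measurable]: "X \<in> borel_measurable M" using assms by auto
  assume "\<not> ?thesis"
  then have "prob {w\<in>space M. expectation X \<le> X w} = 0"
    by (simp add: zero_less_measure_iff)
  moreover have "{w\<in>space M. e \<le> X w} \<in> events" for e
    by (intro borel_measurable_le) simp_all
  ultimately have "AE w in M. \<not> expectation X \<le> X w"
    by (simp only: prob_Collect_eq_0)
  then have "AE w in M. X w < expectation X" by (auto simp: not_le)
  from expectation_less[OF assms this] show False by simp
qed

locale parallel_queues =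
  fixes lam :: real and \<mu> :: "'m::finite \<Rightarrow> real"
    and H :: "real measure" and F :: "'m \<Rightarrow> real measure"
  assumes lam: "0 < lam"
    and H_prob: "prob_space H" and H_sets [measurable_cong, simp]: "sets H = sets borel"
    and H_nonneg: "AE t in H. 0 \<le> t"
    and H_mean: "has_bochner_integral H (\<lambda>t. t) (1 / lam)"
    and F_prob: "\<And>m. prob_space (F m)" and F_sets [measurable_cong, simp]: "\<And>m. sets (F m) = sets borel"
    and F_nonneg: "\<And>m. AE y in F m. 0 \<le> y"
    and F_mean: "\<And>m. has_bochner_integral (F m) (\<lambda>y. y) (1 / \<mu> m)"
    and stable: "\<And>m. lam < \<mu> m"
    and moment4: "\<And>m. integrable (F m) (\<lambda>y. y ^ 4)"
begin

abbreviation services :: "('m \<Rightarrow> real) measure" where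
  "services \<equiv> PiM UNIV F"

text \<open>
  The part of the primitives of an arrival whose law does not depend on the strategy.
\<close>

abbreviation base :: "(real \<times> ('m \<Rightarrow> real)) measure" where
  "base \<equiv> H \<Otimes>\<^sub>M services"

sublocale H: prob_space H by (rule H_prob)

sublocale services: prob_space services
  by (intro prob_space_PiM F_prob)

sublocale F: product_prob_space F UNIV
  by (intro product_prob_space.intro product_sigma_finite.intro product_prob_space_axioms.intro
       prob_space_imp_sigma_finite F_prob)

sublocale base: pair_prob_space H services ..

lemma measurable_base_arrival [measurable]: "fst \<in> borel_measurable base"
  using measurable_fst[of H services] by (simp cong: measurable_cong_sets)

lemma measurable_base_service [measurable]: "(\<lambda>ty. snd ty m) \<in> borel_measurable base"
  by measurable

lemma base_arrival: "distr base H fst = H"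
  by (simp add: services.distr_pair_fst)

lemma base_service: "distr base (F m) (\<lambda>ty. snd ty m) = F m"
proof -
  have "distr base (F m) (\<lambda>ty. snd ty m) = distr (distr base services snd) (F m) (\<lambda>y. y m)"
    by (subst distr_distr) (auto simp: comp_def)
  also have "distr base services snd = services"
  proof (rule measure_eqI)
    fix A assume "A \<in> sets (distr base services snd)"
    then have A: "A \<in> sets services" by simp
    have "snd -` A \<inter> space base = space H \<times> A"
      using sets.sets_into_space[OF A] by (auto simp: space_pair_measure)
    then show "emeasure (distr base services snd) A = emeasure services A"
      using A services.emeasure_pair_measure_Times[of "space H" H A] sets.top[of H]
      by (simp add: emeasure_distr H.emeasure_space_1)
  qed simp
  also have "distr services (F m) (\<lambda>y. y m) = F m"
    by (intro F.PiM_component) auto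
  finally show ?thesis .
qed

lemma integrable_base_service:
  assumes "integrable (F m) g"
  shows "integrable base (\<lambda>ty. g (snd ty m) :: real)"
  by (rule integrable_distr[of _ base "F m"]) (auto simp: base_service assms)

lemma integral_base_service:
  assumes "g \<in> borel_measurable (F m)"
  shows "(\<integral>ty. g (snd ty m) \<partial>base) = (\<integral>y. g y \<partial>F m :: real)"
  using integral_distr[of "\<lambda>ty. snd ty m" base "F m" g] assms by (simp add: base_service)

lemma integrable_base_arrival:
  assumes "integrable H g"
  shows "integrable base (\<lambda>ty. g (fst ty) :: real)"
  by (rule integrable_distr[of _ base H]) (auto simp: base_arrival assms)

lemma integral_base_arrival:
  assumes "g \<in> borel_measurable H"
  shows "(\<integral>ty. g (fst ty) \<partial>base) = (\<integral>t. g t \<partial>H :: real)"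
  using integral_distr[of fst base H g] assms by (simp add: base_arrival)

lemma AE_base_arrival: "AE ty in base. 0 \<le> fst ty"
proof -
  have "AE t in distr base H fst. 0 \<le> t" unfolding base_arrival by (rule H_nonneg)
  then show ?thesis by (subst (asm) AE_distr_iff) auto
qed

lemma AE_base_service: "AE ty in base. 0 \<le> snd ty m"
proof -
  have "AE t in distr base (F m) (\<lambda>ty. snd ty m). 0 \<le> t" unfolding base_service by (rule F_nonneg)
  then show ?thesis by (subst (asm) AE_distr_iff) auto
qed

text \<open>
  Inter-arrival times are only assumed to have a mean. Truncated at a large level they have all
  moments, and still exceed the service times in mean; shortening them only makes the queue longer.
\<close>

lemma mean_truncated_arrival: "\<exists>c>0. 1 / \<mu> m < (\<integral>t. min t c \<partial>H)"
proof -
  have "(\<lambda>n. \<integral>t. min t (real n) \<partial>H) \<longlonglongrightarrow> (\<integral>t. t \<partial>H)"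
  proof (rule integral_dominated_convergence[where w = "\<lambda>t. \<bar>t\<bar>"])
    show "AE t in H. (\<lambda>n. min t (real n)) \<longlonglongrightarrow> t"
    proof (intro AE_I2 tendsto_eventually)
      fix t :: real
      obtain N where "t \<le> real N" using real_arch_simple by blast
      then show "\<forall>\<^sub>F n in sequentially. min t (real n) = t"
        by (intro eventually_sequentiallyI[of N]) (auto simp: min_def)
    qed
    show "integrable H (\<lambda>t. \<bar>t\<bar>)" using H_mean by (auto simp: has_bochner_integral_iff)
  qed auto
  moreover have "(\<integral>t. t \<partial>H) = 1 / lam" using H_mean by (auto simp: has_bochner_integral_iff)
  moreover have "1 / \<mu> m < 1 / lam"
    using lam stable[of m] by (intro divide_strict_left_mono) auto
  ultimately have "\<forall>\<^sub>F n in sequentially. 1 / \<mu> m < (\<integral>t. min t (real n) \<partial>H)"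
    by (metis order_tendstoD(1))
  then obtain N where "\<And>n. N \<le> n \<Longrightarrow> 1 / \<mu> m < (\<integral>t. min t (real n) \<partial>H)"
    by (auto simp: eventually_sequentially)
  from this[of "Suc N"] show ?thesis by (intro exI[of _ "real (Suc N)"]) auto
qed

text \<open>
  The recursion considered is that of a station which every customer joins. It dominates the workload
  of the station under every strategy, which makes the estimates uniform. The exponent \<open>Suc r\<close> is even,
  so that the power of \<open>max 0 z\<close> is at most that of \<open>z\<close>.
\<close>

lemma station_drift:
  assumes r: "r = 1 \<or> r = 3"
  shows "\<exists>d>0. \<exists>C\<ge>0. \<forall>x\<ge>0. 0 \<le> x ^ Suc r - d * x ^ r + C \<and>
    (\<integral>\<^sup>+ty. ennreal (max 0 (x + snd ty m - fst ty) ^ Suc r) \<partial>base)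
    \<le> ennreal (x ^ Suc r - d * x ^ r + C)"
proof -
  obtain c where c: "0 < c" "1 / \<mu> m < (\<integral>t. min t c \<partial>H)" using mean_truncated_arrival by blast
  \<comment> \<open>the net input of work, with the inter-arrival time truncated\<close>
  define \<eta> where "\<eta> ty = snd ty m - min (fst ty) c" for ty :: "real \<times> ('m \<Rightarrow> real)"
  have [measurable]: "\<eta> \<in> borel_measurable base" unfolding \<eta>_def[abs_def] by measurable
  have iF: "integrable (F m) (\<lambda>y. y)" "(\<integral>y. y \<partial>F m) = 1 / \<mu> m"
    using F_mean[of m] by (auto simp: has_bochner_integral_iff)
  have iH: "integrable H (\<lambda>t. min t c)"
    by (rule H.integrable_const_bound[of _ c]) (use H_nonneg c in auto)
  have iS: "integrable base (\<lambda>ty. snd ty m)" "(\<integral>ty. snd ty m \<partial>base) = 1 / \<mu> m"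
    by (rule integrable_base_service[OF iF(1)]) (subst integral_base_service, simp, rule iF(2))
  have it: "integrable base (\<lambda>ty. min (fst ty) c)"
    "(\<integral>ty. min (fst ty) c \<partial>base) = (\<integral>t. min t c \<partial>H)"
    by (rule integrable_base_arrival[OF iH]) (rule integral_base_arrival, simp)
  have i1: "integrable base \<eta>"
    unfolding \<eta>_def[abs_def] by (intro Bochner_Integration.integrable_diff iS it)
  have "(\<integral>ty. \<eta> ty \<partial>base) = 1 / \<mu> m - (\<integral>t. min t c \<partial>H)"
    unfolding \<eta>_def[abs_def] Bochner_Integration.integral_diff[OF iS(1) it(1)] iS it ..
  then have neg: "(\<integral>ty. \<eta> ty \<partial>base) < 0" using c by simp
  have i4: "integrable base (\<lambda>ty. (\<eta> ty) ^ 4)"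
  proof (rule Bochner_Integration.integrable_bound[of base "\<lambda>ty. 8 * (snd ty m) ^ 4 + 8 * c ^ 4"])
    show "integrable base (\<lambda>ty. 8 * (snd ty m) ^ 4 + 8 * c ^ 4)"
      using integrable_base_service[OF moment4[of m]] by simp
    show "AE ty in base. norm (\<eta> ty ^ 4) \<le> norm (8 * snd ty m ^ 4 + 8 * c ^ 4)"
      using AE_base_arrival AE_base_service[of m]
    proof eventually_elim
      case (elim ty)
      have q: "(a - b) ^ 4 \<le> 8 * a ^ 4 + 8 * b ^ 4" for a b :: real
      proof -
        have "(a - b)\<^sup>2 \<le> 2 * (a\<^sup>2 + b\<^sup>2)"
          using zero_le_power2[of "a + b"] by (simp add: power2_eq_square algebra_simps)
        then have "((a - b)\<^sup>2)\<^sup>2 \<le> (2 * (a\<^sup>2 + b\<^sup>2))\<^sup>2" by (intro power_mono) auto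
        also have "\<dots> \<le> 8 * (a\<^sup>2)\<^sup>2 + 8 * (b\<^sup>2)\<^sup>2"
          using zero_le_power2[of "a\<^sup>2 - b\<^sup>2"] by (simp add: power2_eq_square algebra_simps)
        finally show ?thesis by (simp flip: power_mult)
      qed
      have "(\<eta> ty) ^ 4 \<le> 8 * snd ty m ^ 4 + 8 * (min (fst ty) c) ^ 4"
        unfolding \<eta>_def by (rule q)
      also have "(min (fst ty) c) ^ 4 \<le> c ^ 4" using elim c by (intro power_mono) auto
      finally show ?case using c by (simp add: abs_of_nonneg)
    qed
  qed auto
  obtain d C where d: "0 < d" "0 \<le> C" and bd: "\<And>x. 0 \<le> x \<Longrightarrow> integrable base (\<lambda>w. (x + \<eta> w) ^ Suc r)"
    "\<And>x. 0 \<le> x \<Longrightarrow> (\<integral>w. (x + \<eta> w) ^ Suc r \<partial>base) \<le> x ^ Suc r - d * x ^ r + C"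
    using base.polynomial_drift[OF i1 i4 neg r] by blast
  have "0 \<le> x ^ Suc r - d * x ^ r + C \<and>
    (\<integral>\<^sup>+ty. ennreal (max 0 (x + snd ty m - fst ty) ^ Suc r) \<partial>base)
    \<le> ennreal (x ^ Suc r - d * x ^ r + C)" if x: "0 \<le> x" for x
  proof -
    have ev: "even (Suc r)" using r by auto
    have "max 0 (x + snd ty m - fst ty) ^ Suc r \<le> (x + \<eta> ty) ^ Suc r" for ty
    proof (cases "x + snd ty m - fst ty \<le> 0")
      case True
      then show ?thesis using zero_le_even_power[OF ev] by (simp add: max_def)
    next
      case False
      then have "(x + snd ty m - fst ty) ^ Suc r \<le> (x + \<eta> ty) ^ Suc r"
        by (intro power_mono) (auto simp: \<eta>_def)
      then show ?thesis using False by (simp add: max_def)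
    qed
    then have "(\<integral>\<^sup>+ty. ennreal (max 0 (x + snd ty m - fst ty) ^ Suc r) \<partial>base)
        \<le> (\<integral>\<^sup>+ty. ennreal ((x + \<eta> ty) ^ Suc r) \<partial>base)"
      by (intro nn_integral_mono ennreal_leI)
    also have "\<dots> = ennreal (\<integral>w. (x + \<eta> w) ^ Suc r \<partial>base)"
      using bd(1)[OF x] zero_le_even_power[OF ev] by (intro nn_integral_eq_integral) auto
    also have "\<dots> \<le> ennreal (x ^ Suc r - d * x ^ r + C)"
      by (intro ennreal_leI bd(2) x)
    finally have "(\<integral>\<^sup>+ty. ennreal (max 0 (x + snd ty m - fst ty) ^ Suc r) \<partial>base)
        \<le> ennreal (x ^ Suc r - d * x ^ r + C)" .
    moreover have "0 \<le> (\<integral>w. (x + \<eta> w) ^ Suc r \<partial>base)"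
      by (intro Bochner_Integration.integral_nonneg zero_le_even_power[OF ev])
    with bd(2)[OF x] have "0 \<le> x ^ Suc r - d * x ^ r + C" by linarith
    ultimately show ?thesis by blast
  qed
  with d show ?thesis by blast
qed


section \<open>Lyapunov functions for the workload vector\<close>

lemma sets_primitives [measurable_cong]:
  "sets (primitives H F p) = sets (borel \<Otimes>\<^sub>M count_space UNIV \<Otimes>\<^sub>M PiM UNIV (\<lambda>_. borel))"
  unfolding primitives_def by (intro sets_pair_measure_cong sets_PiM_cong) auto

lemma measurable_next_workload:
  "(\<lambda>(x, w). next_workload x w) \<in>
    borel \<Otimes>\<^sub>M (borel \<Otimes>\<^sub>M count_space UNIV \<Otimes>\<^sub>M PiM (UNIV::'m set) (\<lambda>_. borel)) \<rightarrow>\<^sub>M borel"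
  unfolding next_workload_def case_prod_beta by measurable

lemma prob_space_primitives: "prob_space (primitives H F p)"
  unfolding primitives_def
  by (intro prob_space_pair H_prob services.prob_space_axioms prob_space_measure_pmf)

lemma workload_chain: "regenerative_chain (primitives H F p) next_workload"
proof (intro regenerative_chain.intro regenerative_chain_axioms.intro prob_space_primitives)
  show "(\<lambda>(x, w). next_workload x w) \<in> borel \<Otimes>\<^sub>M primitives H F p \<rightarrow>\<^sub>M borel"
    using measurable_next_workload
    unfolding measurable_cong_sets[OF sets_pair_measure_cong[OF refl sets_primitives] refl] .
qed

abbreviation kill :: "real ^ ('m option) \<Rightarrow> (real ^ 'm \<Rightarrow> ennreal) \<Rightarrow> real ^ 'm \<Rightarrow> ennreal" where
  "kill p \<equiv> regenerative_chain.killed (primitives H F p) next_workload"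

abbreviation Green :: "real ^ ('m option) \<Rightarrow> (real ^ 'm \<Rightarrow> ennreal) \<Rightarrow> real ^ 'm \<Rightarrow> ennreal" where
  "Green p \<equiv> regenerative_chain.green (primitives H F p) next_workload"

lemma base_to_primitives [measurable]:
  "(\<lambda>ty. (fst ty, a, snd ty)) \<in> base \<rightarrow>\<^sub>M primitives H F p"
  by (simp add: measurable_cong_sets[OF refl sets_primitives])

text \<open>
  Conditioning on the action shows that transition probabilities are linear in the strategy.
\<close>

lemma nn_integral_primitives:
  assumes p: "p \<in> strategies" and \<phi>: "\<phi> \<in> borel_measurable (primitives H F p)"
  shows "(\<integral>\<^sup>+w. \<phi> w \<partial>primitives H F p) =
    (\<Sum>a\<in>UNIV. ennreal (p $ a) * (\<integral>\<^sup>+ty. \<phi> (fst ty, a, snd ty) \<partial>base))"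
proof -
  let ?E = "embed_pmf (\<lambda>a. p $ a)"
  have pmf: "pmf ?E a = p $ a" for a
  proof (rule pmf_embed_pmf)
    show "0 \<le> p $ x" for x using p by (simp add: strategies_def)
    show "(\<integral>\<^sup>+x. ennreal (p $ x) \<partial>count_space UNIV) = 1"
      using p by (simp add: nn_integral_count_space_finite strategies_def sum_ennreal)
  qed
  interpret pmf_services: pair_prob_space "measure_pmf ?E" services ..
  have \<phi>'[measurable]: "\<phi> \<in> borel_measurable (H \<Otimes>\<^sub>M measure_pmf ?E \<Otimes>\<^sub>M services)"
    using \<phi> by (simp add: primitives_def)
  have [measurable]: "(\<lambda>ty. \<phi> (fst ty, a, snd ty)) \<in> borel_measurable base" for a
    by (rule measurable_compose[OF base_to_primitives \<phi>])
  have [measurable]: "(\<lambda>y. \<phi> (t, a, y)) \<in> borel_measurable services" if "t \<in> space H" for t a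
    using that by measurable
  have [measurable]: "(\<lambda>t. \<integral>\<^sup>+y. \<phi> (t, a, y) \<partial>services) \<in> borel_measurable H" for a
    by (rule services.borel_measurable_nn_integral) (simp add: case_prod_beta)
  have "(\<integral>\<^sup>+w. \<phi> w \<partial>primitives H F p) = (\<integral>\<^sup>+t. \<integral>\<^sup>+ay. \<phi> (t, ay) \<partial>(measure_pmf ?E \<Otimes>\<^sub>M services) \<partial>H)"
    unfolding primitives_def by (rule pmf_services.nn_integral_fst[symmetric]) simp
  also have "\<dots> = (\<integral>\<^sup>+t. \<integral>\<^sup>+a. \<integral>\<^sup>+y. \<phi> (t, a, y) \<partial>services \<partial>measure_pmf ?E \<partial>H)"
    by (intro nn_integral_cong, subst services.nn_integral_fst[symmetric]) simp_all
  also have "\<dots> = (\<integral>\<^sup>+t. (\<Sum>a\<in>UNIV. ennreal (p $ a) * (\<integral>\<^sup>+y. \<phi> (t, a, y) \<partial>services)) \<partial>H)"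
    by (intro nn_integral_cong) (simp add: nn_integral_measure_pmf nn_integral_count_space_finite pmf)
  also have "\<dots> = (\<Sum>a\<in>UNIV. ennreal (p $ a) * (\<integral>\<^sup>+t. \<integral>\<^sup>+y. \<phi> (t, a, y) \<partial>services \<partial>H))"
    by (simp add: nn_integral_sum nn_integral_cmult)
  also have "\<dots> = (\<Sum>a\<in>UNIV. ennreal (p $ a) * (\<integral>\<^sup>+ty. \<phi> (fst ty, a, snd ty) \<partial>base))"
    by (simp add: services.nn_integral_fst[symmetric])
  finally show ?thesis .
qed

lemma sum_strategy: "p \<in> strategies \<Longrightarrow> (\<Sum>a\<in>UNIV. ennreal (p $ a)) = 1"
  by (simp add: strategies_def sum_ennreal)

lemma nn_integral_primitives_le:
  assumes p: "p \<in> strategies" and \<phi>: "\<phi> \<in> borel_measurable (primitives H F p)"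
    and le: "\<And>a. AE ty in base. \<phi> (fst ty, a, snd ty) \<le> \<psi> ty"
  shows "(\<integral>\<^sup>+w. \<phi> w \<partial>primitives H F p) \<le> (\<integral>\<^sup>+ty. \<psi> ty \<partial>base)"
proof -
  have "(\<integral>\<^sup>+w. \<phi> w \<partial>primitives H F p) \<le> (\<Sum>a\<in>UNIV. ennreal (p $ a) * (\<integral>\<^sup>+ty. \<psi> ty \<partial>base))"
    unfolding nn_integral_primitives[OF p \<phi>]
    by (intro sum_mono mult_left_mono nn_integral_mono_AE le) auto
  also have "\<dots> = (\<integral>\<^sup>+ty. \<psi> ty \<partial>base)"
    by (simp add: sum_distrib_right[symmetric] sum_strategy[OF p])
  finally show ?thesis .
qed

lemma measurable_next [measurable]:
  "next_workload x \<in> borel_measurable (primitives H F p)"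
  using regenerative_chain.measurable_step[OF workload_chain, of "\<lambda>_. x" _ "\<lambda>w. w"] by simp

lemma kill_eq_integral: "kill p f x = (\<integral>\<^sup>+w. (if next_workload x w = 0 then 0 else f (next_workload x w)) \<partial>primitives H F p)"
  by (rule regenerative_chain.killed_def[OF workload_chain])

definition kill_action :: "'m option \<Rightarrow> (real ^ 'm \<Rightarrow> ennreal) \<Rightarrow> real ^ 'm \<Rightarrow> ennreal" where
  "kill_action a f x = (\<integral>\<^sup>+ty. (let x' = next_workload x (fst ty, a, snd ty) in if x' = 0 then 0 else f x') \<partial>base)"

lemma kill_eq_sum:
  assumes "p \<in> strategies" and [measurable]: "f \<in> borel_measurable borel"
  shows "kill p f x = (\<Sum>a\<in>UNIV. ennreal (p $ a) * kill_action a f x)"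
  unfolding kill_eq_integral kill_action_def Let_def by (rule nn_integral_primitives[OF assms(1)]) measurable

lemma next_le: "next_workload x (t, a, y) $ m \<le> max 0 (\<bar>x $ m\<bar> + y m - t)" if "0 \<le> y m"
  using that by (auto simp: next_workload_def)

lemma next_nonneg: "0 \<le> next_workload x w $ m"
  by (auto simp: next_workload_def split: prod.split)

lemma power_sum_drift:
  assumes r: "r = 1 \<or> r = 3"
  shows "\<exists>d>0. \<exists>C\<ge>0. \<forall>p\<in>strategies. \<forall>x.
    0 \<le> (\<Sum>m\<in>UNIV. \<bar>x $ m\<bar> ^ Suc r) - d * (\<Sum>m\<in>UNIV. \<bar>x $ m\<bar> ^ r) + C \<and>
    (\<integral>\<^sup>+w. ennreal (\<Sum>m\<in>UNIV. \<bar>next_workload x w $ m\<bar> ^ Suc r) \<partial>primitives H F p)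
    \<le> ennreal ((\<Sum>m\<in>UNIV. \<bar>x $ m\<bar> ^ Suc r) - d * (\<Sum>m\<in>UNIV. \<bar>x $ m\<bar> ^ r) + C)"
proof -
  define Q where "Q m d C \<longleftrightarrow> 0 < d \<and> 0 \<le> C \<and> (\<forall>x\<ge>0. 0 \<le> x ^ Suc r - d * x ^ r + C \<and>
      (\<integral>\<^sup>+ty. ennreal (max 0 (x + snd ty m - fst ty) ^ Suc r) \<partial>base)
      \<le> ennreal (x ^ Suc r - d * x ^ r + C))" for m d C
  have "\<forall>m. \<exists>d C. Q m d C"
    using station_drift[OF r] unfolding Q_def by blast
  then obtain d C where "\<And>m. Q m (d m) (C m)" by metis
  then have d: "\<And>m. 0 < d m" and C: "\<And>m. 0 \<le> C m" and
    nn: "\<And>m x. 0 \<le> x \<Longrightarrow> 0 \<le> x ^ Suc r - d m * x ^ r + C m" and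
    bd: "\<And>m x. 0 \<le> x \<Longrightarrow> (\<integral>\<^sup>+ty. ennreal (max 0 (x + snd ty m - fst ty) ^ Suc r) \<partial>base)
      \<le> ennreal (x ^ Suc r - d m * x ^ r + C m)"
    unfolding Q_def by blast+
  define d0 where "d0 = Min (range d)"
  have d0: "0 < d0" "\<And>m. d0 \<le> d m" using d by (auto simp: d0_def)
  have "0 \<le> (\<Sum>m\<in>UNIV. \<bar>x $ m\<bar> ^ Suc r) - d0 * (\<Sum>m\<in>UNIV. \<bar>x $ m\<bar> ^ r) + (\<Sum>m\<in>UNIV. C m) \<and>
    (\<integral>\<^sup>+w. ennreal (\<Sum>m\<in>UNIV. \<bar>next_workload x w $ m\<bar> ^ Suc r) \<partial>primitives H F p)
    \<le> ennreal ((\<Sum>m\<in>UNIV. \<bar>x $ m\<bar> ^ Suc r) - d0 * (\<Sum>m\<in>UNIV. \<bar>x $ m\<bar> ^ r) + (\<Sum>m\<in>UNIV. C m))"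
    if p: "p \<in> strategies" for p x
  proof -
    have ae: "AE ty in base. \<forall>m. 0 \<le> snd ty m"
      by (subst AE_all_countable) (intro allI AE_base_service)
    have "(\<integral>\<^sup>+w. ennreal (\<Sum>m\<in>UNIV. \<bar>next_workload x w $ m\<bar> ^ Suc r) \<partial>primitives H F p)
      \<le> (\<integral>\<^sup>+ty. (\<Sum>m\<in>UNIV. ennreal (max 0 (\<bar>x $ m\<bar> + snd ty m - fst ty) ^ Suc r)) \<partial>base)"
    proof (rule nn_integral_primitives_le[OF p])
      fix a
      show "AE ty in base. ennreal (\<Sum>m\<in>UNIV. \<bar>next_workload x (fst ty, a, snd ty) $ m\<bar> ^ Suc r)
          \<le> (\<Sum>m\<in>UNIV. ennreal (max 0 (\<bar>x $ m\<bar> + snd ty m - fst ty) ^ Suc r))"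
        using ae
      proof eventually_elim
        case (elim ty)
        have "(\<Sum>m\<in>UNIV. \<bar>next_workload x (fst ty, a, snd ty) $ m\<bar> ^ Suc r)
            \<le> (\<Sum>m\<in>UNIV. max 0 (\<bar>x $ m\<bar> + snd ty m - fst ty) ^ Suc r)"
        proof (intro sum_mono power_mono)
          fix m
          show "\<bar>next_workload x (fst ty, a, snd ty) $ m\<bar> \<le> max 0 (\<bar>x $ m\<bar> + snd ty m - fst ty)"
            using next_le[of "snd ty" m x "fst ty" a] elim by (simp add: next_nonneg)
        qed simp
        then show ?case by (subst sum_ennreal) (auto intro: ennreal_leI)
      qed
    qed measurable
    also have "\<dots> = (\<Sum>m\<in>UNIV. \<integral>\<^sup>+ty. ennreal (max 0 (\<bar>x $ m\<bar> + snd ty m - fst ty) ^ Suc r) \<partial>base)"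
      by (rule nn_integral_sum) measurable
    also have "\<dots> \<le> (\<Sum>m\<in>UNIV. ennreal (\<bar>x $ m\<bar> ^ Suc r - d m * \<bar>x $ m\<bar> ^ r + C m))"
      by (intro sum_mono bd) auto
    also have "\<dots> = ennreal (\<Sum>m\<in>UNIV. \<bar>x $ m\<bar> ^ Suc r - d m * \<bar>x $ m\<bar> ^ r + C m)"
      by (intro sum_ennreal nn) auto
    finally have int: "(\<integral>\<^sup>+w. ennreal (\<Sum>m\<in>UNIV. \<bar>next_workload x w $ m\<bar> ^ Suc r) \<partial>primitives H F p)
      \<le> ennreal (\<Sum>m\<in>UNIV. \<bar>x $ m\<bar> ^ Suc r - d m * \<bar>x $ m\<bar> ^ r + C m)" .
    have "(\<Sum>m\<in>UNIV. \<bar>x $ m\<bar> ^ Suc r - d m * \<bar>x $ m\<bar> ^ r + C m)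
        \<le> (\<Sum>m\<in>UNIV. \<bar>x $ m\<bar> ^ Suc r - d0 * \<bar>x $ m\<bar> ^ r + C m)"
      by (intro sum_mono add_right_mono diff_left_mono mult_right_mono d0) auto
    also have "\<dots> = (\<Sum>m\<in>UNIV. \<bar>x $ m\<bar> ^ Suc r) - d0 * (\<Sum>m\<in>UNIV. \<bar>x $ m\<bar> ^ r) + (\<Sum>m\<in>UNIV. C m)"
      by (simp add: sum.distrib sum_subtractf sum_distrib_left)
    finally have le: "(\<Sum>m\<in>UNIV. \<bar>x $ m\<bar> ^ Suc r - d m * \<bar>x $ m\<bar> ^ r + C m)
      \<le> (\<Sum>m\<in>UNIV. \<bar>x $ m\<bar> ^ Suc r) - d0 * (\<Sum>m\<in>UNIV. \<bar>x $ m\<bar> ^ r) + (\<Sum>m\<in>UNIV. C m)" .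
    have "0 \<le> (\<Sum>m\<in>UNIV. \<bar>x $ m\<bar> ^ Suc r - d m * \<bar>x $ m\<bar> ^ r + C m)"
      by (intro sum_nonneg nn) auto
    with le order_trans[OF int ennreal_leI[OF le]] show ?thesis by linarith
  qed
  moreover have "0 \<le> (\<Sum>m\<in>UNIV. C m)" using C by (intro sum_nonneg) auto
  ultimately show ?thesis using d0(1) by blast
qed

text \<open>
  The inter-arrival time is at least its mean and each service time at most its mean, with positive
  probability; by stability the difference is at least some \<open>\<delta> > 0\<close>. On this event each workload falls
  by \<open>\<delta>\<close> or to \<open>0\<close>, whichever station is joined.
\<close>

lemma good_event:
  "\<exists>\<delta>>0. \<exists>E\<in>sets base. 0 < measure base E \<and> (\<forall>ty\<in>E. \<delta> \<le> fst ty \<and> (\<forall>m. snd ty m + \<delta> \<le> fst ty))"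
proof -
  define A where "A = {t \<in> space H. 1 / lam \<le> t}"
  define B where "B m = {y \<in> space (F m). y \<le> 1 / \<mu> m}" for m
  define \<delta> where "\<delta> = Min (range (\<lambda>m. 1 / lam - 1 / \<mu> m))"
  have \<mu>: "0 < \<mu> m" for m using lam stable[of m] by linarith
  have \<delta>le: "\<delta> \<le> 1 / lam - 1 / \<mu> m" for m by (auto simp: \<delta>_def)
  have "1 / \<mu> m < 1 / lam" for m
    using lam stable[of m] by (intro divide_strict_left_mono) auto
  then have \<delta>: "0 < \<delta>" by (auto simp: \<delta>_def)
  have Am [measurable]: "A \<in> sets H" and Bm [measurable]: "\<And>m. B m \<in> sets (F m)"
    unfolding A_def B_def by measurable
  have A: "0 < measure H A"
    using H.prob_ge_mean[of "\<lambda>t. t"] H_mean by (auto simp: has_bochner_integral_iff A_def)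
  have B: "0 < measure (F m) (B m)" for m
  proof -
    show ?thesis
      using prob_space.prob_ge_mean[OF F_prob[of m], of "\<lambda>t. - t"] F_mean[of m] by (auto simp: has_bochner_integral_iff B_def)
  qed
  have Bset: "Pi\<^sub>E UNIV B \<in> sets services" by (intro sets_PiM_I_finite Bm) simp
  have "emeasure base (A \<times> Pi\<^sub>E UNIV B) = emeasure H A * (\<Prod>m\<in>UNIV. emeasure (F m) (B m))"
    unfolding services.emeasure_pair_measure_Times[OF Am Bset]
    by (subst F.emeasure_PiM) (rule finite, rule Bm, rule refl)
  also have "\<dots> = ennreal (measure H A * (\<Prod>m\<in>UNIV. measure (F m) (B m)))"
    by (simp add: H.emeasure_eq_measure finite_measure.emeasure_eq_measure[OF prob_space.finite_measure[OF F_prob]]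
      prod_ennreal ennreal_mult prod_nonneg)
  finally have "measure base (A \<times> Pi\<^sub>E UNIV B) = measure H A * (\<Prod>m\<in>UNIV. measure (F m) (B m))"
    by (simp add: measure_def prod_nonneg)
  also have "0 < \<dots>" using A B by (intro mult_pos_pos prod_pos) auto
  finally have pos: "0 < measure base (A \<times> Pi\<^sub>E UNIV B)" .
  have "\<delta> \<le> fst ty \<and> (\<forall>m. snd ty m + \<delta> \<le> fst ty)" if "ty \<in> A \<times> Pi\<^sub>E UNIV B" for ty
  proof -
    have t: "1 / lam \<le> fst ty" and y: "\<And>m. snd ty m \<le> 1 / \<mu> m"
      using that by (auto simp: A_def B_def PiE_iff)
    have "snd ty m + \<delta> \<le> fst ty" for m using t y[of m] \<delta>le[of m] by linarith
    moreover have "\<delta> \<le> fst ty"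
      using t \<delta>le[of undefined] \<mu>[of undefined] by (smt (verit) divide_pos_pos)
    ultimately show ?thesis by blast
  qed
  with pos \<delta> pair_measureI[OF Am Bset] show ?thesis by blast
qed

text \<open>
  Write \<open>s\<close> for the total work and \<open>\<epsilon>\<close> for the probability of the good event. If some workload
  exceeds \<open>\<delta>\<close>, then \<open>s\<close> falls by at least \<open>\<delta>\<close> on this event. The function \<open>B - exp (- \<theta> * s)\<close> is at most \<open>B\<close> after a step, and on the good event
  lower than \<open>B\<close> by \<open>exp (- \<theta> * (s - \<delta>))\<close>, which is \<open>2 / \<epsilon>\<close> times \<open>exp (- \<theta> * s)\<close> for the right \<open>\<theta>\<close>:
  in mean it has fallen. If all workloads are at most \<open>\<delta>\<close>, the good event empties the system and the
  whole of \<open>B = 2 / \<epsilon>\<close> is lost by killing.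
\<close>

lemma bounded_lyapunov:
  "\<exists>\<theta>>0. \<exists>B\<ge>1. \<forall>p\<in>strategies. \<forall>x.
    kill p (\<lambda>x. ennreal (B - exp (- (\<theta> * total_work x)))) x + ennreal (exp (- (\<theta> * total_work x)))
      \<le> ennreal (B - exp (- (\<theta> * total_work x)))"
proof -
  obtain \<delta> E where \<delta>: "0 < \<delta>" and E[measurable]: "E \<in> sets base" and Epos: "0 < measure base E"
    and good: "\<And>ty. ty \<in> E \<Longrightarrow> \<delta> \<le> fst ty" "\<And>ty m. ty \<in> E \<Longrightarrow> snd ty m + \<delta> \<le> fst ty"
    using good_event by blast
  define \<epsilon> where "\<epsilon> = measure base E"
  have \<epsilon>: "0 < \<epsilon>" "\<epsilon> \<le> 1" using Epos by (auto simp: \<epsilon>_def)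
  define B where "B = 2 / \<epsilon>"
  have B: "2 \<le> B" using \<epsilon> by (auto simp: B_def field_simps)
  \<comment> \<open>chosen such that \<open>exp (\<theta> * \<delta>) = 2 / \<epsilon>\<close>\<close>
  define \<theta> where "\<theta> = ln B / \<delta>"
  have \<theta>: "0 < \<theta>" using B \<delta> by (auto simp: \<theta>_def)
  have exp\<theta>: "exp (\<theta> * \<delta>) = B" using B \<delta> by (simp add: \<theta>_def)
  define \<psi> :: "real ^ 'm \<Rightarrow> real" where "\<psi> x = exp (- (\<theta> * total_work x))" for x
  have \<psi>: "0 < \<psi> x" "\<psi> x \<le> 1" for x
    using \<theta> total_work_nonneg[of x] by (auto simp: \<psi>_def)
  have [measurable]: "\<psi> \<in> borel_measurable borel" unfolding \<psi>_def[abs_def] by measurable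
  have next_E: "next_workload x (fst ty, a, snd ty) $ m \<le> max 0 (\<bar>x $ m\<bar> - \<delta>)" if "ty \<in> E" for x ty a m
    using good(1)[OF that] good(2)[OF that, of m] by (auto simp: next_workload_def)
  \<comment> \<open>after a step in the good event the killed function is at most \<open>B - c\<close>\<close>
  have key: "\<exists>c. c \<le> B \<and> 2 * \<psi> x \<le> c * \<epsilon> \<and> (\<forall>ty\<in>E. \<forall>a. next_workload x (fst ty, a, snd ty) \<noteq> 0 \<longrightarrow>
      B - \<psi> (next_workload x (fst ty, a, snd ty)) \<le> B - c)" for x
  proof (cases "\<forall>m. \<bar>x $ m\<bar> \<le> \<delta>")
    case True
    have "next_workload x (fst ty, a, snd ty) = 0" if "ty \<in> E" for ty a
    proof -
      have "next_workload x (fst ty, a, snd ty) $ m = 0" for m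
        using next_E[OF that, of x a m] next_nonneg[of x "(fst ty, a, snd ty)" m] True[rule_format, of m] by simp
      then show ?thesis by (simp add: vec_eq_iff)
    qed
    moreover have "2 * \<psi> x \<le> B * \<epsilon>" using \<psi>[of x] \<epsilon> by (simp add: B_def)
    ultimately show ?thesis by (intro exI[of _ B]) auto
  next
    case False
    then obtain i where i: "\<delta> < \<bar>x $ i\<bar>" by (auto simp: not_le)
    define c where "c = exp (- (\<theta> * (total_work x - \<delta>)))"
    have "\<delta> \<le> total_work x" using i abs_component_le_total_work[of x i] by linarith
    then have "c \<le> 1" using \<theta> by (auto simp: c_def)
    moreover have "c = B * \<psi> x"
      unfolding c_def \<psi>_def exp\<theta>[symmetric] exp_add[symmetric] by (simp add: algebra_simps)
    then have "2 * \<psi> x = c * \<epsilon>" using \<epsilon> by (simp add: B_def)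
    moreover have "c \<le> \<psi> (next_workload x (fst ty, a, snd ty))" if ty: "ty \<in> E" for ty a
    proof -
      have "total_work (next_workload x (fst ty, a, snd ty)) \<le> (\<Sum>m\<in>UNIV. \<bar>x $ m\<bar> - (if m = i then \<delta> else 0))"
        unfolding total_work_def
      proof (rule sum_mono)
        fix m
        show "\<bar>next_workload x (fst ty, a, snd ty) $ m\<bar> \<le> \<bar>x $ m\<bar> - (if m = i then \<delta> else 0)"
          using next_E[OF ty, of x a m] i \<delta> by (auto simp: next_nonneg)
      qed
      also have "\<dots> = total_work x - \<delta>" by (simp add: sum_subtractf total_work_def)
      finally show ?thesis using \<theta> by (simp add: c_def \<psi>_def)
    qed
    ultimately show ?thesis using B by (intro exI[of _ c]) auto
  qed
  have "kill p (\<lambda>x. ennreal (B - \<psi> x)) x + ennreal (\<psi> x) \<le> ennreal (B - \<psi> x)"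
    if p: "p \<in> strategies" for p x
  proof -
    obtain c where c: "c \<le> B" "2 * \<psi> x \<le> c * \<epsilon>" and
      cE: "\<And>ty a. ty \<in> E \<Longrightarrow> next_workload x (fst ty, a, snd ty) \<noteq> 0 \<Longrightarrow>
        B - \<psi> (next_workload x (fst ty, a, snd ty)) \<le> B - c"
      using key[of x] by blast
    have "0 < c * \<epsilon>" using c(2) \<psi>(1)[of x] by linarith
    then have c0: "0 < c" using \<epsilon> by (simp add: zero_less_mult_iff)
    have "kill p (\<lambda>x. ennreal (B - \<psi> x)) x \<le> (\<integral>\<^sup>+ty. ennreal (B - c * indicator E ty) \<partial>base)"
      unfolding kill_eq_integral
    proof (rule nn_integral_primitives_le[OF p])
      fix a
      show "AE ty in base. (if next_workload x (fst ty, a, snd ty) = 0 then 0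
          else ennreal (B - \<psi> (next_workload x (fst ty, a, snd ty)))) \<le> ennreal (B - c * indicator E ty)"
      proof (intro AE_I2)
        fix ty
        show "(if next_workload x (fst ty, a, snd ty) = 0 then 0
          else ennreal (B - \<psi> (next_workload x (fst ty, a, snd ty)))) \<le> ennreal (B - c * indicator E ty)"
          using cE[of ty a] \<psi>(1)[of "next_workload x (fst ty, a, snd ty)"]
          by (auto simp: indicator_def intro!: ennreal_leI)
      qed
    qed measurable
    moreover have iE: "integrable base (indicat_real E)"
      by (intro integrable_real_indicator E) (auto simp: base.emeasure_eq_measure)
    have "(\<integral>\<^sup>+ty. ennreal (B - c * indicator E ty) \<partial>base) = ennreal (\<integral>ty. B - c * indicator E ty \<partial>base)"
    proof (rule nn_integral_eq_integral)
      show "AE ty in base. 0 \<le> B - c * indicator E ty"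
        using c(1) c0 by (auto simp: indicator_def)
      show "integrable base (\<lambda>ty. B - c * indicator E ty)"
        using iE by simp
    qed
    moreover have "(\<integral>ty. B - c * indicator E ty \<partial>base) = B - c * \<epsilon>"
      using iE E by (simp add: \<epsilon>_def base.prob_space)
    ultimately have "kill p (\<lambda>x. ennreal (B - \<psi> x)) x + ennreal (\<psi> x) \<le> ennreal (B - c * \<epsilon>) + ennreal (\<psi> x)"
      by (simp add: add_right_mono)
    also have "c * \<epsilon> \<le> B" using c(1) \<epsilon> c0 by (meson mult_left_le order_trans less_imp_le)
    then have "ennreal (B - c * \<epsilon>) + ennreal (\<psi> x) = ennreal (B - c * \<epsilon> + \<psi> x)"
      using \<psi>[of x] by (subst ennreal_plus) auto
    also have "\<dots> \<le> ennreal (B - \<psi> x)" using c by (intro ennreal_leI) auto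
    finally show ?thesis .
  qed
  then show ?thesis using \<theta> B unfolding \<psi>_def by (intro exI[of _ \<theta>] conjI exI[of _ B]) auto
qed


lemma measurable_kill [measurable]: "f \<in> borel_measurable borel \<Longrightarrow> kill p f \<in> borel_measurable borel"
  by (rule regenerative_chain.measurable_killed[OF workload_chain])

lemma measurable_Green [measurable]: "f \<in> borel_measurable borel \<Longrightarrow> Green p f \<in> borel_measurable borel"
  by (rule regenerative_chain.measurable_green[OF workload_chain])

lemma measurable_kill_action [measurable]:
  assumes [measurable]: "f \<in> borel_measurable borel"
  shows "kill_action a f \<in> borel_measurable borel"
proof -
  have [measurable]: "(\<lambda>z::(real^'m) \<times> real \<times> ('m \<Rightarrow> real). next_workload (fst z) (fst (snd z), a, snd (snd z)))
      \<in> borel_measurable (borel \<Otimes>\<^sub>M base)"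
    by (rule regenerative_chain.measurable_step[OF workload_chain[of undefined]])
      (use measurable_compose[OF measurable_snd base_to_primitives] in \<open>auto simp: comp_def\<close>)
  show ?thesis
    unfolding kill_action_def[abs_def] Let_def
    by (rule base.borel_measurable_nn_integral) (simp add: case_prod_beta)
qed

lemma kill_le_step:
  assumes [measurable]: "f \<in> borel_measurable borel"
  shows "kill p f x \<le> (\<integral>\<^sup>+w. f (next_workload x w) \<partial>primitives H F p)"
  unfolding kill_eq_integral by (intro nn_integral_mono) auto

text \<open>
  The sum of powers has drift at most \<open>- (1 + s) ^ r\<close>, up to factors, plus a constant. The constant
  matters only where \<open>s\<close> is bounded, and there a large multiple of the bounded function of
  \<open>bounded_lyapunov\<close> outweighs it.
\<close>

lemma lyapunov:
  assumes r: "r = 1 \<or> r = 3"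
  shows "\<exists>C\<ge>0. \<exists>L\<in>borel_measurable borel.
    (\<forall>p\<in>strategies. \<forall>x. ennreal ((1 + total_work x) ^ r) + kill p L x \<le> L x) \<and>
    (\<forall>x. L x \<le> ennreal (C * (1 + total_work x) ^ Suc r))"
proof -
  obtain d c where d: "0 < d" and c: "0 \<le> c" and
    nn: "\<And>x::real^'m. 0 \<le> (\<Sum>m\<in>UNIV. \<bar>x $ m\<bar> ^ Suc r) - d * (\<Sum>m\<in>UNIV. \<bar>x $ m\<bar> ^ r) + c" and
    drift: "\<And>p x. p \<in> strategies \<Longrightarrow>
      (\<integral>\<^sup>+w. ennreal (\<Sum>m\<in>UNIV. \<bar>next_workload x w $ m\<bar> ^ Suc r) \<partial>primitives H F p)
      \<le> ennreal ((\<Sum>m\<in>UNIV. \<bar>x $ m\<bar> ^ Suc r) - d * (\<Sum>m\<in>UNIV. \<bar>x $ m\<bar> ^ r) + c)"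
  proof -
    have "axis None 1 \<in> (strategies :: (real ^ 'm option) set)"
      by (auto simp: strategies_def axis_def)
    with power_sum_drift[OF r] that show ?thesis by blast
  qed
  obtain \<theta> B where \<theta>: "0 < \<theta>" and B: "1 \<le> B" and
    bdd: "\<And>p x. p \<in> strategies \<Longrightarrow>
      kill p (\<lambda>x. ennreal (B - exp (- (\<theta> * total_work x)))) x + ennreal (exp (- (\<theta> * total_work x)))
      \<le> ennreal (B - exp (- (\<theta> * total_work x)))"
    using bounded_lyapunov by blast
  define V \<psi> \<phi> where "V x = (\<Sum>m\<in>UNIV. \<bar>x $ m\<bar> ^ Suc r)" and "\<psi> x = exp (- (\<theta> * total_work x))"
    and "\<phi> x = B - exp (- (\<theta> * total_work x))" for x :: "real ^ 'm"
  have [measurable]: "V \<in> borel_measurable borel" "\<phi> \<in> borel_measurable borel" "\<psi> \<in> borel_measurable borel"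
    unfolding V_def[abs_def] \<phi>_def[abs_def] \<psi>_def[abs_def] by measurable
  have V0: "0 \<le> V x" for x by (auto simp: V_def intro: sum_nonneg)
  have \<psi>01: "0 < \<psi> x" "\<psi> x \<le> 1" for x
    using \<theta> total_work_nonneg[of x] by (auto simp: \<psi>_def)
  have \<phi>\<psi>: "\<phi> x = B - \<psi> x" for x by (simp add: \<phi>_def \<psi>_def)
  then have \<phi>0: "0 \<le> \<phi> x" "\<phi> x \<le> B" for x using \<psi>01[of x] B by auto
  define K :: real where "K = (1 + CARD('m)) ^ r"
  have K: "0 < K" by (simp add: K_def)
  \<comment> \<open>\<open>e * (1 + s) ^ r - b\<close> is the downward drift of \<open>V\<close>; half of it exceeds \<open>b\<close> beyond the level \<open>R\<close> of
    total work, and below that level \<open>A * \<psi>\<close> does\<close>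
  define e b R A where "e = d / K" and "b = d + c" and "R = 2 * b / e" and "A = b * exp (\<theta> * R)"
  have e: "0 < e" and b: "0 < b" using d c K by (auto simp: e_def b_def)
  then have A: "0 < A" by (simp add: A_def)
  have absorb: "b - A * \<psi> x \<le> e / 2 * (1 + total_work x) ^ r" for x
  proof (cases "total_work x \<le> R")
    case True
    then have "1 \<le> exp (\<theta> * (R - total_work x))" using \<theta> by simp
    then have "b * 1 \<le> b * exp (\<theta> * (R - total_work x))" using b by (intro mult_left_mono) auto
    also have "\<dots> = A * \<psi> x" by (simp add: A_def \<psi>_def algebra_simps exp_diff exp_minus divide_simps)
    finally have "b - A * \<psi> x \<le> 0" by simp
    also have "0 \<le> e / 2 * (1 + total_work x) ^ r" using e total_work_nonneg[of x] by simp
    finally show ?thesis .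
  next
    case False
    have "b = e / 2 * R" using e by (simp add: R_def)
    also have "\<dots> \<le> e / 2 * (1 + total_work x)" using e False by (intro mult_left_mono) auto
    also have "\<dots> \<le> e / 2 * (1 + total_work x) ^ r"
      using e r total_work_nonneg[of x] by (intro mult_left_mono self_le_power) auto
    finally show ?thesis using A \<psi>01[of x] by (smt (verit) mult_pos_pos)
  qed
  define L where "L x = ennreal (2 / e) * (ennreal (V x) + ennreal A * ennreal (\<phi> x))" for x
  have [measurable]: "L \<in> borel_measurable borel" unfolding L_def[abs_def] by measurable
  have super: "ennreal ((1 + total_work x) ^ r) + kill p L x \<le> L x" if p: "p \<in> strategies" for p x
  proof -
    define a where "a = V x - d * (\<Sum>m\<in>UNIV. \<bar>x $ m\<bar> ^ r) + c"
    have a0: "0 \<le> a" using nn[of x] by (simp add: a_def V_def)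
    have kV: "kill p (\<lambda>x. ennreal (V x)) x \<le> ennreal a"
      using order_trans[OF kill_le_step[of "\<lambda>x. ennreal (V x)" p x]] drift[OF p, of x] by (simp add: V_def a_def)
    have k\<phi>: "kill p (\<lambda>x. ennreal (\<phi> x)) x + ennreal (\<psi> x) \<le> ennreal (\<phi> x)"
      using bdd[OF p, of x] by (simp add: \<phi>_def \<psi>_def)
    have le: "ennreal (\<psi> x) \<le> ennreal (\<phi> x)" using k\<phi> by (rule order_trans[rotated]) simp
    then have \<psi>\<phi>: "\<psi> x \<le> \<phi> x" using \<phi>0 \<psi>01 by (simp add: ennreal_le_iff)
    have k\<phi>': "kill p (\<lambda>x. ennreal (\<phi> x)) x \<le> ennreal (\<phi> x - \<psi> x)"
      using k\<phi> \<psi>01[of x] by (simp add: ennreal_minus[symmetric] ennreal_le_minus_iff)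
    have kL: "kill p L x = ennreal (2 / e) * (kill p (\<lambda>x. ennreal (V x)) x + ennreal A * kill p (\<lambda>x. ennreal (\<phi> x)) x)"
      unfolding L_def[abs_def]
      by (simp add: regenerative_chain.killed_cmult[OF workload_chain] regenerative_chain.killed_add[OF workload_chain])
    have "(1 + total_work x) ^ r \<le> K * (1 + (\<Sum>m\<in>UNIV. \<bar>x $ m\<bar> ^ r))"
      using power_total_work_le[of r x] r by (auto simp: K_def)
    then have "e * (1 + total_work x) ^ r \<le> e * (K * (1 + (\<Sum>m\<in>UNIV. \<bar>x $ m\<bar> ^ r)))"
      using e by (intro mult_left_mono) auto
    also have "\<dots> = d + d * (\<Sum>m\<in>UNIV. \<bar>x $ m\<bar> ^ r)" using K by (simp add: e_def algebra_simps)
    finally have "a \<le> V x - e * (1 + total_work x) ^ r + b" by (simp add: a_def b_def)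
    then have real: "e / 2 * (1 + total_work x) ^ r + (a + A * (\<phi> x - \<psi> x)) \<le> V x + A * \<phi> x"
      using absorb[of x] by (simp add: algebra_simps)
    have "ennreal ((1 + total_work x) ^ r) + kill p L x
        \<le> ennreal ((1 + total_work x) ^ r) + ennreal (2 / e) * (ennreal a + ennreal A * ennreal (\<phi> x - \<psi> x))"
      unfolding kL by (intro add_left_mono mult_left_mono add_mono kV k\<phi>') auto
    also have "\<dots> = ennreal (2 / e * (e / 2 * (1 + total_work x) ^ r + (a + A * (\<phi> x - \<psi> x))))"
      using e A a0 \<psi>\<phi> total_work_nonneg[of x]
      by (simp add: ennreal_mult[symmetric] ennreal_plus[symmetric] distrib_left del: ennreal_plus)
    also have "\<dots> \<le> ennreal (2 / e * (V x + A * \<phi> x))"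
      using e real by (intro ennreal_leI mult_left_mono) auto
    also have "\<dots> = L x"
      using e A V0[of x] \<phi>0(1)[of x]
      by (simp add: L_def ennreal_mult[symmetric] ennreal_plus[symmetric] del: ennreal_plus)
    finally show ?thesis .
  qed
  define C where "C = 2 / e * (CARD('m) + A * B)"
  have "L x \<le> ennreal (C * (1 + total_work x) ^ Suc r)" for x
  proof -
    let ?s = "(1 + total_work x) ^ Suc r"
    have s1: "1 \<le> ?s" using total_work_nonneg[of x] by (intro one_le_power) auto
    have "V x \<le> CARD('m) * ?s" unfolding V_def by (rule power_le_total_work)
    moreover have "A * \<phi> x \<le> (A * B) * 1" using A \<phi>0[of x] by simp
    moreover have "(A * B) * 1 \<le> (A * B) * ?s" using A B s1 by (intro mult_left_mono) auto
    ultimately have "V x + A * \<phi> x \<le> (CARD('m) + A * B) * ?s" by (simp add: algebra_simps)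
    then have "2 / e * (V x + A * \<phi> x) \<le> 2 / e * ((CARD('m) + A * B) * ?s)"
      using e by (intro mult_left_mono) auto
    also have "\<dots> = C * ?s" by (simp add: C_def)
    finally have "2 / e * (V x + A * \<phi> x) \<le> C * ?s" .
    then have "ennreal (2 / e * (V x + A * \<phi> x)) \<le> ennreal (C * ?s)" by (rule ennreal_leI)
    also have "ennreal (2 / e * (V x + A * \<phi> x)) = L x"
      using e A V0[of x] \<phi>0(1)[of x]
      by (simp add: L_def ennreal_mult[symmetric] ennreal_plus[symmetric] del: ennreal_plus)
    finally show ?thesis .
  qed
  moreover have "0 \<le> C" using e A B by (simp add: C_def)
  ultimately show ?thesis using super by (intro exI[of _ C] conjI bexI[of _ L]) auto
qed

lemma Green_bound:
  assumes r: "r = 1 \<or> r = 3"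
  shows "\<exists>C\<ge>0. \<forall>p\<in>strategies. \<forall>x.
    Green p (\<lambda>x. ennreal ((1 + total_work x) ^ r)) x \<le> ennreal (C * (1 + total_work x) ^ Suc r)"
proof -
  obtain C L where C: "0 \<le> C" and [measurable]: "L \<in> borel_measurable borel"
    and L: "\<And>p x. p \<in> strategies \<Longrightarrow> ennreal ((1 + total_work x) ^ r) + kill p L x \<le> L x"
      "\<And>x. L x \<le> ennreal (C * (1 + total_work x) ^ Suc r)"
    using lyapunov[OF r] by blast
  have "Green p (\<lambda>x. ennreal ((1 + total_work x) ^ r)) x \<le> L x" if "p \<in> strategies" for p x
    by (rule regenerative_chain.green_le_superharmonic[OF workload_chain]) (use L(1)[OF that] in auto)
  then show ?thesis using C L(2) order_trans by blast
qed

text \<open>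
  A step of the chain preserves quadratic growth. An action is the strategy that always takes it, so
  this follows from the drift of the second powers.
\<close>

lemma kill_action_bound:
  "\<exists>C\<ge>0. \<forall>a x. kill_action a (\<lambda>x. ennreal ((1 + total_work x)\<^sup>2)) x \<le> ennreal (C * (1 + total_work x)\<^sup>2)"
proof -
  obtain d c where d: "0 < d" and c: "0 \<le> c" and
    drift: "\<And>p x. p \<in> strategies \<Longrightarrow>
      (\<integral>\<^sup>+w. ennreal (\<Sum>m\<in>UNIV. \<bar>next_workload x w $ m\<bar>\<^sup>2) \<partial>primitives H F p)
      \<le> ennreal ((\<Sum>m\<in>UNIV. \<bar>x $ m\<bar>\<^sup>2) - d * (\<Sum>m\<in>UNIV. \<bar>x $ m\<bar>) + c)"
    using power_sum_drift[of 1] by (auto simp flip: numeral_2_eq_2)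
  define K C :: real where "K = (1 + CARD('m))\<^sup>2" and "C = K * (1 + CARD('m) + c)"
  have K: "0 \<le> K" by (simp add: K_def)
  have "kill_action a (\<lambda>x. ennreal ((1 + total_work x)\<^sup>2)) x \<le> ennreal (C * (1 + total_work x)\<^sup>2)" for a x
  proof -
    let ?p = "axis a 1 :: real ^ 'm option"
    let ?V = "\<lambda>x::real^'m. \<Sum>m\<in>UNIV. \<bar>x $ m\<bar>\<^sup>2"
    have p: "?p \<in> strategies" by (auto simp: strategies_def axis_def)
    interpret P: prob_space "primitives H F ?p" by (rule prob_space_primitives)
    have "kill_action a (\<lambda>x. ennreal ((1 + total_work x)\<^sup>2)) x = kill ?p (\<lambda>x. ennreal ((1 + total_work x)\<^sup>2)) x"
      by (subst kill_eq_sum[OF p]) (auto simp: axis_def if_distrib[of ennreal] if_distrib[of "\<lambda>x. x * _"] cong: if_cong)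
    also have "\<dots> \<le> (\<integral>\<^sup>+w. ennreal ((1 + total_work (next_workload x w))\<^sup>2) \<partial>primitives H F ?p)"
      by (rule kill_le_step) measurable
    also have "\<dots> \<le> (\<integral>\<^sup>+w. ennreal K * (1 + ennreal (?V (next_workload x w))) \<partial>primitives H F ?p)"
    proof (rule nn_integral_mono)
      fix w
      have "ennreal ((1 + total_work (next_workload x w))\<^sup>2) \<le> ennreal (K * (1 + ?V (next_workload x w)))"
        using power_total_work_le[of 2 "next_workload x w"] by (intro ennreal_leI) (simp add: K_def)
      then show "ennreal ((1 + total_work (next_workload x w))\<^sup>2) \<le> ennreal K * (1 + ennreal (?V (next_workload x w)))"
        using K by (simp add: ennreal_mult sum_nonneg)
    qed
    also have "\<dots> = ennreal K * (1 + (\<integral>\<^sup>+w. ennreal (?V (next_workload x w)) \<partial>primitives H F ?p))"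
      by (simp add: nn_integral_cmult nn_integral_add P.emeasure_space_1)
    also have "\<dots> \<le> ennreal K * (1 + ennreal (CARD('m) * (1 + total_work x)\<^sup>2 + c))"
    proof (intro mult_left_mono add_left_mono order_trans[OF drift[OF p]] ennreal_leI)
      have "0 \<le> d * (\<Sum>m\<in>UNIV. \<bar>x $ m\<bar>)" using d by (simp add: sum_nonneg)
      with power_le_total_work[where x = x and r = 2]
      show "?V x - d * (\<Sum>m\<in>UNIV. \<bar>x $ m\<bar>) + c \<le> CARD('m) * (1 + total_work x)\<^sup>2 + c" by linarith
    qed simp
    also have "\<dots> = ennreal (K * (1 + (CARD('m) * (1 + total_work x)\<^sup>2 + c)))"
      using K c by (simp add: ennreal_mult)
    also have "\<dots> \<le> ennreal (C * (1 + total_work x)\<^sup>2)"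
    proof (rule ennreal_leI)
      have "1 \<le> (1 + total_work x)\<^sup>2" using total_work_nonneg[of x] by (intro one_le_power) auto
      then have "(1 + c) * 1 \<le> (1 + c) * (1 + total_work x)\<^sup>2" using c by (intro mult_left_mono) auto
      then have "K * (1 + (CARD('m) * (1 + total_work x)\<^sup>2 + c)) \<le> K * ((1 + CARD('m) + c) * (1 + total_work x)\<^sup>2)"
        using K by (intro mult_left_mono) (simp_all add: algebra_simps)
      then show "K * (1 + (CARD('m) * (1 + total_work x)\<^sup>2 + c)) \<le> C * (1 + total_work x)\<^sup>2"
        by (simp add: C_def mult.assoc)
    qed
    finally show ?thesis .
  qed
  moreover have "0 \<le> C" using K c by (simp add: C_def)
  ultimately show ?thesis by blast
qed

lemma kill_action_mono: "(\<And>x. f x \<le> g x) \<Longrightarrow> kill_action a f x \<le> kill_action a g x"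
  unfolding kill_action_def Let_def by (intro nn_integral_mono) auto

lemma kill_action_cmult:
  assumes [measurable]: "f \<in> borel_measurable borel"
  shows "kill_action a (\<lambda>x. c * f x) x = c * kill_action a f x"
proof -
  have [measurable]: "(\<lambda>ty. next_workload x (fst ty, a, snd ty)) \<in> borel_measurable base"
    using measurable_compose[OF base_to_primitives measurable_next] .
  show ?thesis
    unfolding kill_action_def Let_def
    by (subst nn_integral_cmult[symmetric]) (auto intro!: nn_integral_cong)
qed

text \<open>
  Let \<open>g = Green p f\<close>. By linearity in the strategy, replacing \<open>p\<close> by \<open>q\<close> in one step changes \<open>kill p g\<close>
  by at most \<open>D\<close>, the sum over the actions of \<open>kill_action a g\<close> times \<open>norm (q - p)\<close>. Therefore
  \<open>g + Green q D\<close> satisfies the superharmonic inequality for \<open>q\<close> and \<open>f\<close>. Here \<open>g\<close> and \<open>D\<close> grow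
  quadratically in the workload, and \<open>Green q D\<close> is finite by the quartic Lyapunov function.
\<close>

lemma Green_lipschitz:
  "\<exists>C\<ge>0. \<forall>p\<in>strategies. \<forall>q\<in>strategies. \<forall>f\<in>borel_measurable borel.
    (\<forall>x. f x \<le> ennreal (1 + total_work x)) \<longrightarrow> Green q f 0 \<le> Green p f 0 + ennreal (C * norm (q - p))"
proof -
  obtain C1 where C1: "0 \<le> C1" "\<And>p x. p \<in> strategies \<Longrightarrow>
      Green p (\<lambda>x. ennreal (1 + total_work x)) x \<le> ennreal (C1 * (1 + total_work x)\<^sup>2)"
    using Green_bound[of 1] by (auto simp flip: numeral_2_eq_2)
  obtain C2 where C2: "0 \<le> C2" "\<And>a x. kill_action a (\<lambda>x. ennreal ((1 + total_work x)\<^sup>2)) x \<le> ennreal (C2 * (1 + total_work x)\<^sup>2)"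
    using kill_action_bound by blast
  obtain C3 where C3: "0 \<le> C3" "\<And>p x. p \<in> strategies \<Longrightarrow>
      Green p (\<lambda>x. ennreal ((1 + total_work x) ^ 3)) x \<le> ennreal (C3 * (1 + total_work x) ^ Suc 3)"
    using Green_bound[of 3] by auto
  define C where "C = real CARD('m option) * (C1 * C2) * C3"
  have "Green q f 0 \<le> Green p f 0 + ennreal (C * norm (q - p))"
    if p: "p \<in> strategies" and q: "q \<in> strategies" and [measurable]: "f \<in> borel_measurable borel"
      and f: "\<And>x. f x \<le> ennreal (1 + total_work x)" for p q f
  proof -
    interpret P: regenerative_chain "primitives H F p" next_workload by (rule workload_chain)
    interpret Q: regenerative_chain "primitives H F q" next_workload by (rule workload_chain)
    let ?g = "Green p f"
    define D where "D x = ennreal (norm (q - p)) * (\<Sum>a\<in>UNIV. kill_action a ?g x)" for x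
    have [measurable]: "D \<in> borel_measurable borel" unfolding D_def[abs_def] by measurable
    have g: "?g x \<le> ennreal C1 * ennreal ((1 + total_work x)\<^sup>2)" for x
      using order_trans[OF P.green_mono[OF f] C1(2)[OF p]] C1(1) by (simp add: ennreal_mult)
    have kill_le: "kill q ?g x \<le> kill p ?g x + D x" for x
    proof -
      have "kill q ?g x = (\<Sum>a\<in>UNIV. ennreal (q $ a) * kill_action a ?g x)"
        by (rule kill_eq_sum[OF q]) measurable
      also have "\<dots> \<le> (\<Sum>a\<in>UNIV. (ennreal (p $ a) + ennreal (norm (q - p))) * kill_action a ?g x)"
      proof (intro sum_mono mult_right_mono)
        fix a
        have "q $ a \<le> p $ a + norm (q - p)"
          using component_le_norm_cart[of "q - p" a] by (simp add: abs_le_iff)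
        then show "ennreal (q $ a) \<le> ennreal (p $ a) + ennreal (norm (q - p))"
          using p by (simp add: strategies_def ennreal_plus[symmetric] del: ennreal_plus)
      qed simp
      also have "\<dots> = (\<Sum>a\<in>UNIV. ennreal (p $ a) * kill_action a ?g x) + D x"
        by (simp add: distrib_right sum.distrib D_def sum_distrib_left)
      also have "(\<Sum>a\<in>UNIV. ennreal (p $ a) * kill_action a ?g x) = kill p ?g x"
        by (rule kill_eq_sum[OF p, symmetric]) measurable
      finally show ?thesis .
    qed
    \<comment> \<open>\<open>kill q\<close> costs \<open>D\<close> more than \<open>kill p\<close> on \<open>?g\<close>, which is paid by the first term of \<open>Green q D\<close>\<close>
    have "Green q f x \<le> ?g x + Green q D x" for x
    proof (rule Q.green_le_superharmonic)
      fix x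
      have "f x + kill q (\<lambda>x. ?g x + Green q D x) x = f x + (kill q ?g x + kill q (Green q D) x)"
        by (subst Q.killed_add) auto
      also have "\<dots> \<le> f x + ((kill p ?g x + D x) + kill q (Green q D) x)"
        by (intro add_left_mono add_right_mono kill_le)
      also have "\<dots> = (f x + kill p ?g x) + (D x + kill q (Green q D) x)"
        by (simp add: ac_simps)
      also have "\<dots> = ?g x + Green q D x"
        by (simp add: P.green_first_step[symmetric] Q.green_first_step[symmetric])
      finally show "f x + kill q (\<lambda>x. ?g x + Green q D x) x \<le> ?g x + Green q D x" .
    qed measurable
    moreover have "Green q D 0 \<le> ennreal (C * norm (q - p))"
    proof -
      have "D x \<le> ennreal (norm (q - p) * (CARD('m option) * (C1 * C2))) * ennreal ((1 + total_work x) ^ 3)" for x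
      proof -
        have "kill_action a ?g x \<le> ennreal (C1 * C2 * (1 + total_work x)\<^sup>2)" for a
        proof -
          have "kill_action a ?g x \<le> kill_action a (\<lambda>x. ennreal C1 * ennreal ((1 + total_work x)\<^sup>2)) x"
            by (intro kill_action_mono g)
          also have "\<dots> = ennreal C1 * kill_action a (\<lambda>x. ennreal ((1 + total_work x)\<^sup>2)) x"
            by (intro kill_action_cmult) measurable
          also have "\<dots> \<le> ennreal C1 * ennreal (C2 * (1 + total_work x)\<^sup>2)"
            by (intro mult_left_mono C2(2)) auto
          finally show ?thesis using C1(1) C2(1) by (simp add: ennreal_mult[symmetric] mult.assoc)
        qed
        moreover have "C1 * C2 * (1 + total_work x)\<^sup>2 \<le> C1 * C2 * (1 + total_work x) ^ 3"
          using C1(1) C2(1) total_work_nonneg[of x] by (intro mult_left_mono power_increasing) auto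
        ultimately have "kill_action a ?g x \<le> ennreal (C1 * C2 * (1 + total_work x) ^ 3)" for a
          by (meson ennreal_leI order_trans)
        then have "(\<Sum>a\<in>(UNIV::'m option set). kill_action a ?g x) \<le> (\<Sum>a\<in>(UNIV::'m option set). ennreal (C1 * C2 * (1 + total_work x) ^ 3))"
          by (intro sum_mono)
        also have "\<dots> = ennreal (CARD('m option) * (C1 * C2 * (1 + total_work x) ^ 3))"
          using C1(1) C2(1) total_work_nonneg[of x] by (subst sum_ennreal) auto
        finally have "D x \<le> ennreal (norm (q - p)) * ennreal (CARD('m option) * (C1 * C2 * (1 + total_work x) ^ 3))"
          unfolding D_def by (intro mult_left_mono) auto
        then show ?thesis
          using C1(1) C2(1) total_work_nonneg[of x] by (simp add: ennreal_mult[symmetric] mult.assoc)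
      qed
      then have "Green q D 0 \<le> Green q (\<lambda>x. ennreal (norm (q - p) * (CARD('m option) * (C1 * C2))) * ennreal ((1 + total_work x) ^ 3)) 0"
        by (rule Q.green_mono)
      also have "\<dots> = ennreal (norm (q - p) * (CARD('m option) * (C1 * C2))) * Green q (\<lambda>x. ennreal ((1 + total_work x) ^ 3)) 0"
        by (intro Q.green_cmult) measurable
      also have "\<dots> \<le> ennreal (norm (q - p) * (CARD('m option) * (C1 * C2))) * ennreal C3"
        using C3(2)[OF q, of 0] by (intro mult_left_mono) auto
      also have "\<dots> = ennreal (C * norm (q - p))"
        using C1(1) C2(1) C3(1) by (simp add: C_def ennreal_mult[symmetric] mult_ac)
      finally show ?thesis .
    qed
    ultimately show ?thesis by (meson add_left_mono order_trans)
  qed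
  moreover have "0 \<le> C" using C1(1) C2(1) C3(1) by (simp add: C_def)
  ultimately show ?thesis by blast
qed

text \<open>
  The function \<open>2 * f * Green p f\<close> of \<open>second_moment_le\<close> is a linear times a quadratic one, and the
  quartic Lyapunov function controls cubic growth.
\<close>

lemma second_moment_bound:
  "\<exists>C\<ge>0. \<forall>p\<in>strategies. (\<integral>\<^sup>+\<omega>. (\<Sum>j. regenerative_chain.visit next_workload (\<lambda>x. ennreal (1 + total_work x)) 0 \<omega> j)\<^sup>2
      \<partial>PiM UNIV (\<lambda>_::nat. primitives H F p)) \<le> ennreal C"
proof -
  obtain C1 where C1: "0 \<le> C1" "\<And>p x. p \<in> strategies \<Longrightarrow>
      Green p (\<lambda>x. ennreal (1 + total_work x)) x \<le> ennreal (C1 * (1 + total_work x)\<^sup>2)"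
    using Green_bound[of 1] by (auto simp flip: numeral_2_eq_2)
  obtain C L where C: "0 \<le> C" and [measurable]: "L \<in> borel_measurable borel"
    and L: "\<And>p x. p \<in> strategies \<Longrightarrow> ennreal ((1 + total_work x) ^ 3) + kill p L x \<le> L x"
      "\<And>x. L x \<le> ennreal (C * (1 + total_work x) ^ Suc 3)"
    using lyapunov[of 3] by blast
  have "(\<integral>\<^sup>+\<omega>. (\<Sum>j. regenerative_chain.visit next_workload (\<lambda>x. ennreal (1 + total_work x)) 0 \<omega> j)\<^sup>2
      \<partial>PiM UNIV (\<lambda>_::nat. primitives H F p)) \<le> ennreal (2 * C1 * C)" if p: "p \<in> strategies" for p
  proof -
    interpret P: regenerative_chain "primitives H F p" next_workload by (rule workload_chain)
    have "2 * (ennreal (1 + total_work x) * Green p (\<lambda>x. ennreal (1 + total_work x)) x)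
        + kill p (\<lambda>x. ennreal (2 * C1) * L x) x \<le> ennreal (2 * C1) * L x" for x
    proof -
      have "2 * (ennreal (1 + total_work x) * Green p (\<lambda>x. ennreal (1 + total_work x)) x)
          \<le> 2 * (ennreal (1 + total_work x) * ennreal (C1 * (1 + total_work x)\<^sup>2))"
        by (intro mult_left_mono C1(2) p) auto
      also have "\<dots> = ennreal (2 * ((1 + total_work x) * (C1 * (1 + total_work x)\<^sup>2)))"
        using C1(1) total_work_nonneg[of x] by (simp add: ennreal_mult)
      also have "2 * ((1 + total_work x) * (C1 * (1 + total_work x)\<^sup>2)) = 2 * C1 * (1 + total_work x) ^ 3"
        by (simp add: power3_eq_cube power2_eq_square)
      also have "ennreal \<dots> = ennreal (2 * C1) * ennreal ((1 + total_work x) ^ 3)"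
        using C1(1) total_work_nonneg[of x] by (intro ennreal_mult) auto
      finally have "2 * (ennreal (1 + total_work x) * Green p (\<lambda>x. ennreal (1 + total_work x)) x)
        + kill p (\<lambda>x. ennreal (2 * C1) * L x) x
        \<le> ennreal (2 * C1) * ennreal ((1 + total_work x) ^ 3) + ennreal (2 * C1) * kill p L x"
        by (subst P.killed_cmult) (auto intro: add_right_mono)
      also have "\<dots> \<le> ennreal (2 * C1) * L x"
        unfolding distrib_left[symmetric] by (intro mult_left_mono L(1) p) auto
      finally show ?thesis .
    qed
    then have "(\<integral>\<^sup>+\<omega>. (\<Sum>j. P.visit (\<lambda>x. ennreal (1 + total_work x)) 0 \<omega> j)\<^sup>2 \<partial>P.stream) \<le> ennreal (2 * C1) * L 0"
      by (intro P.second_moment_le) auto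
    also have "\<dots> \<le> ennreal (2 * C1) * ennreal C"
      using L(2)[of 0] by (intro mult_left_mono) auto
    also have "\<dots> = ennreal (2 * C1 * C)" using C1(1) C by (simp add: ennreal_mult)
    finally show ?thesis .
  qed
  moreover have "0 \<le> 2 * C1 * C" using C1(1) C by simp
  ultimately show ?thesis by blast
qed


section \<open>Stationary means and cycle means of the workload\<close>

lemma Green_one_finite:
  assumes p: "p \<in> strategies"
  shows "Green p (\<lambda>_. 1) x < \<infinity>"
proof -
  interpret P: regenerative_chain "primitives H F p" next_workload by (rule workload_chain)
  obtain C where "Green p (\<lambda>x. ennreal (1 + total_work x)) x \<le> ennreal (C * (1 + total_work x) ^ Suc 1)"
    using Green_bound[of 1] p by auto
  moreover have "Green p (\<lambda>_. 1) x \<le> Green p (\<lambda>x. ennreal (1 + total_work x)) x"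
    by (rule P.green_mono) (use total_work_nonneg in \<open>simp add: ennreal_ge_1\<close>)
  ultimately have "Green p (\<lambda>_. 1) x \<le> ennreal (C * (1 + total_work x) ^ Suc 1)"
    by (rule order_trans[rotated])
  then show ?thesis by (rule le_less_trans) simp
qed

lemma is_stationary_iff:
  "is_stationary H F p \<pi> \<longleftrightarrow> regenerative_chain.stationary (primitives H F p) next_workload \<pi>"
  by (simp add: is_stationary_def regenerative_chain.stationary_def[OF workload_chain])

lemma is_stationary_unique:
  assumes "p \<in> strategies" "is_stationary H F p \<pi>"
  shows "\<pi> = regenerative_chain.cycle_measure (primitives H F p) next_workload"
  using assms regenerative_chain.stationary_unique[OF workload_chain Green_one_finite]
  by (simp add: is_stationary_iff)

lemma stationary_dist_eq:
  assumes "p \<in> strategies"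
  shows "stationary_dist H F p = regenerative_chain.cycle_measure (primitives H F p) next_workload"
  unfolding stationary_dist_def
proof (rule the_equality)
  show "is_stationary H F p (regenerative_chain.cycle_measure (primitives H F p) next_workload)"
    using regenerative_chain.stationary_cycle_measure[OF workload_chain Green_one_finite[OF assms]]
    by (simp add: is_stationary_iff)
qed (rule is_stationary_unique[OF assms])

lemma is_stationary_stationary_dist: "p \<in> strategies \<Longrightarrow> is_stationary H F p (stationary_dist H F p)"
  using regenerative_chain.stationary_cycle_measure[OF workload_chain Green_one_finite]
  by (simp add: is_stationary_iff stationary_dist_eq)

lemma nn_integral_stationary_dist:
  assumes "p \<in> strategies" "f \<in> borel_measurable borel"
  shows "(\<integral>\<^sup>+x. f x \<partial>stationary_dist H F p) = Green p f 0 / Green p (\<lambda>_. 1) 0"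
  unfolding stationary_dist_eq[OF assms(1)]
  by (rule regenerative_chain.nn_integral_cycle_measure[OF workload_chain assms(2)])

text \<open>
  The expected sum of \<open>h\<close> over a cycle that starts empty; it is split into positive and negative part
  as the Green operator acts on nonnegative functions.
\<close>

definition cycle_mean :: "real ^ ('m option) \<Rightarrow> (real ^ 'm \<Rightarrow> real) \<Rightarrow> real" where
  "cycle_mean p h = enn2real (Green p (\<lambda>x. ennreal (h x)) 0) - enn2real (Green p (\<lambda>x. ennreal (- h x)) 0)"

lemma cycle_mean_bounds:
  "\<exists>K\<ge>0. \<forall>p\<in>strategies. \<forall>q\<in>strategies. \<forall>h\<in>borel_measurable borel. \<forall>c>0.
    (\<forall>x. \<bar>h x\<bar> \<le> c * (1 + total_work x)) \<longrightarrow>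
    Green p (\<lambda>x. ennreal (h x)) 0 < \<infinity> \<and> \<bar>cycle_mean p h\<bar> \<le> K * c \<and>
    \<bar>cycle_mean q h - cycle_mean p h\<bar> \<le> K * c * norm (q - p)"
proof -
  obtain C1 where C1: "0 \<le> C1" "\<And>p x. p \<in> strategies \<Longrightarrow>
      Green p (\<lambda>x. ennreal (1 + total_work x)) x \<le> ennreal (C1 * (1 + total_work x)\<^sup>2)"
    using Green_bound[of 1] by (auto simp flip: numeral_2_eq_2)
  obtain C where C: "0 \<le> C" "\<And>p q f. p \<in> strategies \<Longrightarrow> q \<in> strategies \<Longrightarrow> f \<in> borel_measurable borel \<Longrightarrow>
    (\<And>x. f x \<le> ennreal (1 + total_work x)) \<Longrightarrow> Green q f 0 \<le> Green p f 0 + ennreal (C * norm (q - p))"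
    using Green_lipschitz by blast
  define E where "E p h = enn2real (Green p (\<lambda>x. ennreal (h x)) 0)" for p and h :: "real ^ 'm \<Rightarrow> real"
  have fin: "Green p (\<lambda>x. ennreal (h x)) 0 \<le> ennreal (c * C1)"
    and lip: "E q h \<le> E p h + c * C * norm (q - p)"
    if p: "p \<in> strategies" and q: "q \<in> strategies" and [measurable]: "h \<in> borel_measurable borel" and c: "0 < c"
      and h: "\<And>x. \<bar>h x\<bar> \<le> c * (1 + total_work x)" for p q h c
  proof -
    let ?f = "\<lambda>x. ennreal (h x / c)"
    have f: "?f x \<le> ennreal (1 + total_work x)" for x
      using h[of x] c by (intro ennreal_leI) (simp add: pos_divide_le_eq abs_le_iff mult.commute)
    have eq: "Green p (\<lambda>x. ennreal (h x)) 0 = ennreal c * Green p ?f 0" for p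
    proof -
      interpret P: regenerative_chain "primitives H F p" next_workload by (rule workload_chain)
      have "Green p (\<lambda>x. ennreal c * ?f x) 0 = ennreal c * Green p ?f 0"
        by (rule P.green_cmult) measurable
      moreover have "ennreal c * ?f x = ennreal (h x)" for x
        using c by (subst ennreal_mult'[symmetric]) auto
      ultimately show ?thesis by simp
    qed
    have le: "Green p ?f 0 \<le> ennreal C1" if "p \<in> strategies" for p
      using order_trans[OF regenerative_chain.green_mono[OF workload_chain f] C1(2)[OF that, of 0]] by simp
    show "Green p (\<lambda>x. ennreal (h x)) 0 \<le> ennreal (c * C1)"
      unfolding eq using le[OF p] c C1(1) by (simp add: ennreal_mult mult_left_mono)
    have "Green q (\<lambda>x. ennreal (h x)) 0 \<le> ennreal c * (Green p ?f 0 + ennreal (C * norm (q - p)))"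
      unfolding eq by (intro mult_left_mono C(2) p q f) auto
    also have "\<dots> = Green p (\<lambda>x. ennreal (h x)) 0 + ennreal (c * C * norm (q - p))"
      using c C(1) by (simp add: eq distrib_left ennreal_mult mult.assoc)
    also have "Green p (\<lambda>x. ennreal (h x)) 0 = ennreal (E p h)"
      unfolding E_def eq using le[OF p] c
      by (intro ennreal_enn2real[symmetric]) (auto simp: ennreal_mult_less_top intro: le_less_trans)
    finally have "Green q (\<lambda>x. ennreal (h x)) 0 \<le> ennreal (E p h + c * C * norm (q - p))"
      using c C(1) by (simp add: E_def ennreal_plus[symmetric] del: ennreal_plus)
    then have "E q h \<le> enn2real (ennreal (E p h + c * C * norm (q - p)))"
      unfolding E_def[of q] by (intro enn2real_mono) auto
    then show "E q h \<le> E p h + c * C * norm (q - p)"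
      using c C(1) by (simp add: E_def del: ennreal_plus)
  qed
  have cm: "cycle_mean p h = E p h - E p (\<lambda>x. - h x)" for p h
    by (simp add: cycle_mean_def E_def)
  have "Green p (\<lambda>x. ennreal (h x)) 0 < \<infinity> \<and> \<bar>cycle_mean p h\<bar> \<le> (C1 + 2 * C) * c \<and>
    \<bar>cycle_mean q h - cycle_mean p h\<bar> \<le> (C1 + 2 * C) * c * norm (q - p)"
    if p: "p \<in> strategies" and q: "q \<in> strategies" and [measurable]: "h \<in> borel_measurable borel" and c: "0 < c"
      and h: "\<And>x. \<bar>h x\<bar> \<le> c * (1 + total_work x)" for p q h c
  proof -
    have h': "\<bar>- h x\<bar> \<le> c * (1 + total_work x)" for x using h[of x] by simp
    have m': "(\<lambda>x. - h x) \<in> borel_measurable borel" by measurable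
    have bnd: "0 \<le> E p g \<and> E p g \<le> c * C1"
      if "Green p (\<lambda>x. ennreal (g x)) 0 \<le> ennreal (c * C1)" for g
      using that c C1(1) enn2real_mono[OF that] by (simp add: E_def)
    note b1 = bnd[OF fin[OF p q _ c h]] and b2 = bnd[OF fin[OF p q m' c h']]
    note l = lip[OF p q _ c h] lip[OF p q m' c h'] lip[OF q p _ c h] lip[OF q p m' c h']
    have "0 \<le> C1 * c * norm (q - p)" "0 \<le> C * c" using c C(1) C1(1) by auto
    then have "\<bar>cycle_mean p h\<bar> \<le> (C1 + 2 * C) * c"
      and "\<bar>cycle_mean q h - cycle_mean p h\<bar> \<le> (C1 + 2 * C) * c * norm (q - p)"
      unfolding cm using b1 b2 l
      by (auto simp: abs_le_iff algebra_simps norm_minus_commute)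
    moreover have "Green p (\<lambda>x. ennreal (h x)) 0 < \<infinity>"
      using fin[OF p q _ c h] by (auto intro: le_less_trans)
    ultimately show ?thesis by blast
  qed
  moreover have "0 \<le> C1 + 2 * C" using C(1) C1(1) by simp
  ultimately show ?thesis by blast
qed

lemma Green_finite:
  assumes p: "p \<in> strategies" and [measurable]: "h \<in> borel_measurable borel"
    and h: "\<And>x. \<bar>h x\<bar> \<le> c * (1 + total_work x)"
  shows "Green p (\<lambda>x. ennreal (h x)) 0 < \<infinity>"
proof -
  have "c * (1 + total_work x) \<le> (\<bar>c\<bar> + 1) * (1 + total_work x)" for x :: "real ^ 'm"
    using total_work_nonneg[of x] by (intro mult_right_mono) auto
  then have h': "\<bar>h x\<bar> \<le> (\<bar>c\<bar> + 1) * (1 + total_work x)" for x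
    using h order_trans by blast
  have "0 < \<bar>c\<bar> + 1" by simp
  with cycle_mean_bounds p assms(2) h' show ?thesis by blast
qed

text \<open>
  The regenerative formula, which holds because the stationary distribution is the normalised occupation
  measure of a cycle.
\<close>

lemma integral_stationary_dist:
  assumes p: "p \<in> strategies" and [measurable]: "h \<in> borel_measurable borel"
    and h: "\<And>x. \<bar>h x\<bar> \<le> c * (1 + total_work x)"
  shows "integrable (stationary_dist H F p) h"
    "(\<integral>x. h x \<partial>stationary_dist H F p) = cycle_mean p h / cycle_mean p (\<lambda>_. 1)"
proof -
  have [measurable_cong]: "sets (stationary_dist H F p) = sets borel"
    using is_stationary_stationary_dist[OF p] by (simp add: is_stationary_def)
  interpret P: regenerative_chain "primitives H F p" next_workload by (rule workload_chain)
  have h': "\<bar>- h x\<bar> \<le> c * (1 + total_work x)" for x using h[of x] by simp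
  note fin = Green_finite[OF p assms(2) h] Green_finite[OF p _ h', simplified]
  define A B L where "A = enn2real (Green p (\<lambda>x. ennreal (h x)) 0)"
    and "B = enn2real (Green p (\<lambda>x. ennreal (- h x)) 0)" and "L = enn2real (Green p (\<lambda>_. 1) 0)"
  have AB: "Green p (\<lambda>x. ennreal (h x)) 0 = ennreal A" "Green p (\<lambda>x. ennreal (- h x)) 0 = ennreal B"
    "Green p (\<lambda>_. 1) 0 = ennreal L"
    using fin Green_one_finite[OF p, of 0] by (auto simp: A_def B_def L_def)
  have AB0: "0 \<le> A" "0 \<le> B" by (simp_all add: A_def B_def)
  have L1: "1 \<le> L"
    using P.green_one_ge_1[of 0] unfolding AB(3) by (simp add: ennreal_ge_1)
  have nn: "(\<integral>\<^sup>+x. ennreal (h x) \<partial>stationary_dist H F p) = ennreal (A / L)"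
    "(\<integral>\<^sup>+x. ennreal (- h x) \<partial>stationary_dist H F p) = ennreal (B / L)"
    using L1 by (auto simp: nn_integral_stationary_dist[OF p] AB divide_ennreal AB0)
  show int: "integrable (stationary_dist H F p) h"
    by (subst real_integrable_def) (use nn in auto)
  have "cycle_mean p (\<lambda>_. 1) = L"
  proof -
    have "Green p (\<lambda>_. 0) 0 = 0"
      using P.green_cmult[of "\<lambda>_. 1" 0 0] by simp
    then show ?thesis by (simp add: cycle_mean_def L_def ennreal_neg)
  qed
  then show "(\<integral>x. h x \<partial>stationary_dist H F p) = cycle_mean p h / cycle_mean p (\<lambda>_. 1)"
    unfolding real_lebesgue_integral_def[OF int] nn using L1
    by (simp add: cycle_mean_def A_def B_def diff_divide_distrib)
qed

lemma path_eq_workload: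
  fixes \<omega> :: "nat \<Rightarrow> real \<times> 'm option \<times> ('m \<Rightarrow> real)"
  shows "regenerative_chain.path next_workload 0 \<omega> j = workload \<omega> j"
proof -
  interpret P: regenerative_chain "primitives H F undefined" next_workload by (rule workload_chain)
  show ?thesis by (induction j) auto
qed

lemma return_time_eq_cycle_length:
  fixes \<omega> :: "nat \<Rightarrow> real \<times> 'm option \<times> ('m \<Rightarrow> real)"
  shows "regenerative_chain.return_time next_workload 0 \<omega> = cycle_length \<omega>"
proof -
  interpret P: regenerative_chain "primitives H F undefined" next_workload by (rule workload_chain)
  show ?thesis by (simp add: P.return_time_def cycle_length_def path_eq_workload)
qed

abbreviation driving :: "real ^ ('m option) \<Rightarrow> (nat \<Rightarrow> real \<times> 'm option \<times> ('m \<Rightarrow> real)) measure" where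
  "driving p \<equiv> PiM UNIV (\<lambda>_::nat. primitives H F p)"

lemma measurable_workload [measurable]: "(\<lambda>\<omega>. workload \<omega> j) \<in> borel_measurable (driving p)"
proof -
  interpret P: regenerative_chain "primitives H F p" next_workload by (rule workload_chain)
  have "(\<lambda>\<omega>. P.path 0 \<omega> j) \<in> borel_measurable (driving p)" by measurable
  then show ?thesis by (simp add: path_eq_workload)
qed

lemma measurable_cycle_length [measurable]: "cycle_length \<in> driving p \<rightarrow>\<^sub>M count_space UNIV"
proof -
  have "cycle_length = (\<lambda>\<omega>. LEAST n. 1 \<le> n \<and> workload \<omega> n = 0)"
    by (auto simp: cycle_length_def Inf_nat_def fun_eq_iff)
  also have "\<dots> \<in> driving p \<rightarrow>\<^sub>M count_space UNIV" by measurable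
  finally show ?thesis .
qed

lemma measurable_sum_cycle [measurable]:
  fixes f :: "real ^ 'm \<Rightarrow> 'b::euclidean_space"
  assumes [measurable]: "f \<in> borel_measurable borel"
  shows "(\<lambda>\<omega>. \<Sum>j<cycle_length \<omega>. f (workload \<omega> j)) \<in> borel_measurable (driving p)"
  by (rule measurable_compose_countable[where g = cycle_length and f = "\<lambda>n \<omega>. \<Sum>j<n. f (workload \<omega> j)"])
     measurable

lemma AE_cycle_sum_eq:
  assumes p: "p \<in> strategies"
  shows "AE \<omega> in driving p. \<forall>f. (\<Sum>j. regenerative_chain.visit next_workload f 0 \<omega> j) = (\<Sum>j<cycle_length \<omega>. f (workload \<omega> j))"
  using regenerative_chain.AE_sum_visit[OF workload_chain Green_one_finite[OF p], of 0]
  by (simp add: return_time_eq_cycle_length path_eq_workload)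

lemma integral_sum_cycle:
  assumes p: "p \<in> strategies" and [measurable]: "h \<in> borel_measurable borel"
    and h: "\<And>x. \<bar>h x\<bar> \<le> c * (1 + total_work x)"
  shows "integrable (driving p) (\<lambda>\<omega>. \<Sum>j<cycle_length \<omega>. h (workload \<omega> j))"
    "(\<integral>\<omega>. (\<Sum>j<cycle_length \<omega>. h (workload \<omega> j)) \<partial>driving p) = cycle_mean p h"
proof -
  interpret P: regenerative_chain "primitives H F p" next_workload by (rule workload_chain)
  define c' where "c' = \<bar>c\<bar> + 1"
  have c': "0 < c'" by (simp add: c'_def)
  have "c * (1 + total_work x) \<le> c' * (1 + total_work x)" for x :: "real ^ 'm"
    using total_work_nonneg[of x] by (intro mult_right_mono) (auto simp: c'_def)
  then have h': "\<bar>h x\<bar> \<le> c' * (1 + total_work x)" for x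
    using h order_trans by blast
  have fin: "Green p (\<lambda>x. ennreal (h x)) 0 < \<infinity>" "Green p (\<lambda>x. ennreal (- h x)) 0 < \<infinity>"
    using cycle_mean_bounds p h' c' by (fastforce)+
  define S where "S g \<omega> = (\<Sum>j<cycle_length \<omega>. max 0 (g (workload \<omega> j)))" for g :: "real ^ 'm \<Rightarrow> real" and \<omega> :: "nat \<Rightarrow> real \<times> 'm option \<times> ('m \<Rightarrow> real)"
  have S0: "0 \<le> S g \<omega>" for g \<omega> by (auto simp: S_def intro: sum_nonneg)
  have [measurable]: "S g \<in> borel_measurable (driving p)" if [measurable]: "g \<in> borel_measurable borel" for g
    unfolding S_def[abs_def] by (rule measurable_sum_cycle) measurable
  have nn: "(\<integral>\<^sup>+\<omega>. ennreal (S g \<omega>) \<partial>driving p) = Green p (\<lambda>x. ennreal (g x)) 0"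
    if [measurable]: "g \<in> borel_measurable borel" for g
  proof -
    have "(\<integral>\<^sup>+\<omega>. ennreal (S g \<omega>) \<partial>driving p) = (\<integral>\<^sup>+\<omega>. (\<Sum>j. P.visit (\<lambda>x. ennreal (g x)) 0 \<omega> j) \<partial>driving p)"
    proof (rule nn_integral_cong_AE)
      show "AE \<omega> in driving p. ennreal (S g \<omega>) = (\<Sum>j. P.visit (\<lambda>x. ennreal (g x)) 0 \<omega> j)"
        using AE_cycle_sum_eq[OF p]
      proof eventually_elim
        case (elim \<omega>)
        have "ennreal (S g \<omega>) = (\<Sum>j<cycle_length \<omega>. ennreal (max 0 (g (workload \<omega> j))))"
          unfolding S_def by (subst sum_ennreal) auto
        moreover have "ennreal (max 0 r) = ennreal r" for r
          by (simp add: max_def ennreal_neg)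
        ultimately show ?case using elim by simp
      qed
    qed
    also have "\<dots> = Green p (\<lambda>x. ennreal (g x)) 0"
      by (rule P.nn_integral_sum_visit) measurable
    finally show ?thesis .
  qed
  have int: "integrable (driving p) (S h)" "integrable (driving p) (S (\<lambda>x. - h x))"
    by (rule integrableI_nonneg; (use fin in \<open>simp add: nn S0\<close>)?; measurable)+
  have val: "(\<integral>\<omega>. S h \<omega> \<partial>driving p) = enn2real (Green p (\<lambda>x. ennreal (h x)) 0)"
    "(\<integral>\<omega>. S (\<lambda>x. - h x) \<omega> \<partial>driving p) = enn2real (Green p (\<lambda>x. ennreal (- h x)) 0)"
    by (subst integral_eq_nn_integral; simp add: nn S0)+
  have eq: "(\<Sum>j<cycle_length \<omega>. h (workload \<omega> j)) = S h \<omega> - S (\<lambda>x. - h x) \<omega>" for \<omega>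
    unfolding S_def sum_subtractf[symmetric] by (intro sum.cong) auto
  show "integrable (driving p) (\<lambda>\<omega>. \<Sum>j<cycle_length \<omega>. h (workload \<omega> j))"
    unfolding eq using int by simp
  show "(\<integral>\<omega>. (\<Sum>j<cycle_length \<omega>. h (workload \<omega> j)) \<partial>driving p) = cycle_mean p h"
    unfolding eq using int by (simp add: val cycle_mean_def)
qed

end

section \<open>Utilities and the cycle estimator\<close>

locale unobservable_queues = parallel_queues lam \<mu> H F
  for lam :: real and \<mu> :: "'m::finite \<Rightarrow> real" and H :: "real measure" and F :: "'m \<Rightarrow> real measure" +
  fixes \<nu> :: "'m \<Rightarrow> real \<Rightarrow> real"
  assumes lipschitz: "\<And>m. \<exists>C. C-lipschitz_on {0..} (\<nu> m)"
begin

abbreviation v :: "real ^ 'm \<Rightarrow> real ^ ('m option)" where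
  "v \<equiv> mean_value F \<nu>"

abbreviation u :: "real ^ ('m option) \<Rightarrow> real ^ ('m option)" where
  "u \<equiv> expected_utility H F \<nu>"

abbreviation mean_length :: "real ^ ('m option) \<Rightarrow> real" where
  "mean_length p \<equiv> cycle_mean p (\<lambda>_. 1)"

text \<open>
  The Lipschitz property of \<open>\<nu> m\<close> is inherited by its average over the service time, which thus is
  continuous and of linear growth.
\<close>

lemma station_value:
  obtains c where "0 < c" "\<And>x. \<bar>\<integral>y. \<nu> m (max 0 (x + y)) \<partial>F m\<bar> \<le> c * (1 + \<bar>x\<bar>)"
    "continuous_on UNIV (\<lambda>x. \<integral>y. \<nu> m (max 0 (x + y)) \<partial>F m)"
proof -
  obtain C where C: "C-lipschitz_on {0..} (\<nu> m)" using lipschitz by blast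
  have C0: "0 \<le> C" using C by (rule lipschitz_on_nonneg)
  have iF: "integrable (F m) (\<lambda>y. \<bar>y\<bar>)" using F_mean[of m] by (auto simp: has_bochner_integral_iff)
  have cont: "continuous_on UNIV (\<lambda>y. \<nu> m (max 0 (x + y)))" for x
    by (rule continuous_on_compose2[OF lipschitz_on_continuous_on[OF C]]) (auto intro!: continuous_intros)
  have [measurable]: "(\<lambda>y. \<nu> m (max 0 (x + y))) \<in> borel_measurable (F m)" for x
    using borel_measurable_continuous_onI[OF cont[of x]] by (simp cong: measurable_cong_sets)
  have diff: "\<bar>\<nu> m (max 0 a) - \<nu> m (max 0 b)\<bar> \<le> C * \<bar>a - b\<bar>" for a b
  proof -
    have "\<bar>\<nu> m (max 0 a) - \<nu> m (max 0 b)\<bar> \<le> C * \<bar>max 0 a - max 0 b\<bar>"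
      using lipschitz_onD[OF C, of "max 0 a" "max 0 b"] by (simp add: dist_real_def)
    also have "\<dots> \<le> C * \<bar>a - b\<bar>" using C0 by (intro mult_left_mono) auto
    finally show ?thesis .
  qed
  define I where "I = (\<integral>y. \<bar>y\<bar> \<partial>F m)"
  have I0: "0 \<le> I" by (simp add: I_def)
  have bnd: "\<bar>\<nu> m (max 0 (x + y))\<bar> \<le> \<bar>\<nu> m 0\<bar> + C * \<bar>x\<bar> + C * \<bar>y\<bar>" for x y
  proof -
    have "\<bar>\<nu> m (max 0 (x + y)) - \<nu> m 0\<bar> \<le> C * \<bar>x + y\<bar>" using diff[of "x + y" 0] by simp
    also have "\<dots> \<le> C * (\<bar>x\<bar> + \<bar>y\<bar>)" using C0 by (intro mult_left_mono) auto
    finally show ?thesis by (simp add: distrib_left)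
  qed
  have ib: "integrable (F m) (\<lambda>y. \<bar>\<nu> m 0\<bar> + C * \<bar>x\<bar> + C * \<bar>y\<bar>)" for x
    using iF by simp
  have int: "integrable (F m) (\<lambda>y. \<nu> m (max 0 (x + y)))" for x
    by (rule Bochner_Integration.integrable_bound[OF ib[of x]]) (use bnd[of x] in \<open>auto intro: order_trans[OF _ abs_ge_self]\<close>)
  show ?thesis
  proof (rule that)
    let ?c = "\<bar>\<nu> m 0\<bar> + C + C * I + 1"
    show "0 < ?c" using C0 I0 by (simp add: add_nonneg_pos)
    fix x
    have "\<bar>\<integral>y. \<nu> m (max 0 (x + y)) \<partial>F m\<bar> \<le> (\<integral>y. \<bar>\<nu> m (max 0 (x + y))\<bar> \<partial>F m)"
      by (rule integral_abs_bound)
    also have "\<dots> \<le> (\<integral>y. \<bar>\<nu> m 0\<bar> + C * \<bar>x\<bar> + C * \<bar>y\<bar> \<partial>F m)"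
      using bnd int ib by (intro integral_mono) auto
    also have "\<dots> = \<bar>\<nu> m 0\<bar> + C * \<bar>x\<bar> + C * I"
      using iF by (simp add: I_def prob_space.prob_space[OF F_prob])
    also have "\<dots> \<le> ?c * (1 + \<bar>x\<bar>)"
      using C0 I0 by (simp add: algebra_simps add_increasing)
    finally show "\<bar>\<integral>y. \<nu> m (max 0 (x + y)) \<partial>F m\<bar> \<le> ?c * (1 + \<bar>x\<bar>)" .
  next
    have "C-lipschitz_on UNIV (\<lambda>x. \<integral>y. \<nu> m (max 0 (x + y)) \<partial>F m)"
    proof (rule lipschitz_onI)
      fix x x' :: real
      have "\<bar>(\<integral>y. \<nu> m (max 0 (x + y)) \<partial>F m) - (\<integral>y. \<nu> m (max 0 (x' + y)) \<partial>F m)\<bar>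
          = \<bar>\<integral>y. \<nu> m (max 0 (x + y)) - \<nu> m (max 0 (x' + y)) \<partial>F m\<bar>"
        using int by simp
      also have "\<dots> \<le> (\<integral>y. \<bar>\<nu> m (max 0 (x + y)) - \<nu> m (max 0 (x' + y))\<bar> \<partial>F m)"
        by (rule integral_abs_bound)
      also have "\<dots> \<le> (\<integral>y. C * \<bar>x - x'\<bar> \<partial>F m)"
      proof (rule integral_mono)
        show "\<bar>\<nu> m (max 0 (x + y)) - \<nu> m (max 0 (x' + y))\<bar> \<le> C * \<bar>x - x'\<bar>" for y
          using diff[of "x + y" "x' + y"] by simp
      qed (use int in auto)
      finally show "dist (\<integral>y. \<nu> m (max 0 (x + y)) \<partial>F m) (\<integral>y. \<nu> m (max 0 (x' + y)) \<partial>F m) \<le> C * dist x x'"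
        by (simp add: dist_real_def prob_space.prob_space[OF F_prob])
    qed (rule C0)
    then show "continuous_on UNIV (\<lambda>x. \<integral>y. \<nu> m (max 0 (x + y)) \<partial>F m)"
      by (rule lipschitz_on_continuous_on)
  qed
qed

lemma measurable_v [measurable]: "v \<in> borel_measurable borel"
proof -
  have [measurable]: "(\<lambda>x. \<integral>y. \<nu> m (max 0 (x + y)) \<partial>F m) \<in> borel_measurable borel" for m
    using station_value[of m] by (metis borel_measurable_continuous_onI)
  show ?thesis
    unfolding mean_value_def[abs_def]
  proof (rule borel_measurable_vec_lambda)
    fix a :: "'m option"
    show "(\<lambda>x. case a of None \<Rightarrow> 0 | Some m \<Rightarrow> \<integral>y. \<nu> m (max 0 (x $ m + y)) \<partial>F m)
        \<in> borel_measurable borel"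
      by (cases a) auto
  qed
qed

lemma value_bound:
  obtains c where "0 < c" "\<And>a x. \<bar>v x $ a\<bar> \<le> c * (1 + total_work x)"
    "\<And>x. norm (v x) \<le> c * (1 + total_work x)"
proof -
  have "\<exists>c>0. \<forall>x. \<bar>v x $ a\<bar> \<le> c * (1 + total_work x)" for a
  proof (cases a)
    case None
    then show ?thesis
      by (intro exI[of _ 1]) (auto simp: mean_value_def add_nonneg_nonneg total_work_nonneg)
  next
    case (Some m)
    obtain c where c: "0 < c" "\<And>x. \<bar>\<integral>y. \<nu> m (max 0 (x + y)) \<partial>F m\<bar> \<le> c * (1 + \<bar>x\<bar>)"
      using station_value[of m] by metis
    have "\<bar>v x $ a\<bar> \<le> c * (1 + total_work x)" for x
    proof -
      have "\<bar>v x $ a\<bar> \<le> c * (1 + \<bar>x $ m\<bar>)" using c(2)[of "x $ m"] by (simp add: mean_value_def Some)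
      also have "\<dots> \<le> c * (1 + total_work x)"
        using c(1) abs_component_le_total_work[of x m] by (intro mult_left_mono) auto
      finally show ?thesis .
    qed
    with c(1) show ?thesis by blast
  qed
  then have "\<exists>c. \<forall>a. 0 < c a \<and> (\<forall>x. \<bar>v x $ a\<bar> \<le> c a * (1 + total_work x))"
    by (intro choice allI) blast
  then obtain c where c: "\<And>a. 0 < c a" "\<And>a x. \<bar>v x $ a\<bar> \<le> c a * (1 + total_work x)"
    by blast
  have nv: "norm (v x) \<le> (\<Sum>a\<in>UNIV. c a) * (1 + total_work x)" for x
  proof -
    have "norm (v x) \<le> (\<Sum>a\<in>UNIV. \<bar>v x $ a\<bar>)" by (rule norm_le_l1_cart)
    also have "\<dots> \<le> (\<Sum>a\<in>UNIV. c a * (1 + total_work x))" by (intro sum_mono c(2))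
    finally show ?thesis by (simp add: sum_distrib_right)
  qed
  show ?thesis
  proof (rule that)
    show "0 < (\<Sum>a\<in>UNIV. c a)" using c(1) by (intro sum_pos) auto
    show "norm (v x) \<le> (\<Sum>a\<in>UNIV. c a) * (1 + total_work x)" for x by (rule nv)
    show "\<bar>v x $ a\<bar> \<le> (\<Sum>a\<in>UNIV. c a) * (1 + total_work x)" for a x
      by (rule order_trans[OF component_le_norm_cart nv])
  qed
qed

lemma sets_stationary_dist: "p \<in> strategies \<Longrightarrow> sets (stationary_dist H F p) = sets borel"
  using is_stationary_stationary_dist[of p] by (simp add: is_stationary_def)

lemma utility_component_eq_integral:
  assumes p: "p \<in> strategies"
  shows "u p $ a = (\<integral>x. v x $ a \<partial>stationary_dist H F p)"
proof -
  have [measurable_cong]: "sets (stationary_dist H F p) = sets borel" by (rule sets_stationary_dist[OF p])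
  obtain c where c: "0 < c" "\<And>x. norm (v x) \<le> c * (1 + total_work x)" using value_bound by metis
  have "integrable (stationary_dist H F p) (\<lambda>x. c * (1 + total_work x))"
    by (rule integral_stationary_dist(1)[OF p, of _ c]) (use c(1) in \<open>auto simp: abs_mult intro: add_nonneg_nonneg total_work_nonneg\<close>)
  then have "integrable (stationary_dist H F p) v"
    by (rule Bochner_Integration.integrable_bound) (use c(2) in \<open>auto intro: order_trans[OF _ abs_ge_self]\<close>)
  then have "(\<integral>x. v x $ a \<partial>stationary_dist H F p) = (\<integral>x. v x \<partial>stationary_dist H F p) $ a"
    by (rule integral_bounded_linear[OF bounded_linear_vec_nth])
  then show ?thesis by (simp add: expected_utility_def)
qed

lemma utility_component:
  assumes p: "p \<in> strategies"
  shows "u p $ a = cycle_mean p (\<lambda>x. v x $ a) / mean_length p"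
proof -
  obtain c where c: "0 < c" "\<And>a x. \<bar>v x $ a\<bar> \<le> c * (1 + total_work x)" using value_bound by metis
  show ?thesis
    unfolding utility_component_eq_integral[OF p]
    by (rule integral_stationary_dist(2)[OF p _ c(2)]) measurable
qed

lemma mean_length_ge_1:
  assumes p: "p \<in> strategies"
  shows "1 \<le> mean_length p"
proof -
  interpret P: regenerative_chain "primitives H F p" next_workload by (rule workload_chain)
  have "Green p (\<lambda>_. 0) 0 = 0"
    using P.green_cmult[of "\<lambda>_. 1" 0 0] by simp
  moreover have "enn2real 1 \<le> enn2real (Green p (\<lambda>_. 1) 0)"
    using P.green_one_ge_1[of 0] Green_one_finite[OF p, of 0] by (intro enn2real_mono) auto
  ultimately show ?thesis by (simp add: cycle_mean_def ennreal_neg)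
qed

lemma utility_lipschitz:
  "\<exists>K\<ge>0. \<forall>p\<in>strategies. \<forall>q\<in>strategies. norm (u q - u p) \<le> K * norm (q - p)"
proof -
  obtain c where c: "0 < c" "\<And>a x. \<bar>v x $ a\<bar> \<le> c * (1 + total_work x)" using value_bound by metis
  obtain K where K: "0 \<le> K" and
    bd: "\<And>p q h c. p \<in> strategies \<Longrightarrow> q \<in> strategies \<Longrightarrow> h \<in> borel_measurable borel \<Longrightarrow> 0 < c \<Longrightarrow>
      (\<And>x. \<bar>h x\<bar> \<le> c * (1 + total_work x)) \<Longrightarrow> \<bar>cycle_mean p h\<bar> \<le> K * c \<and>
      \<bar>cycle_mean q h - cycle_mean p h\<bar> \<le> K * c * norm (q - p)"
    using cycle_mean_bounds by blast
  define K' where "K' = K * c + K * c * K"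
  have comp: "\<bar>u q $ a - u p $ a\<bar> \<le> K' * norm (q - p)" if p: "p \<in> strategies" and q: "q \<in> strategies" for p q a
  proof -
    define A where "A p = cycle_mean p (\<lambda>x. v x $ a)" for p
    have A: "\<bar>A p\<bar> \<le> K * c" "\<bar>A q - A p\<bar> \<le> K * c * norm (q - p)"
      using bd[OF p q _ c(1), of "\<lambda>x. v x $ a"] c(2) by (auto simp: A_def)
    have L: "\<bar>mean_length q - mean_length p\<bar> \<le> K * norm (q - p)"
      using bd[OF p q, of "\<lambda>_. 1" 1] total_work_nonneg by auto
    have L1: "1 \<le> mean_length p" "1 \<le> mean_length q" by (rule mean_length_ge_1; fact)+
    have "u q $ a - u p $ a = (A q - A p) / mean_length q
        + (A p / mean_length p) * ((mean_length p - mean_length q) / mean_length q)"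
      using L1 by (simp add: utility_component p q A_def field_simps)
    also have "\<bar>\<dots>\<bar> \<le> \<bar>(A q - A p) / mean_length q\<bar>
        + \<bar>A p / mean_length p\<bar> * \<bar>(mean_length p - mean_length q) / mean_length q\<bar>"
      by (metis abs_mult abs_triangle_ineq)
    also have "\<dots> \<le> K * c * norm (q - p) + (K * c) * (K * norm (q - p))"
    proof (intro add_mono mult_mono)
      have shrink: "\<bar>x / l\<bar> \<le> \<bar>x\<bar>" if "1 \<le> l" for x l :: real
        using that divide_left_mono[of 1 l "\<bar>x\<bar>"] by (simp add: abs_divide)
      show "\<bar>(A q - A p) / mean_length q\<bar> \<le> K * c * norm (q - p)"
        using shrink[OF L1(2), of "A q - A p"] A(2) by linarith
      show "\<bar>A p / mean_length p\<bar> \<le> K * c"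
        using shrink[OF L1(1), of "A p"] A(1) by linarith
      show "\<bar>(mean_length p - mean_length q) / mean_length q\<bar> \<le> K * norm (q - p)"
        using shrink[OF L1(2), of "mean_length p - mean_length q"] L by linarith
    qed (use K c(1) in auto)
    finally show ?thesis by (simp add: K'_def algebra_simps)
  qed
  have "norm (u q - u p) \<le> (CARD('m option) * K') * norm (q - p)" if p: "p \<in> strategies" and q: "q \<in> strategies" for p q
  proof -
    have "norm (u q - u p) \<le> (\<Sum>a\<in>UNIV. \<bar>(u q - u p) $ a\<bar>)" by (rule norm_le_l1_cart)
    also have "\<dots> \<le> (\<Sum>a\<in>(UNIV::'m option set). K' * norm (q - p))"
      by (intro sum_mono) (use comp[OF p q] in auto)
    finally show ?thesis by (simp add: mult.assoc)
  qed
  moreover have "0 \<le> CARD('m option) * K'" using K c(1) by (simp add: K'_def)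
  ultimately show ?thesis by blast
qed

lemma utility_None:
  assumes p: "p \<in> strategies"
  shows "u p $ None = 0"
  by (simp add: utility_component_eq_integral[OF p] mean_value_def)

text \<open>
  Under this strategy the stations other than \<open>m\<close> stay empty.
\<close>

definition isolated :: "'m \<Rightarrow> real \<Rightarrow> real ^ ('m option)" where
  "isolated m s = (\<chi> a. if a = Some m then s else if a = None then 1 - s else 0)"

lemma isolated_strategy: "0 \<le> s \<Longrightarrow> s \<le> 1 \<Longrightarrow> isolated m s \<in> strategies"
  by (auto simp: strategies_def isolated_def UNIV_option_conv sum.reindex cong: if_cong)

lemma strategy_component_le_1:
  assumes "p \<in> strategies"
  shows "p $ a \<le> 1"
  using assms member_le_sum[of a UNIV "\<lambda>a. p $ a"] by (auto simp: strategies_def)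

text \<open>
  Erasing all other stations maps the stationary distribution under \<open>p\<close> to a stationary distribution
  under the isolated strategy, because station \<open>m\<close> only notices whether or not it is joined. By
  uniqueness it is the stationary distribution there.
\<close>

lemma utility_isolated:
  assumes p: "p \<in> strategies"
  shows "u p $ Some m = u (isolated m (p $ Some m)) $ Some m"
proof -
  let ?q = "isolated m (p $ Some m)"
  let ?\<pi> = "stationary_dist H F p"
  define e :: "real ^ 'm \<Rightarrow> real ^ 'm" where "e x = (\<chi> i. if i = m then x $ i else 0)" for x
  have [measurable]: "e \<in> borel_measurable borel"
    unfolding e_def[abs_def] by (rule borel_measurable_vec_lambda) auto
  interpret P: regenerative_chain "primitives H F p" next_workload by (rule workload_chain)
  interpret Q: regenerative_chain "primitives H F ?q" next_workload by (rule workload_chain)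
  have q: "?q \<in> strategies"
    using p strategy_component_le_1[OF p, of "Some m"] by (intro isolated_strategy) (auto simp: strategies_def)
  have st: "P.stationary ?\<pi>" using is_stationary_stationary_dist[OF p] by (simp add: is_stationary_iff)
  then have prob: "prob_space ?\<pi>" and sets[measurable_cong]: "sets ?\<pi> = sets borel"
    by (auto simp: P.stationary_def)
  have same: "(\<integral>\<^sup>+w. f (next_workload (e x) w) \<partial>primitives H F ?q)
      = (\<integral>\<^sup>+w. f (e (next_workload x w)) \<partial>primitives H F p)"
    if [measurable]: "f \<in> borel_measurable borel" for f :: "real ^ 'm \<Rightarrow> ennreal" and x
  proof -
    \<comment> \<open>the mean of \<open>f\<close> after a step from \<open>x\<close> with action \<open>a\<close>, all other stations being erased afterwards\<close>
    define J where "J a = (\<integral>\<^sup>+ty. f (e (next_workload x (fst ty, a, snd ty))) \<partial>base)" for a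
    have J_None: "J a = J None" if "a \<noteq> Some m" for a
      using that unfolding J_def e_def next_workload_def
      by (intro nn_integral_cong arg_cong[of _ _ f]) (auto simp: vec_eq_iff)
    have J_iso: "(\<integral>\<^sup>+ty. f (next_workload (e x) (fst ty, a, snd ty)) \<partial>base) = J a" if "a = Some m \<or> a = None" for a
      unfolding J_def
    proof (rule nn_integral_cong_AE)
      show "AE ty in base. f (next_workload (e x) (fst ty, a, snd ty)) = f (e (next_workload x (fst ty, a, snd ty)))"
        using AE_base_arrival
      proof eventually_elim
        case (elim ty)
        then have "next_workload (e x) (fst ty, a, snd ty) = e (next_workload x (fst ty, a, snd ty))"
          using that by (auto simp: vec_eq_iff e_def next_workload_def)
        then show ?case by simp
      qed
    qed
    have "(\<integral>\<^sup>+w. f (next_workload (e x) w) \<partial>primitives H F ?q)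
        = (\<Sum>a\<in>UNIV. ennreal (?q $ a) * (\<integral>\<^sup>+ty. f (next_workload (e x) (fst ty, a, snd ty)) \<partial>base))"
      by (rule nn_integral_primitives[OF q]) measurable
    also have "\<dots> = (\<Sum>a\<in>{Some m, None}. ennreal (?q $ a) * J a)"
      by (intro sum.mono_neutral_cong_right) (auto simp: isolated_def J_iso)
    also have "\<dots> = ennreal (p $ Some m) * J (Some m) + ennreal (1 - p $ Some m) * J None"
      by (simp add: isolated_def)
    also have "ennreal (1 - p $ Some m) = (\<Sum>a\<in>UNIV - {Some m}. ennreal (p $ a))"
    proof -
      have "1 - p $ Some m = (\<Sum>a\<in>UNIV - {Some m}. p $ a)"
        using p by (simp add: strategies_def sum_diff1)
      then show ?thesis using p by (simp add: strategies_def sum_ennreal)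
    qed
    also have "(\<Sum>a\<in>UNIV - {Some m}. ennreal (p $ a)) * J None = (\<Sum>a\<in>UNIV - {Some m}. ennreal (p $ a) * J a)"
      unfolding sum_distrib_right
    proof (intro sum.cong refl)
      fix a assume "a \<in> UNIV - {Some m}"
      then show "ennreal (p $ a) * J None = ennreal (p $ a) * J a" using J_None[of a] by simp
    qed
    also have "ennreal (p $ Some m) * J (Some m) + \<dots> = (\<Sum>a\<in>UNIV. ennreal (p $ a) * J a)"
      by (rule sum.remove[symmetric]) auto
    also have "\<dots> = (\<integral>\<^sup>+w. f (e (next_workload x w)) \<partial>primitives H F p)"
      unfolding J_def by (rule nn_integral_primitives[OF p, symmetric]) measurable
    finally show ?thesis .
  qed
  have "Q.stationary (distr ?\<pi> borel e)"
  proof (rule Q.stationaryI)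
    show "prob_space (distr ?\<pi> borel e)"
      by (rule prob_space.prob_space_distr[OF prob]) measurable
    fix A :: "(real ^ 'm) set" assume [measurable]: "A \<in> sets borel"
    have "(\<integral>\<^sup>+x. (\<integral>\<^sup>+w. indicator A (next_workload x w) \<partial>primitives H F ?q) \<partial>distr ?\<pi> borel e)
        = (\<integral>\<^sup>+x. (\<integral>\<^sup>+w. indicator A (next_workload (e x) w) \<partial>primitives H F ?q) \<partial>?\<pi>)"
      by (rule nn_integral_distr) measurable
    also have "\<dots> = (\<integral>\<^sup>+x. (\<integral>\<^sup>+w. indicator A (e (next_workload x w)) \<partial>primitives H F p) \<partial>?\<pi>)"
      by (intro nn_integral_cong same) measurable
    also have "\<dots> = (\<integral>\<^sup>+x. indicator A (e x) \<partial>?\<pi>)"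
      by (rule P.nn_integral_stationary[OF st, symmetric]) measurable
    also have "\<dots> = emeasure (distr ?\<pi> borel e) A"
      by (subst nn_integral_distr[symmetric, of e ?\<pi> borel "indicator A"]) auto
    finally show "(\<integral>\<^sup>+x. (\<integral>\<^sup>+w. indicator A (next_workload x w) \<partial>primitives H F ?q) \<partial>distr ?\<pi> borel e)
        = emeasure (distr ?\<pi> borel e) A" .
  qed simp
  then have eq: "distr ?\<pi> borel e = stationary_dist H F ?q"
    using is_stationary_unique[OF q] by (simp add: is_stationary_iff stationary_dist_eq[OF q])
  have "u ?q $ Some m = (\<integral>x. v x $ Some m \<partial>distr ?\<pi> borel e)"
    unfolding utility_component_eq_integral[OF q] eq ..
  also have "\<dots> = (\<integral>x. v (e x) $ Some m \<partial>?\<pi>)"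
    by (rule integral_distr) measurable
  also have "\<dots> = u p $ Some m"
    unfolding utility_component_eq_integral[OF p] by (simp add: mean_value_def e_def)
  finally show ?thesis ..
qed

lemma measurable_cycle_sum [measurable]: "cycle_sum F \<nu> \<in> borel_measurable (driving p)"
  unfolding cycle_sum_def[abs_def] by measurable

lemma prob_space_driving: "prob_space (driving p)"
  by (intro prob_space_PiM prob_space_primitives)

lemma prob_space_cycle_law: "prob_space (cycle_law H F \<nu> p)"
  unfolding cycle_law_def by (rule prob_space.prob_space_distr[OF prob_space_driving]) measurable

lemma sets_cycle_law [simp, measurable_cong]: "sets (cycle_law H F \<nu> p) = sets borel"
  by (simp add: cycle_law_def)

text \<open>
  The mean cycle length cancels the denominator of the regenerative formula.
\<close>

lemma integral_cycle_law:
  assumes p: "p \<in> strategies"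
  shows "integrable (cycle_law H F \<nu> p) (\<lambda>g. g $ a)"
    and "(\<integral>g. g $ a \<partial>cycle_law H F \<nu> p) = mean_length p * u p $ a"
proof -
  obtain c where c: "0 < c" "\<And>a x. \<bar>v x $ a\<bar> \<le> c * (1 + total_work x)" using value_bound by metis
  have m: "(\<lambda>x. v x $ a) \<in> borel_measurable borel" by measurable
  have comp: "cycle_sum F \<nu> \<omega> $ a = (\<Sum>j<cycle_length \<omega>. v (workload \<omega> j) $ a)" for \<omega>
    by (simp add: cycle_sum_def)
  show "integrable (cycle_law H F \<nu> p) (\<lambda>g. g $ a)"
    unfolding cycle_law_def
    by (subst integrable_distr_eq) (auto simp: comp intro: integral_sum_cycle(1)[OF p m c(2)])
  have "(\<integral>g. g $ a \<partial>cycle_law H F \<nu> p) = cycle_mean p (\<lambda>x. v x $ a)"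
    unfolding cycle_law_def
    by (subst integral_distr) (auto simp: comp intro: integral_sum_cycle(2)[OF p m c(2)])
  then show "(\<integral>g. g $ a \<partial>cycle_law H F \<nu> p) = mean_length p * u p $ a"
    using mean_length_ge_1[OF p] by (simp add: utility_component[OF p])
qed

lemma cycle_law_second_moment:
  "\<exists>C\<ge>0. \<forall>p\<in>strategies. (\<integral>\<^sup>+g. ennreal ((norm g)\<^sup>2) \<partial>cycle_law H F \<nu> p) \<le> ennreal C"
proof -
  obtain c where c: "0 < c" "\<And>x. norm (v x) \<le> c * (1 + total_work x)" using value_bound by metis
  obtain C where C: "0 \<le> C" "\<And>p. p \<in> strategies \<Longrightarrow>
    (\<integral>\<^sup>+\<omega>. (\<Sum>j. regenerative_chain.visit next_workload (\<lambda>x. ennreal (1 + total_work x)) 0 \<omega> j)\<^sup>2 \<partial>driving p) \<le> ennreal C"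
    using second_moment_bound by blast
  have "(\<integral>\<^sup>+g. ennreal ((norm g)\<^sup>2) \<partial>cycle_law H F \<nu> p) \<le> ennreal (c\<^sup>2 * C)" if p: "p \<in> strategies" for p
  proof -
    interpret P: regenerative_chain "primitives H F p" next_workload by (rule workload_chain)
    let ?S = "\<lambda>\<omega>. \<Sum>j. P.visit (\<lambda>x. ennreal (1 + total_work x)) 0 \<omega> j"
    have "(\<integral>\<^sup>+g. ennreal ((norm g)\<^sup>2) \<partial>cycle_law H F \<nu> p) = (\<integral>\<^sup>+\<omega>. ennreal ((norm (cycle_sum F \<nu> \<omega>))\<^sup>2) \<partial>driving p)"
      unfolding cycle_law_def by (rule nn_integral_distr) measurable
    also have "\<dots> \<le> (\<integral>\<^sup>+\<omega>. ennreal (c\<^sup>2) * (?S \<omega>)\<^sup>2 \<partial>driving p)"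
    proof (rule nn_integral_mono_AE)
      show "AE \<omega> in driving p. ennreal ((norm (cycle_sum F \<nu> \<omega>))\<^sup>2) \<le> ennreal (c\<^sup>2) * (?S \<omega>)\<^sup>2"
        using AE_cycle_sum_eq[OF p]
      proof eventually_elim
        case (elim \<omega>)
        let ?s = "\<Sum>j<cycle_length \<omega>. 1 + total_work (workload \<omega> j)"
        have "?S \<omega> = (\<Sum>j<cycle_length \<omega>. ennreal (1 + total_work (workload \<omega> j)))"
          using elim by blast
        also have "\<dots> = ennreal ?s"
          by (intro sum_ennreal add_nonneg_nonneg total_work_nonneg) simp
        finally have s: "?S \<omega> = ennreal ?s" .
        have "norm (cycle_sum F \<nu> \<omega>) \<le> c * ?s"
          unfolding cycle_sum_def sum_distrib_left
          by (rule order_trans[OF norm_sum]) (intro sum_mono c(2))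
        then have "(norm (cycle_sum F \<nu> \<omega>))\<^sup>2 \<le> c\<^sup>2 * ?s\<^sup>2"
          using power_mono[of "norm (cycle_sum F \<nu> \<omega>)" "c * ?s" 2] by (simp add: power_mult_distrib)
        then have "ennreal ((norm (cycle_sum F \<nu> \<omega>))\<^sup>2) \<le> ennreal (c\<^sup>2 * ?s\<^sup>2)" by (rule ennreal_leI)
        also have "\<dots> = ennreal (c\<^sup>2) * (?S \<omega>)\<^sup>2"
          unfolding s by (subst ennreal_power) (auto simp: ennreal_mult' total_work_nonneg intro!: sum_nonneg)
        finally show ?case .
      qed
    qed
    also have "\<dots> = ennreal (c\<^sup>2) * (\<integral>\<^sup>+\<omega>. (?S \<omega>)\<^sup>2 \<partial>driving p)"
      by (rule nn_integral_cmult) measurable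
    also have "\<dots> \<le> ennreal (c\<^sup>2) * ennreal C"
      by (intro mult_left_mono C(2)[OF p]) simp
    also have "\<dots> = ennreal (c\<^sup>2 * C)" using C(1) by (simp add: ennreal_mult)
    finally show ?thesis .
  qed
  moreover have "0 \<le> c\<^sup>2 * C" using C(1) by simp
  ultimately show ?thesis by blast
qed

end

section \<open>Projected stochastic ascent along a potential\<close>

text \<open>
  That \<open>u\<close> is the gradient of \<open>\<Phi>\<close> is expressed by the first-order expansion, which makes sense at the
  boundary of \<open>S\<close> as well.
\<close>

locale potential_field =
  fixes S :: "'v::euclidean_space set" and \<Phi> :: "'v \<Rightarrow> real" and u :: "'v \<Rightarrow> 'v" and K :: real
  assumes S: "compact S" "convex S" "S \<noteq> {}"
    and K: "0 \<le> K"
    and gradient: "\<And>x y. x \<in> S \<Longrightarrow> y \<in> S \<Longrightarrow> \<bar>\<Phi> y - \<Phi> x - u x \<bullet> (y - x)\<bar> \<le> K * (norm (y - x))\<^sup>2"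
    and field_lipschitz: "\<And>x y. x \<in> S \<Longrightarrow> y \<in> S \<Longrightarrow> norm (u y - u x) \<le> K * norm (y - x)"
begin

definition critical :: "'v set" where
  "critical = {x \<in> S. \<forall>y\<in>S. u x \<bullet> (y - x) \<le> 0}"

text \<open>
  Moving from a maximiser \<open>x\<close> towards \<open>y\<close> by a fraction \<open>t\<close> changes the objective by \<open>t\<close> times the
  left-hand side, up to a term of order \<open>t\<^sup>2\<close>.
\<close>

lemma first_order_condition:
  assumes x: "x \<in> S" and y: "y \<in> S" and \<kappa>: "0 \<le> \<kappa>"
    and max: "\<And>y. y \<in> S \<Longrightarrow> \<Phi> y - \<kappa> * (norm (y - z))\<^sup>2 \<le> \<Phi> x - \<kappa> * (norm (x - z))\<^sup>2"
  shows "(u x - (2 * \<kappa>) *\<^sub>R (x - z)) \<bullet> (y - x) \<le> 0"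
proof (rule ccontr)
  let ?d = "y - x"
  let ?A = "(u x - (2 * \<kappa>) *\<^sub>R (x - z)) \<bullet> ?d"
  assume "\<not> ?A \<le> 0"
  then have A: "0 < ?A" by simp
  define c where "c = (K + \<kappa>) * (norm ?d)\<^sup>2"
  have c0: "0 \<le> c" using K \<kappa> by (simp add: c_def)
  \<comment> \<open>small enough for \<open>t * c < ?A\<close>, so that the first-order term wins\<close>
  define t where "t = min 1 (?A / (c + 1) / 2)"
  have t: "0 < t" "t \<le> 1" using A c0 by (auto simp: t_def)
  have "t * c \<le> ?A / (c + 1) / 2 * c" using c0 by (intro mult_right_mono) (auto simp: t_def)
  also have "\<dots> < ?A"
  proof -
    have "c / (c + 1) / 2 < 1" using c0 by (simp add: field_simps)
    then have "?A * (c / (c + 1) / 2) < ?A * 1" using A by (intro mult_strict_left_mono) auto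
    then show ?thesis by (simp add: field_simps)
  qed
  finally have tc: "t * c < ?A" .
  have yt: "x + t *\<^sub>R ?d \<in> S"
    using convexD_alt[OF S(2) x y, of t] t by (simp add: algebra_simps)
  let ?X = "(x - z) \<bullet> ?d" and ?U = "u x \<bullet> ?d" and ?D = "(norm ?d)\<^sup>2"
  have A_eq: "?A = ?U - 2 * \<kappa> * ?X" by (simp only: inner_diff_left inner_scaleR_left)
  have expand: "(norm (x + t *\<^sub>R ?d - z))\<^sup>2 = (norm (x - z))\<^sup>2 + 2 * t * ?X + t\<^sup>2 * ?D"
    unfolding power2_norm_eq_inner by (simp add: inner_add_left inner_add_right inner_diff_left inner_diff_right
      inner_commute power2_eq_square algebra_simps)
  have "\<Phi> x + t * ?U - K * (t\<^sup>2 * ?D) \<le> \<Phi> (x + t *\<^sub>R ?d)"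
    using gradient[OF x yt] t by (simp add: power_mult_distrib abs_le_iff)
  also have "\<dots> \<le> \<Phi> x + \<kappa> * (2 * t * ?X + t\<^sup>2 * ?D)"
    using max[OF yt] unfolding expand by (simp add: distrib_left)
  finally have "t * ?U - t * (2 * \<kappa> * ?X) \<le> t\<^sup>2 * ((K + \<kappa>) * ?D)"
    by (simp only: distrib_left distrib_right mult_ac)
  then have "t * ?A \<le> t * (t * c)"
    unfolding A_eq c_def by (simp only: right_diff_distrib power2_eq_square mult.assoc)
  then show False using t tc by simp
qed

lemma continuous_on_potential: "continuous_on S \<Phi>"
  unfolding continuous_on_def
proof
  fix x assume x: "x \<in> S"
  have "((\<lambda>y. norm (u x) * norm (y - x) + K * (norm (y - x))\<^sup>2) \<longlongrightarrow> norm (u x) * norm (x - x) + K * (norm (x - x))\<^sup>2) (at x within S)"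
    by (intro tendsto_intros)
  then have lim: "((\<lambda>y. norm (u x) * norm (y - x) + K * (norm (y - x))\<^sup>2) \<longlongrightarrow> 0) (at x within S)"
    by simp
  have "\<forall>\<^sub>F y in at x within S. norm (\<Phi> y - \<Phi> x) \<le> norm (u x) * norm (y - x) + K * (norm (y - x))\<^sup>2"
    unfolding eventually_at_filter
  proof (intro always_eventually allI impI)
    fix y assume "y \<in> S"
    have "\<bar>u x \<bullet> (y - x)\<bar> \<le> norm (u x) * norm (y - x)" by (rule Cauchy_Schwarz_ineq2)
    with gradient[OF x \<open>y \<in> S\<close>] show "norm (\<Phi> y - \<Phi> x) \<le> norm (u x) * norm (y - x) + K * (norm (y - x))\<^sup>2"
      by (simp add: abs_le_iff)
  qed
  then have "((\<lambda>y. \<Phi> y - \<Phi> x) \<longlongrightarrow> 0) (at x within S)"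
    by (rule Lim_null_comparison[OF _ lim])
  then show "(\<Phi> \<longlongrightarrow> \<Phi> x) (at x within S)"
    by (simp add: LIM_zero_iff)
qed

lemma critical_nonempty: "critical \<noteq> {}"
proof -
  obtain x where x: "x \<in> S" "\<And>y. y \<in> S \<Longrightarrow> \<Phi> y \<le> \<Phi> x"
    using continuous_attains_sup[OF S(1,3) continuous_on_potential] by blast
  have "u x \<bullet> (y - x) \<le> 0" if "y \<in> S" for y
    using first_order_condition[OF x(1) that, of 0 x] x(2) by simp
  with x(1) show ?thesis by (auto simp: critical_def)
qed

text \<open>
  The maximiser of the potential penalised by the squared distance from \<open>x\<close>. The factor \<open>K + 1\<close> makes
  the penalty stronger than the curvature of the potential, so that the maximiser is unique and
  depends continuously on \<open>x\<close>.
\<close>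

definition prox :: "'v \<Rightarrow> 'v" where
  "prox x = (SOME z. z \<in> S \<and> (\<forall>y\<in>S. \<Phi> y - (K + 1) * (norm (y - x))\<^sup>2 \<le> \<Phi> z - (K + 1) * (norm (z - x))\<^sup>2))"

lemma prox:
  shows prox_in: "prox x \<in> S"
    and prox_max: "y \<in> S \<Longrightarrow> \<Phi> y - (K + 1) * (norm (y - x))\<^sup>2 \<le> \<Phi> (prox x) - (K + 1) * (norm (prox x - x))\<^sup>2"
proof -
  have "continuous_on S (\<lambda>y. \<Phi> y - (K + 1) * (norm (y - x))\<^sup>2)"
    by (intro continuous_intros continuous_on_potential)
  then have "\<exists>z. z \<in> S \<and> (\<forall>y\<in>S. \<Phi> y - (K + 1) * (norm (y - x))\<^sup>2 \<le> \<Phi> z - (K + 1) * (norm (z - x))\<^sup>2)"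
    using continuous_attains_sup[OF S(1,3)] by blast
  then have *: "prox x \<in> S \<and> (\<forall>y\<in>S. \<Phi> y - (K + 1) * (norm (y - x))\<^sup>2 \<le> \<Phi> (prox x) - (K + 1) * (norm (prox x - x))\<^sup>2)"
    unfolding prox_def by (rule someI_ex)
  show "prox x \<in> S" using * by blast
  show "y \<in> S \<Longrightarrow> \<Phi> y - (K + 1) * (norm (y - x))\<^sup>2 \<le> \<Phi> (prox x) - (K + 1) * (norm (prox x - x))\<^sup>2"
    using * by blast
qed

lemma prox_first_order:
  assumes y: "y \<in> S"
  shows "(u (prox x) - (2 * (K + 1)) *\<^sub>R (prox x - x)) \<bullet> (y - prox x) \<le> 0"
  by (rule first_order_condition[OF prox_in y]) (use K prox_max in auto)

text \<open>
  Add up the first-order conditions of the two maximisers, each tested at the other: as \<open>u\<close> is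
  \<open>K\<close>-Lipschitz, the quadratic penalty retains a strictly positive share of the squared distance.
\<close>

lemma prox_lipschitz: "norm (prox x - prox y) \<le> 2 * norm (x - y)"
proof -
  let ?a = "prox x" and ?b = "prox y"
  define d where "d = ?b - ?a"
  have "(u ?a - (2 * (K + 1)) *\<^sub>R (?a - x)) \<bullet> d \<le> 0" and "(u ?b - (2 * (K + 1)) *\<^sub>R (?b - y)) \<bullet> (- d) \<le> 0"
    using prox_first_order[OF prox_in, of x y] prox_first_order[OF prox_in, of y x] by (simp_all add: d_def)
  then have "2 * (K + 1) * ((?b - ?a) \<bullet> d) \<le> (u ?b - u ?a) \<bullet> d + 2 * (K + 1) * ((y - x) \<bullet> d)"
    by (simp add: inner_diff_left algebra_simps)
  also have "(u ?b - u ?a) \<bullet> d \<le> norm (u ?b - u ?a) * norm d" by (rule norm_cauchy_schwarz)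
  also have "\<dots> \<le> K * norm d * norm d"
    using field_lipschitz[OF prox_in prox_in, of y x] by (intro mult_right_mono) (auto simp: d_def)
  also have "2 * (K + 1) * ((y - x) \<bullet> d) \<le> 2 * (K + 1) * (norm (y - x) * norm d)"
    using K by (intro mult_left_mono norm_cauchy_schwarz) auto
  finally have "(K + 2) * norm d * norm d \<le> 2 * (K + 1) * norm (y - x) * norm d"
    by (simp add: d_def[symmetric] dot_square_norm power2_eq_square algebra_simps)
  then have "(K + 2) * norm d \<le> 2 * (K + 1) * norm (y - x)"
    by (cases "norm d = 0") (use K in auto)
  also have "\<dots> \<le> (K + 2) * (2 * norm (y - x))" using K by (simp add: algebra_simps)
  finally show ?thesis using K by (simp add: d_def norm_minus_commute)
qed

definition displacement :: "'v \<Rightarrow> 'v" where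
  "displacement x = prox x - x"

lemma displacement_lipschitz: "norm (displacement x) \<le> norm (displacement y) + 3 * norm (x - y)"
proof -
  have "displacement x = displacement y + ((prox x - prox y) - (x - y))"
    by (simp add: displacement_def)
  then have "norm (displacement x) \<le> norm (displacement y) + (norm (prox x - prox y) + norm (x - y))"
    using norm_triangle_ineq[of "displacement y" "(prox x - prox y) - (x - y)"] norm_triangle_ineq4[of "prox x - prox y" "x - y"]
    by simp
  with prox_lipschitz[of x y] show ?thesis by simp
qed

lemma continuous_prox: "continuous_on UNIV prox"
  by (rule lipschitz_on_continuous_on[of 2], rule lipschitz_onI)
     (auto simp: dist_norm prox_lipschitz)

lemma continuous_displacement: "continuous_on UNIV displacement"
  unfolding displacement_def[abs_def] by (intro continuous_intros continuous_prox)

text \<open>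
  Where the penalty vanishes at the maximiser, the first-order condition is that of the potential.
\<close>

lemma displacement_zero:
  assumes x: "x \<in> S" and z: "displacement x = 0"
  shows "x \<in> critical"
proof -
  have "prox x = x" using z by (simp add: displacement_def)
  then show ?thesis using prox_first_order[of _ x] x by (auto simp: critical_def)
qed

text \<open>
  The maximiser beats \<open>x\<close> itself by the penalty, and the gradient at \<open>x\<close> predicts this gain up to
  \<open>K\<close> times the squared distance, which is less than the penalty by one squared distance.
\<close>

lemma displacement_ascent:
  assumes x: "x \<in> S"
  shows "(norm (displacement x))\<^sup>2 \<le> displacement x \<bullet> u x"
proof -
  have "\<Phi> x \<le> \<Phi> (prox x) - (K + 1) * (norm (prox x - x))\<^sup>2"
    using prox_max[OF x, of x] by simp
  moreover have "\<Phi> (prox x) - \<Phi> x - u x \<bullet> (prox x - x) \<le> K * (norm (prox x - x))\<^sup>2"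
    using gradient[OF x prox_in, of x] by (simp add: abs_le_iff)
  ultimately show ?thesis by (simp add: displacement_def inner_commute algebra_simps)
qed

text \<open>
  The Moreau envelope of the potential restricted to \<open>S\<close>, that is, the maximal value of the penalised
  potential.
\<close>

definition envelope :: "'v \<Rightarrow> real" where
  "envelope x = \<Phi> (prox x) - (K + 1) * (norm (displacement x))\<^sup>2"

lemma continuous_envelope: "continuous_on UNIV envelope"
  unfolding envelope_def[abs_def]
  by (intro continuous_intros continuous_displacement
      continuous_on_compose2[OF continuous_on_potential continuous_prox]) (auto simp: prox_in)

text \<open>
  The maximiser \<open>prox x\<close> for the old point is a competitor for the new one. Its distance from the new
  point is not larger than that from the point before projection, as it lies in \<open>S\<close>; expanding the
  square leaves the increment \<open>g\<close> in a linear and a second-order term only.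
\<close>

lemma envelope_projected_step:
  assumes x: "x \<in> S"
  shows "envelope x + 2 * (K + 1) * \<gamma> * (displacement x \<bullet> g) - (K + 1) * \<gamma>\<^sup>2 * (norm g)\<^sup>2
    \<le> envelope (closest_point S (x + \<gamma> *\<^sub>R g))"
proof -
  let ?y = "closest_point S (x + \<gamma> *\<^sub>R g)" and ?z = "prox x"
  have closed: "closed S" using S(1) by (rule compact_imp_closed)
  have "dist ?z ?y = dist (closest_point S ?z) ?y"
    by (simp add: closest_point_self[OF prox_in])
  also have "\<dots> \<le> dist ?z (x + \<gamma> *\<^sub>R g)"
    by (rule closest_point_lipschitz[OF S(2) closed S(3)])
  finally have "(norm (?z - ?y))\<^sup>2 \<le> (norm (displacement x - \<gamma> *\<^sub>R g))\<^sup>2"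
    by (intro power_mono) (auto simp: dist_norm displacement_def algebra_simps)
  also have "\<dots> = (norm (displacement x))\<^sup>2 - 2 * \<gamma> * (displacement x \<bullet> g) + \<gamma>\<^sup>2 * (norm g)\<^sup>2"
    unfolding power2_norm_eq_inner
    by (simp add: inner_diff_left inner_diff_right inner_commute power2_eq_square algebra_simps)
  finally have "(K + 1) * (norm (?z - ?y))\<^sup>2
      \<le> (K + 1) * ((norm (displacement x))\<^sup>2 - 2 * \<gamma> * (displacement x \<bullet> g) + \<gamma>\<^sup>2 * (norm g)\<^sup>2)"
    using K by (intro mult_left_mono) auto
  moreover have "\<Phi> ?z - (K + 1) * (norm (?z - ?y))\<^sup>2 \<le> envelope ?y"
    using prox_max[OF prox_in, of x ?y] by (simp add: envelope_def displacement_def)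
  ultimately show ?thesis by (simp add: envelope_def algebra_simps)
qed

text \<open>
  On the part of \<open>S\<close> at distance at least \<open>e\<close> from the critical points, which is compact, the
  displacement is bounded away from \<open>0\<close>.
\<close>

lemma infdist_critical_tendsto:
  assumes in_S: "\<And>n. p n \<in> S" and lim: "(\<lambda>n. norm (displacement (p n))) \<longlonglongrightarrow> 0"
  shows "(\<lambda>n. infdist (p n) critical) \<longlonglongrightarrow> 0"
proof (rule order_tendstoI)
  fix e :: real assume "e < 0"
  then show "\<forall>\<^sub>F n in sequentially. e < infdist (p n) critical"
    by (intro always_eventually allI) (auto intro: less_le_trans infdist_nonneg)
next
  fix e :: real assume e: "0 < e"
  let ?C = "{x \<in> S. e \<le> infdist x critical}"
  have "closed {x. e \<le> infdist x critical}"
    by (intro closed_Collect_le continuous_intros)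
  then have "compact (S \<inter> {x. e \<le> infdist x critical})" by (rule compact_Int_closed[OF S(1)])
  moreover have "?C = S \<inter> {x. e \<le> infdist x critical}" by auto
  ultimately have C: "compact ?C" by simp
  show "\<forall>\<^sub>F n in sequentially. infdist (p n) critical < e"
  proof (cases "?C = {}")
    case True
    then show ?thesis using in_S by (intro always_eventually allI) (auto simp: not_le[symmetric])
  next
    case False
    have "continuous_on ?C (\<lambda>x. norm (displacement x))"
      by (intro continuous_intros continuous_on_subset[OF continuous_displacement]) auto
    then obtain x where x: "x \<in> ?C" "\<And>y. y \<in> ?C \<Longrightarrow> norm (displacement x) \<le> norm (displacement y)"
      using continuous_attains_inf[OF C False] by blast
    have "0 < norm (displacement x)"
    proof (rule ccontr)
      assume "\<not> ?thesis"
      then have "x \<in> critical" using displacement_zero x(1) by simp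
      then show False using x(1) e by simp
    qed
    then have "\<forall>\<^sub>F n in sequentially. norm (displacement (p n)) < norm (displacement x)"
      by (rule order_tendstoD[OF lim])
    then show ?thesis
      by eventually_elim (use x(2) in_S in \<open>force simp: not_le[symmetric]\<close>)
  qed
qed

end

text \<open>
  Since the steps with \<open>d n \<ge> \<epsilon>\<close> have finite total size, the divergent step sizes force \<open>d n < \<epsilon>\<close>
  infinitely often. After a late such time, \<open>d\<close> can rise to \<open>2 * \<epsilon>\<close> by a single step from below \<open>\<epsilon>\<close>,
  and beyond only by steps taken above \<open>\<epsilon>\<close>, which add up to little.
\<close>

lemma crossing_argument:
  fixes d s \<gamma> :: "nat \<Rightarrow> real"
  assumes d: "\<And>n. 0 \<le> d n" and s: "\<And>n. 0 \<le> s n" and \<gamma>: "\<And>n. 0 < \<gamma> n" and L: "0 \<le> L"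
    and step: "\<And>n. d (Suc n) \<le> d n + L * s n"
    and s0: "s \<longlonglongrightarrow> 0"
    and div: "\<not> summable \<gamma>"
    and fin: "\<And>\<epsilon>. 0 < \<epsilon> \<Longrightarrow> summable (\<lambda>n. if \<epsilon> \<le> d n then \<gamma> n + s n else 0)"
  shows "d \<longlonglongrightarrow> 0"
proof (rule LIMSEQ_I)
  fix e :: real assume e: "0 < e"
  define \<epsilon> where "\<epsilon> = e / 4"
  have \<epsilon>: "0 < \<epsilon>" using e by (simp add: \<epsilon>_def)
  let ?a = "\<lambda>n. if \<epsilon> \<le> d n then s n else 0"
  note sm = fin[OF \<epsilon>]
  have sa: "summable ?a"
    by (rule summable_comparison_test'[OF sm, of 0]) (use s \<gamma> in \<open>auto simp: less_imp_le\<close>)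
  have "\<exists>\<^sub>F n in sequentially. d n < \<epsilon>"
  proof (rule ccontr)
    assume "\<not> ?thesis"
    then obtain N where "\<And>n. N \<le> n \<Longrightarrow> \<epsilon> \<le> d n"
      by (auto simp: frequently_def eventually_sequentially not_less)
    then have "summable \<gamma>"
      by (intro summable_comparison_test'[OF sm, of N]) (use s \<gamma> in \<open>auto simp: less_imp_le\<close>)
    with div show False ..
  qed
  moreover have "\<forall>\<^sub>F n in sequentially. L * s n < \<epsilon>"
  proof -
    have "(\<lambda>n. L * s n) \<longlonglongrightarrow> L * 0" by (intro tendsto_intros s0)
    then show ?thesis using \<epsilon> by (auto dest: order_tendstoD(2))
  qed
  \<comment> \<open>the Cauchy criterion for the total size of the steps taken above \<open>\<epsilon>\<close>\<close>
  moreover have "\<forall>\<^sub>F n in sequentially. \<forall>m\<ge>n. L * (\<Sum>i=n..<m. ?a i) < \<epsilon>"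
  proof -
    have "0 < \<epsilon> / (L + 1)" using \<epsilon> L by simp
    from summable_partial_sum_bound[OF sa this] obtain N where
      N: "\<And>m n. N \<le> m \<Longrightarrow> norm (\<Sum>i=m..n. ?a i) < \<epsilon> / (L + 1)" by blast
    have "L * (\<Sum>i=n..<m. ?a i) < \<epsilon>" if "N \<le> n" for n m
    proof -
      have "(\<Sum>i=n..<m. ?a i) \<le> (\<Sum>i=n..m. ?a i)"
        by (rule sum_mono2) (use s in auto)
      also have "\<dots> < \<epsilon> / (L + 1)" using N[OF that, of m] by (simp add: abs_less_iff)
      finally have lt: "(\<Sum>i=n..<m. ?a i) < \<epsilon> / (L + 1)" .
      have "0 \<le> (\<Sum>i=n..<m. ?a i)" by (rule sum_nonneg) (use s in auto)
      then have "L * (\<Sum>i=n..<m. ?a i) \<le> (L + 1) * (\<Sum>i=n..<m. ?a i)" by (intro mult_right_mono) auto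
      also have "\<dots> < \<epsilon>" using lt L by (simp add: field_simps)
      finally show ?thesis .
    qed
    then show ?thesis by (auto simp: eventually_sequentially)
  qed
  ultimately have "\<exists>\<^sub>F n in sequentially. d n < \<epsilon> \<and> (\<forall>m\<ge>n. L * s m < \<epsilon>) \<and> (\<forall>m\<ge>n. L * (\<Sum>i=n..<m. ?a i) < \<epsilon>)"
    by (auto intro!: frequently_eventually_frequently eventually_conj simp: eventually_all_ge_at_top)
  then obtain n0 where n0: "d n0 < \<epsilon>" "\<And>m. n0 \<le> m \<Longrightarrow> L * s m < \<epsilon>"
    "\<And>m. n0 \<le> m \<Longrightarrow> L * (\<Sum>i=n0..<m. ?a i) < \<epsilon>"
    using frequently_ex by blast
  have "d n \<le> 2 * \<epsilon> + L * (\<Sum>i=n0..<n. ?a i)" if "n0 \<le> n" for n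
    using that
  proof (induction n rule: dec_induct)
    case base
    then show ?case using n0(1) \<epsilon> by simp
  next
    case (step n)
    show ?case
    proof (cases "\<epsilon> \<le> d n")
      case True
      then show ?thesis using step assms(5)[of n] by (simp add: algebra_simps)
    next
      case False
      have "0 \<le> L * (\<Sum>i=n0..<Suc n. ?a i)" using L s by (intro mult_nonneg_nonneg sum_nonneg) auto
      then show ?thesis using False assms(5)[of n] n0(2)[of n] step by linarith
    qed
  qed
  then have "d n < e" if "n0 \<le> n" for n
    using that n0(3)[of n] \<epsilon> by (fastforce simp: \<epsilon>_def)
  then show "\<exists>no. \<forall>n\<ge>no. norm (d n - 0) < e"
    using d by (intro exI[of _ n0]) auto
qed

lemma AE_summable_if_summable_integrals:
  fixes f :: "nat \<Rightarrow> 'a \<Rightarrow> real"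
  assumes [measurable]: "\<And>n. f n \<in> borel_measurable M"
    and f: "\<And>n \<omega>. 0 \<le> f n \<omega>" and c: "\<And>n. 0 \<le> c n" "summable c"
    and le: "\<And>n. (\<integral>\<^sup>+\<omega>. ennreal (f n \<omega>) \<partial>M) \<le> ennreal (c n)"
  shows "AE \<omega> in M. summable (\<lambda>n. f n \<omega>)"
proof -
  have "(\<integral>\<^sup>+\<omega>. (\<Sum>n. ennreal (f n \<omega>)) \<partial>M) = (\<Sum>n. \<integral>\<^sup>+\<omega>. ennreal (f n \<omega>) \<partial>M)"
    by (rule nn_integral_suminf) measurable
  also have "\<dots> \<le> (\<Sum>n. ennreal (c n))" by (intro suminf_le le) auto
  also have "\<dots> = ennreal (\<Sum>n. c n)" by (rule suminf_ennreal2[OF c])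
  finally have "(\<integral>\<^sup>+\<omega>. (\<Sum>n. ennreal (f n \<omega>)) \<partial>M) \<noteq> \<infinity>" by (auto simp: top_unique)
  then have "AE \<omega> in M. (\<Sum>n. ennreal (f n \<omega>)) \<noteq> \<infinity>"
    by (intro nn_integral_PInf_AE) auto
  then show ?thesis
    by eventually_elim (rule summable_suminf_not_top, auto simp: f)
qed

text \<open>
  The assumption on the mean says that the increments correlate with every field \<open>h\<close> pointing uphill at
  least as much as \<open>u\<close> does. With \<open>h\<close> the displacement, the envelope
  grows in mean by a multiple of \<open>\<gamma> n\<close> times the mean squared displacement, up to summable errors; as the
  envelope is bounded, the products of \<open>\<gamma> n\<close> and these means are summable. By Markov's inequality and the bound on second
  moments, the steps taken where the displacement is at least \<open>\<epsilon>\<close> then have summable mean lengths.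
\<close>

theorem (in potential_field) projected_stochastic_ascent:
  fixes M :: "'w measure" and P G :: "nat \<Rightarrow> 'w \<Rightarrow> 'v" and \<gamma> :: "nat \<Rightarrow> real" and C :: real
  assumes M: "prob_space M"
    and G_meas [measurable]: "\<And>n. G n \<in> borel_measurable M"
    and P_meas [measurable]: "\<And>n. P n \<in> borel_measurable M"
    and P_in: "\<And>n \<omega>. \<omega> \<in> space M \<Longrightarrow> P n \<omega> \<in> S"
    and P_step: "\<And>n \<omega>. \<omega> \<in> space M \<Longrightarrow> P (Suc n) \<omega> = closest_point S (P n \<omega> + \<gamma> n *\<^sub>R G n \<omega>)"
    and \<gamma>: "\<And>n. 0 < \<gamma> n" "\<not> summable \<gamma>" "summable (\<lambda>n. (\<gamma> n)\<^sup>2)"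
    and C: "0 \<le> C"
    and moment: "\<And>n A. A \<in> sets borel \<Longrightarrow>
      (\<integral>\<^sup>+\<omega>. indicator A (P n \<omega>) * ennreal ((norm (G n \<omega>))\<^sup>2) \<partial>M) \<le> ennreal C * emeasure M {\<omega>\<in>space M. P n \<omega> \<in> A}"
    and mean: "\<And>n h k. h \<in> borel_measurable borel \<Longrightarrow> k \<in> borel_measurable borel \<Longrightarrow> bounded (h ` S) \<Longrightarrow>
      bounded (k ` S) \<Longrightarrow> (\<And>x. x \<in> S \<Longrightarrow> 0 \<le> k x \<and> k x \<le> h x \<bullet> u x) \<Longrightarrow>
      (\<integral>\<omega>. k (P n \<omega>) \<partial>M) \<le> (\<integral>\<omega>. h (P n \<omega>) \<bullet> G n \<omega> \<partial>M)"
  shows "AE \<omega> in M. (\<lambda>n. infdist (P n \<omega>) critical) \<longlonglongrightarrow> 0"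
proof -
  interpret prob_space M by (rule M)
  have disp_m [measurable]: "displacement \<in> borel_measurable borel"
    by (rule borel_measurable_continuous_onI[OF continuous_displacement])
  have env_m [measurable]: "envelope \<in> borel_measurable borel"
    by (rule borel_measurable_continuous_onI[OF continuous_envelope])
  have bnd_disp: "bounded (displacement ` S)"
    by (intro compact_imp_bounded compact_continuous_image continuous_on_subset[OF continuous_displacement] S) auto
  have bnd_disp2: "bounded ((\<lambda>x. (norm (displacement x))\<^sup>2) ` S)"
    by (intro compact_imp_bounded compact_continuous_image continuous_intros
        continuous_on_subset[OF continuous_displacement] S) auto
  have "bounded (envelope ` S)"
    by (intro compact_imp_bounded compact_continuous_image continuous_on_subset[OF continuous_envelope] S) auto
  then obtain B where B: "\<And>x. x \<in> S \<Longrightarrow> \<bar>envelope x\<bar> \<le> B" by (auto simp: bounded_iff)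
  obtain B1 where B1: "\<And>x. x \<in> S \<Longrightarrow> norm (displacement x) \<le> B1" using bnd_disp by (auto simp: bounded_iff)
  have secm: "(\<integral>\<^sup>+\<omega>. ennreal ((norm (G n \<omega>))\<^sup>2) \<partial>M) \<le> ennreal C" for n
    using moment[of UNIV n] by (simp add: emeasure_space_1)
  have intG2: "integrable M (\<lambda>\<omega>. (norm (G n \<omega>))\<^sup>2)" for n
    by (rule integrableI_nonneg) (use secm[of n] in \<open>auto intro: le_less_trans\<close>)
  have EG2: "(\<integral>\<omega>. (norm (G n \<omega>))\<^sup>2 \<partial>M) \<le> C" for n
  proof -
    have "ennreal (\<integral>\<omega>. (norm (G n \<omega>))\<^sup>2 \<partial>M) \<le> ennreal C"
      using secm[of n] nn_integral_eq_integral[OF intG2[of n]] by simp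
    then show ?thesis using C by simp
  qed
  have int_env: "integrable M (\<lambda>\<omega>. envelope (P n \<omega>))" for n
    by (rule integrable_const_bound[of _ B]) (use B P_in in auto)
  have int_disp: "integrable M (\<lambda>\<omega>. (norm (displacement (P n \<omega>)))\<^sup>2)" for n
    by (rule integrable_const_bound[of _ "B1\<^sup>2"]) (use B1 P_in in \<open>auto intro!: power_mono\<close>)
  have int_dG: "integrable M (\<lambda>\<omega>. displacement (P n \<omega>) \<bullet> G n \<omega>)" for n
  proof (rule Bochner_Integration.integrable_bound)
    show "integrable M (\<lambda>\<omega>. (norm (displacement (P n \<omega>)))\<^sup>2 + (norm (G n \<omega>))\<^sup>2)"
      using int_disp intG2 by simp
    show "AE \<omega> in M. norm (displacement (P n \<omega>) \<bullet> G n \<omega>)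
        \<le> norm ((norm (displacement (P n \<omega>)))\<^sup>2 + (norm (G n \<omega>))\<^sup>2)"
    proof (intro AE_I2)
      fix \<omega>
      have "\<bar>displacement (P n \<omega>) \<bullet> G n \<omega>\<bar> \<le> norm (displacement (P n \<omega>)) * norm (G n \<omega>)"
        by (rule Cauchy_Schwarz_ineq2)
      also have "\<dots> \<le> (norm (displacement (P n \<omega>)))\<^sup>2 + (norm (G n \<omega>))\<^sup>2"
        using sum_squares_bound[of "norm (displacement (P n \<omega>))" "norm (G n \<omega>)"]
          mult_nonneg_nonneg[OF norm_ge_zero norm_ge_zero, of "displacement (P n \<omega>)" "G n \<omega>"]
        by linarith
      finally show "norm (displacement (P n \<omega>) \<bullet> G n \<omega>) \<le> norm ((norm (displacement (P n \<omega>)))\<^sup>2 + (norm (G n \<omega>))\<^sup>2)"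
        by simp
    qed
  qed measurable
  define E D where "E n = (\<integral>\<omega>. envelope (P n \<omega>) \<partial>M)" and "D n = (\<integral>\<omega>. (norm (displacement (P n \<omega>)))\<^sup>2 \<partial>M)" for n
  have D0: "0 \<le> D n" for n by (simp add: D_def)
  have ED: "2 * (K + 1) * (\<gamma> n * D n) \<le> E (Suc n) - E n + (K + 1) * C * (\<gamma> n)\<^sup>2" for n
  proof -
    have "D n \<le> (\<integral>\<omega>. displacement (P n \<omega>) \<bullet> G n \<omega> \<partial>M)"
      unfolding D_def by (rule mean[OF disp_m _ bnd_disp bnd_disp2]) (use displacement_ascent in auto)
    then have "2 * (K + 1) * \<gamma> n * D n \<le> 2 * (K + 1) * \<gamma> n * (\<integral>\<omega>. displacement (P n \<omega>) \<bullet> G n \<omega> \<partial>M)"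
      using K \<gamma>(1)[of n] by (intro mult_left_mono) auto
    moreover have "(K + 1) * (\<gamma> n)\<^sup>2 * (\<integral>\<omega>. (norm (G n \<omega>))\<^sup>2 \<partial>M) \<le> (K + 1) * (\<gamma> n)\<^sup>2 * C"
      using K by (intro mult_left_mono EG2) auto
    moreover have "E n + 2 * (K + 1) * \<gamma> n * (\<integral>\<omega>. displacement (P n \<omega>) \<bullet> G n \<omega> \<partial>M)
        - (K + 1) * (\<gamma> n)\<^sup>2 * (\<integral>\<omega>. (norm (G n \<omega>))\<^sup>2 \<partial>M)
      = (\<integral>\<omega>. envelope (P n \<omega>) + 2 * (K + 1) * \<gamma> n * (displacement (P n \<omega>) \<bullet> G n \<omega>)
          - (K + 1) * (\<gamma> n)\<^sup>2 * (norm (G n \<omega>))\<^sup>2 \<partial>M)"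
      unfolding E_def using int_env[of n] int_dG[of n] intG2[of n] by simp
    moreover have "\<dots> \<le> E (Suc n)"
      unfolding E_def
    proof (rule integral_mono)
      fix \<omega> assume \<omega>: "\<omega> \<in> space M"
      show "envelope (P n \<omega>) + 2 * (K + 1) * \<gamma> n * (displacement (P n \<omega>) \<bullet> G n \<omega>)
          - (K + 1) * (\<gamma> n)\<^sup>2 * (norm (G n \<omega>))\<^sup>2 \<le> envelope (P (Suc n) \<omega>)"
        unfolding P_step[OF \<omega>] by (rule envelope_projected_step[OF P_in[OF \<omega>]])
    qed (use int_env int_dG intG2 in auto)
    ultimately show ?thesis by (simp add: algebra_simps)
  qed
  have sumD: "summable (\<lambda>n. \<gamma> n * D n)"
  proof (rule summableI_nonneg_bounded)
    show "0 \<le> \<gamma> n * D n" for n using \<gamma>(1)[of n] D0 by simp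
    fix N
    have "2 * (K + 1) * (\<Sum>n<N. \<gamma> n * D n) \<le> (\<Sum>n<N. E (Suc n) - E n + (K + 1) * C * (\<gamma> n)\<^sup>2)"
      unfolding sum_distrib_left by (intro sum_mono ED)
    also have "\<dots> = E N - E 0 + (K + 1) * C * (\<Sum>n<N. (\<gamma> n)\<^sup>2)"
      by (simp add: sum.distrib sum_distrib_left sum_lessThan_telescope)
    also have "\<dots> \<le> 2 * B + (K + 1) * C * (\<Sum>n. (\<gamma> n)\<^sup>2)"
    proof (intro add_mono mult_left_mono)
      have "\<bar>E n\<bar> \<le> B" for n
      proof -
        have "\<bar>E n\<bar> \<le> (\<integral>\<omega>. \<bar>envelope (P n \<omega>)\<bar> \<partial>M)" unfolding E_def by (rule integral_abs_bound)
        also have "\<dots> \<le> (\<integral>\<omega>. B \<partial>M)"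
          using int_env[of n] B P_in by (intro integral_mono) auto
        finally show ?thesis by (simp add: prob_space)
      qed
      from this[of N] this[of 0] show "E N - E 0 \<le> 2 * B" by linarith
      show "(\<Sum>n<N. (\<gamma> n)\<^sup>2) \<le> (\<Sum>n. (\<gamma> n)\<^sup>2)" by (rule sum_le_suminf[OF \<gamma>(3)]) auto
    qed (use K C in auto)
    finally show "(\<Sum>n<N. \<gamma> n * D n) \<le> (2 * B + (K + 1) * C * (\<Sum>n. (\<gamma> n)\<^sup>2)) / (2 * (K + 1))"
      using K by (simp add: pos_le_divide_eq mult.commute)
  qed
  \<comment> \<open>the term \<open>\<gamma> n\<close> will exclude that the displacement stays above \<open>\<epsilon>\<close>, the term \<open>\<gamma> n * norm (G n \<omega>)\<close>
    bounds the movement of the iterates while it is there\<close>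
  have far: "AE \<omega> in M. summable (\<lambda>n. if \<epsilon> \<le> norm (displacement (P n \<omega>)) then \<gamma> n + \<gamma> n * norm (G n \<omega>) else 0)"
    if \<epsilon>: "0 < \<epsilon>" for \<epsilon>
  proof (rule AE_summable_if_summable_integrals)
    let ?c = "\<lambda>n. (2 + C) / \<epsilon>\<^sup>2 * (\<gamma> n * D n)"
    show "summable ?c" by (rule summable_mult[OF sumD])
    show "0 \<le> ?c n" for n using C D0[of n] \<gamma>(1)[of n] by simp
    show "0 \<le> (if \<epsilon> \<le> norm (displacement (P n \<omega>)) then \<gamma> n + \<gamma> n * norm (G n \<omega>) else 0)" for n \<omega>
      using \<gamma>(1)[of n] by simp
    fix n
    let ?A = "{x. \<epsilon> \<le> norm (displacement x)}"
    have A[measurable]: "?A \<in> sets borel" by measurable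
    let ?pA = "emeasure M {\<omega>\<in>space M. P n \<omega> \<in> ?A}"
    have pA: "(\<integral>\<^sup>+\<omega>. indicator ?A (P n \<omega>) \<partial>M) = ?pA"
    proof -
      have "(\<integral>\<^sup>+\<omega>. indicator ?A (P n \<omega>) \<partial>M) = (\<integral>\<^sup>+\<omega>. indicator {\<omega>\<in>space M. P n \<omega> \<in> ?A} \<omega> \<partial>M)"
        by (intro nn_integral_cong) (auto simp: indicator_def)
      also have "\<dots> = ?pA" by (rule nn_integral_indicator) measurable
      finally show ?thesis .
    qed
    have "ennreal (\<epsilon>\<^sup>2) * ?pA = (\<integral>\<^sup>+\<omega>. ennreal (\<epsilon>\<^sup>2) * indicator ?A (P n \<omega>) \<partial>M)"
      by (subst nn_integral_cmult) (auto simp: pA)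
    also have "\<dots> \<le> (\<integral>\<^sup>+\<omega>. ennreal ((norm (displacement (P n \<omega>)))\<^sup>2) \<partial>M)"
      using \<epsilon> by (intro nn_integral_mono) (auto simp: indicator_def intro!: ennreal_leI power_mono)
    also have "\<dots> = ennreal (D n)"
      unfolding D_def by (rule nn_integral_eq_integral[OF int_disp]) auto
    finally have "ennreal (\<epsilon>\<^sup>2) * ?pA \<le> ennreal (D n)" .
    then have "ennreal (\<epsilon>\<^sup>2 * measure M {\<omega>\<in>space M. P n \<omega> \<in> ?A}) \<le> ennreal (D n)"
      using \<epsilon> by (simp add: emeasure_eq_measure ennreal_mult)
    then have markov: "measure M {\<omega>\<in>space M. P n \<omega> \<in> ?A} \<le> D n / \<epsilon>\<^sup>2"
      using \<epsilon> D0[of n] by (simp add: pos_le_divide_eq mult.commute)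
    have "(\<integral>\<^sup>+\<omega>. ennreal (if \<epsilon> \<le> norm (displacement (P n \<omega>)) then \<gamma> n + \<gamma> n * norm (G n \<omega>) else 0) \<partial>M)
        \<le> (\<integral>\<^sup>+\<omega>. ennreal (\<gamma> n) * (2 * indicator ?A (P n \<omega>) + indicator ?A (P n \<omega>) * ennreal ((norm (G n \<omega>))\<^sup>2)) \<partial>M)"
    proof (intro nn_integral_mono)
      fix \<omega>
      have "0 \<le> (norm (G n \<omega>) - 1)\<^sup>2" by simp
      then have "1 + norm (G n \<omega>) \<le> 2 + (norm (G n \<omega>))\<^sup>2"
        by (simp add: power2_diff) (smt (verit) norm_ge_zero zero_le_power2)
      then have "\<gamma> n * (1 + norm (G n \<omega>)) \<le> \<gamma> n * (2 + (norm (G n \<omega>))\<^sup>2)"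
        using \<gamma>(1)[of n] by (intro mult_left_mono) auto
      then have "ennreal (\<gamma> n + \<gamma> n * norm (G n \<omega>)) \<le> ennreal (\<gamma> n * (2 + (norm (G n \<omega>))\<^sup>2))"
        by (intro ennreal_leI) (simp add: distrib_left)
      also have "\<dots> = ennreal (\<gamma> n) * (2 + ennreal ((norm (G n \<omega>))\<^sup>2))"
        using \<gamma>(1)[of n] by (simp add: ennreal_mult)
      finally show "ennreal (if \<epsilon> \<le> norm (displacement (P n \<omega>)) then \<gamma> n + \<gamma> n * norm (G n \<omega>) else 0)
        \<le> ennreal (\<gamma> n) * (2 * indicator ?A (P n \<omega>) + indicator ?A (P n \<omega>) * ennreal ((norm (G n \<omega>))\<^sup>2))"
        by (simp add: indicator_def)
    qed
    also have "\<dots> = ennreal (\<gamma> n) * (2 * ?pA + (\<integral>\<^sup>+\<omega>. indicator ?A (P n \<omega>) * ennreal ((norm (G n \<omega>))\<^sup>2) \<partial>M))"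
      by (simp add: nn_integral_cmult nn_integral_add pA)
    also have "\<dots> \<le> ennreal (\<gamma> n) * (2 * ?pA + ennreal C * ?pA)"
      by (intro mult_left_mono add_left_mono moment A) auto
    also have "\<dots> = ennreal (\<gamma> n * ((2 + C) * measure M {\<omega>\<in>space M. P n \<omega> \<in> ?A}))"
      using C \<gamma>(1)[of n] by (simp add: emeasure_eq_measure ennreal_mult distrib_right)
    also have "\<dots> \<le> ennreal (?c n)"
    proof (rule ennreal_leI)
      have "\<gamma> n * ((2 + C) * measure M {\<omega>\<in>space M. P n \<omega> \<in> ?A}) \<le> \<gamma> n * ((2 + C) * (D n / \<epsilon>\<^sup>2))"
        using C \<gamma>(1)[of n] by (intro mult_left_mono markov) auto
      then show "\<gamma> n * ((2 + C) * measure M {\<omega>\<in>space M. P n \<omega> \<in> ?A}) \<le> ?c n" by (simp add: mult_ac)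
    qed
    finally show "(\<integral>\<^sup>+\<omega>. ennreal (if \<epsilon> \<le> norm (displacement (P n \<omega>)) then \<gamma> n + \<gamma> n * norm (G n \<omega>) else 0) \<partial>M)
        \<le> ennreal (?c n)" .
  qed measurable
  \<comment> \<open>countably many levels suffice for a common null set\<close>
  have "AE \<omega> in M. \<forall>j. summable (\<lambda>n. if inverse (real (Suc j)) \<le> norm (displacement (P n \<omega>))
      then \<gamma> n + \<gamma> n * norm (G n \<omega>) else 0)"
    by (subst AE_all_countable) (intro allI far, simp)
  moreover have "AE \<omega> in M. summable (\<lambda>n. (\<gamma> n)\<^sup>2 * (norm (G n \<omega>))\<^sup>2)"
  proof (rule AE_summable_if_summable_integrals[where c = "\<lambda>n. (\<gamma> n)\<^sup>2 * C"])
    show "summable (\<lambda>n. (\<gamma> n)\<^sup>2 * C)" by (rule summable_mult2[OF \<gamma>(3)])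
    fix n
    have "(\<integral>\<^sup>+\<omega>. ennreal ((\<gamma> n)\<^sup>2 * (norm (G n \<omega>))\<^sup>2) \<partial>M) = ennreal ((\<gamma> n)\<^sup>2) * (\<integral>\<^sup>+\<omega>. ennreal ((norm (G n \<omega>))\<^sup>2) \<partial>M)"
      by (simp add: ennreal_mult nn_integral_cmult)
    also have "\<dots> \<le> ennreal ((\<gamma> n)\<^sup>2) * ennreal C" by (intro mult_left_mono secm) auto
    finally show "(\<integral>\<^sup>+\<omega>. ennreal ((\<gamma> n)\<^sup>2 * (norm (G n \<omega>))\<^sup>2) \<partial>M) \<le> ennreal ((\<gamma> n)\<^sup>2 * C)"
      using C by (simp add: ennreal_mult)
  qed (use C in auto)
  ultimately show ?thesis
    using AE_space
  proof eventually_elim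
    case (elim \<omega>)
    define d s where "d n = norm (displacement (P n \<omega>))" and "s n = \<gamma> n * norm (G n \<omega>)" for n
    have "d \<longlonglongrightarrow> 0"
    proof (rule crossing_argument[where s = s and \<gamma> = \<gamma> and L = 3])
      show "0 \<le> d n" "0 \<le> s n" for n using \<gamma>(1)[of n] by (auto simp: d_def s_def)
      show "0 < \<gamma> n" for n by (rule \<gamma>(1))
      show "\<not> summable \<gamma>" by (rule \<gamma>(2))
      show "d (Suc n) \<le> d n + 3 * s n" for n
      proof -
        have "norm (P (Suc n) \<omega> - P n \<omega>) = dist (closest_point S (P n \<omega> + \<gamma> n *\<^sub>R G n \<omega>)) (closest_point S (P n \<omega>))"
          by (simp add: P_step[OF elim(3)] closest_point_self[OF P_in[OF elim(3)]] dist_norm)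
        also have "\<dots> \<le> dist (P n \<omega> + \<gamma> n *\<^sub>R G n \<omega>) (P n \<omega>)"
          by (rule closest_point_lipschitz[OF S(2) compact_imp_closed[OF S(1)] S(3)])
        also have "\<dots> = s n" using \<gamma>(1)[of n] by (simp add: dist_norm s_def)
        finally show ?thesis
          using displacement_lipschitz[of "P (Suc n) \<omega>" "P n \<omega>"] by (simp add: d_def)
      qed
      have "(\<lambda>n. (s n)\<^sup>2) \<longlonglongrightarrow> 0"
        using summable_LIMSEQ_zero[OF elim(2)] by (simp add: s_def power_mult_distrib)
      then have "(\<lambda>n. sqrt ((s n)\<^sup>2)) \<longlonglongrightarrow> sqrt 0" by (rule tendsto_real_sqrt)
      then show "s \<longlonglongrightarrow> 0" using \<open>\<And>n. 0 \<le> s n\<close> by simp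
      fix \<epsilon> :: real assume "0 < \<epsilon>"
      then obtain j where j: "inverse (real (Suc j)) < \<epsilon>" using reals_Archimedean by blast
      show "summable (\<lambda>n. if \<epsilon> \<le> d n then \<gamma> n + s n else 0)"
        by (rule summable_comparison_test'[OF elim(1)[rule_format, of j], of 0])
          (use j \<open>\<And>n. 0 \<le> s n\<close> \<gamma>(1) in \<open>auto simp: d_def s_def less_imp_le\<close>)
    qed simp
    then show ?case
      unfolding d_def by (rule infdist_critical_tendsto[OF P_in[OF elim(3)]])
  qed
qed

section \<open>Conditional expectations from conditional laws\<close>

text \<open>
  The real conditional expectation forgets infinite values; an indicator has none.
\<close>

lemma (in sigma_finite_subalgebra) nn_cond_exp_indicator_eq:
  assumes [measurable]: "A \<in> sets M"
    and ae: "AE \<omega> in M. real_cond_exp M F (indicator A) \<omega> = c \<omega>"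
  shows "AE \<omega> in M. nn_cond_exp M F (indicator A) \<omega> = ennreal (c \<omega>)"
proof -
  have one: "AE \<omega> in M. nn_cond_exp M F (\<lambda>_. 1) \<omega> = 1"
    by (rule nn_cond_exp_F_meas[of "\<lambda>_. 1", simplified, THEN AE_mp]) auto
  have "AE \<omega> in M. nn_cond_exp M F (indicator A) \<omega> \<le> nn_cond_exp M F (\<lambda>_. 1) \<omega>"
    by (rule nn_cond_exp_mono) (auto simp: indicator_def)
  moreover have "AE \<omega> in M. nn_cond_exp M F (\<lambda>_. 0) \<omega> = 0"
    by (rule nn_cond_exp_F_meas[of "\<lambda>_. 0", simplified, THEN AE_mp]) auto
  ultimately show ?thesis
    using ae one
  proof eventually_elim
    case (elim \<omega>)
    have "(\<lambda>\<omega>. ennreal (indicat_real A \<omega>)) = indicator A" "(\<lambda>\<omega>. ennreal (- indicat_real A \<omega>)) = (\<lambda>_. 0)"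
      by (auto simp: fun_eq_iff indicator_def ennreal_neg)
    then have "c \<omega> = enn2real (nn_cond_exp M F (indicator A) \<omega>)"
      using elim by (simp add: real_cond_exp_def)
    moreover have "nn_cond_exp M F (indicator A) \<omega> < \<infinity>"
      using elim by (auto intro: le_less_trans)
    ultimately show ?case by simp
  qed
qed

text \<open>
  By approximation with simple functions; only countably many exceptional null sets arise on the
  way.
\<close>

lemma (in sigma_finite_subalgebra) nn_cond_exp_conditional_law:
  fixes \<kappa> :: "'a \<Rightarrow> 'b measure" and X :: "'a \<Rightarrow> 'b"
  assumes X [measurable]: "X \<in> M \<rightarrow>\<^sub>M N" and \<kappa>: "\<And>\<omega>. \<omega> \<in> space M \<Longrightarrow> prob_space (\<kappa> \<omega>)"
    and sets: "\<And>\<omega>. \<omega> \<in> space M \<Longrightarrow> sets (\<kappa> \<omega>) = sets N"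
    and law: "\<And>B. B \<in> sets N \<Longrightarrow>
      AE \<omega> in M. real_cond_exp M F (\<lambda>\<omega>'. indicator B (X \<omega>')) \<omega> = measure (\<kappa> \<omega>) B"
    and \<phi>: "\<phi> \<in> borel_measurable N"
  shows "AE \<omega> in M. nn_cond_exp M F (\<lambda>\<omega>'. \<phi> (X \<omega>')) \<omega> = (\<integral>\<^sup>+x. \<phi> x \<partial>\<kappa> \<omega>)"
  using \<phi>
proof (induction \<phi>)
  case (cong f g)
  have [measurable]: "(\<lambda>\<omega>'. f (X \<omega>')) \<in> borel_measurable M" "(\<lambda>\<omega>'. g (X \<omega>')) \<in> borel_measurable M"
    using cong(1,2) by auto
  have "AE \<omega> in M. nn_cond_exp M F (\<lambda>\<omega>'. f (X \<omega>')) \<omega> = nn_cond_exp M F (\<lambda>\<omega>'. g (X \<omega>')) \<omega>"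
    by (rule nn_cond_exp_cong) (use cong(3) measurable_space[OF X] in auto)
  with cong(4) show ?case
    using AE_space
  proof eventually_elim
    case (elim \<omega>)
    have "(\<integral>\<^sup>+x. f x \<partial>\<kappa> \<omega>) = (\<integral>\<^sup>+x. g x \<partial>\<kappa> \<omega>)"
      using sets_eq_imp_space_eq[OF sets[OF elim(3)]] cong(3) by (intro nn_integral_cong) auto
    with elim show ?case by simp
  qed
next
  case (set A)
  then have [measurable]: "A \<in> sets N" .
  have eq: "(\<lambda>\<omega>'. indicator A (X \<omega>')) = (indicator (X -` A) :: 'a \<Rightarrow> real)"
    "(\<lambda>\<omega>'. indicator A (X \<omega>')) = (indicator (X -` A) :: 'a \<Rightarrow> ennreal)"
    by (auto simp: fun_eq_iff indicator_def)
  have [measurable]: "X -` A \<inter> space M \<in> sets M" by measurable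
  have "AE \<omega> in M. nn_cond_exp M F (indicator (X -` A \<inter> space M)) \<omega> = ennreal (measure (\<kappa> \<omega>) A)"
  proof (rule nn_cond_exp_indicator_eq)
    have "AE \<omega> in M. real_cond_exp M F (indicator (X -` A \<inter> space M)) \<omega> = real_cond_exp M F (\<lambda>\<omega>'. indicator A (X \<omega>')) \<omega>"
      by (rule real_cond_exp_cong) (auto simp: indicator_def)
    with law[OF set] show "AE \<omega> in M. real_cond_exp M F (indicator (X -` A \<inter> space M)) \<omega> = measure (\<kappa> \<omega>) A"
      by eventually_elim simp
  qed measurable
  moreover have "AE \<omega> in M. nn_cond_exp M F (indicator (X -` A \<inter> space M)) \<omega> = nn_cond_exp M F (\<lambda>\<omega>'. indicator A (X \<omega>')) \<omega>"
    by (rule nn_cond_exp_cong) (auto simp: indicator_def)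
  ultimately show ?case
    using AE_space
  proof eventually_elim
    case (elim \<omega>)
    interpret k: prob_space "\<kappa> \<omega>" by (rule \<kappa>[OF elim(3)])
    show ?case using elim set sets[OF elim(3)] by (simp add: k.emeasure_eq_measure)
  qed
next
  case (mult f c)
  have [measurable]: "(\<lambda>\<omega>'. f (X \<omega>')) \<in> borel_measurable M" using mult by auto
  have "AE \<omega> in M. c * nn_cond_exp M F (\<lambda>\<omega>'. f (X \<omega>')) \<omega> = nn_cond_exp M F (\<lambda>\<omega>'. c * f (X \<omega>')) \<omega>"
    by (rule nn_cond_exp_prod) auto
  with mult(4) show ?case
    using AE_space
  proof eventually_elim
    case (elim \<omega>)
    have "f \<in> borel_measurable (\<kappa> \<omega>)" using mult(2) sets[OF elim(3)] by (simp cong: measurable_cong_sets)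
    then have "(\<integral>\<^sup>+x. c * f x \<partial>\<kappa> \<omega>) = c * (\<integral>\<^sup>+x. f x \<partial>\<kappa> \<omega>)" by (rule nn_integral_cmult)
    with elim show ?case by simp
  qed
next
  case (add f g)
  have [measurable]: "(\<lambda>\<omega>'. f (X \<omega>')) \<in> borel_measurable M" "(\<lambda>\<omega>'. g (X \<omega>')) \<in> borel_measurable M"
    using add by auto
  have "AE \<omega> in M. nn_cond_exp M F (\<lambda>\<omega>'. g (X \<omega>')) \<omega> + nn_cond_exp M F (\<lambda>\<omega>'. f (X \<omega>')) \<omega>
      = nn_cond_exp M F (\<lambda>\<omega>'. g (X \<omega>') + f (X \<omega>')) \<omega>"
    by (rule nn_cond_exp_sum) auto
  with add.IH show ?case
    using AE_space
  proof eventually_elim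
    case (elim \<omega>)
    have "f \<in> borel_measurable (\<kappa> \<omega>)" "g \<in> borel_measurable (\<kappa> \<omega>)"
      using add sets[OF elim(4)] by (simp_all cong: measurable_cong_sets)
    then have "(\<integral>\<^sup>+x. g x + f x \<partial>\<kappa> \<omega>) = (\<integral>\<^sup>+x. g x \<partial>\<kappa> \<omega>) + (\<integral>\<^sup>+x. f x \<partial>\<kappa> \<omega>)"
      by (intro nn_integral_add)
    with elim show ?case by simp
  qed
next
  case (seq U)
  have [measurable]: "U i \<in> borel_measurable N" for i by (rule seq)
  have UX [measurable]: "(\<lambda>\<omega>'. U i (X \<omega>')) \<in> borel_measurable M" for i by measurable
  define \<psi> where "\<psi> i = nn_cond_exp M F (\<lambda>\<omega>'. U i (X \<omega>'))" for i
  have \<psi>M [measurable]: "\<psi> i \<in> borel_measurable M" and \<psi>F [measurable]: "\<psi> i \<in> borel_measurable F" for i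
    by (simp_all add: \<psi>_def)
  have AE_int: "AE \<omega> in M. \<forall>i. \<psi> i \<omega> = (\<integral>\<^sup>+x. U i x \<partial>\<kappa> \<omega>)"
    unfolding \<psi>_def AE_all_countable using seq by blast
  have inc: "AE \<omega> in M. \<psi> i \<omega> \<le> \<psi> (Suc i) \<omega>" for i
    using AE_int
  proof eventually_elim
    case (elim \<omega>)
    have "U i x \<le> U (Suc i) x" for x using incseq_SucD[OF \<open>incseq U\<close>] by (simp add: le_fun_def)
    then show ?case by (simp add: elim nn_integral_mono)
  qed
  have "AE \<omega> in M. (SUP i. \<psi> i \<omega>) = nn_cond_exp M F (\<lambda>\<omega>'. (SUP i. U i) (X \<omega>')) \<omega>"
  proof (rule nn_cond_exp_charact)
    fix A assume A[measurable]: "A \<in> sets F"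
    have [measurable]: "A \<in> sets M" using subalg A by (auto simp: subalgebra_def)
    have "(\<integral>\<^sup>+\<omega>\<in>A. (SUP i. U i) (X \<omega>) \<partial>M) = (\<integral>\<^sup>+\<omega>. (SUP i. U i (X \<omega>) * indicator A \<omega>) \<partial>M)"
      by (intro nn_integral_cong) (auto simp: SUP_mult_right_ennreal image_comp)
    also have "\<dots> = (SUP i. \<integral>\<^sup>+\<omega>. U i (X \<omega>) * indicator A \<omega> \<partial>M)"
      using \<open>incseq U\<close> by (intro nn_integral_monotone_convergence_SUP) (auto simp: incseq_def le_fun_def intro!: mult_right_mono)
    also have "\<dots> = (SUP i. \<integral>\<^sup>+\<omega>. \<psi> i \<omega> * indicator A \<omega> \<partial>M)"
    proof (intro SUP_cong refl)
      fix i
      have "(\<integral>\<^sup>+\<omega>. indicator A \<omega> * \<psi> i \<omega> \<partial>M) = (\<integral>\<^sup>+\<omega>. indicator A \<omega> * U i (X \<omega>) \<partial>M)"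
        unfolding \<psi>_def by (rule nn_cond_exp_intg) auto
      then show "(\<integral>\<^sup>+\<omega>. U i (X \<omega>) * indicator A \<omega> \<partial>M) = (\<integral>\<^sup>+\<omega>. \<psi> i \<omega> * indicator A \<omega> \<partial>M)"
        by (simp add: mult.commute)
    qed
    also have "\<dots> = (\<integral>\<^sup>+\<omega>. (SUP i. \<psi> i \<omega> * indicator A \<omega>) \<partial>M)"
    proof (intro nn_integral_monotone_convergence_SUP_AE[symmetric])
      show "AE \<omega> in M. \<psi> i \<omega> * indicator A \<omega> \<le> \<psi> (Suc i) \<omega> * indicator A \<omega>" for i
        using inc[of i] by eventually_elim (auto intro: mult_right_mono)
    qed measurable
    also have "\<dots> = (\<integral>\<^sup>+\<omega>\<in>A. (SUP i. \<psi> i \<omega>) \<partial>M)"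
      by (intro nn_integral_cong) (auto simp: SUP_mult_right_ennreal)
    finally show "(\<integral>\<^sup>+\<omega>\<in>A. (SUP i. U i) (X \<omega>) \<partial>M) = (\<integral>\<^sup>+\<omega>\<in>A. (SUP i. \<psi> i \<omega>) \<partial>M)" .
  next
    show "(\<lambda>\<omega>'. (SUP i. U i) (X \<omega>')) \<in> borel_measurable M"
      unfolding SUP_apply by measurable
  qed measurable
  with AE_int show ?case
    using AE_space
  proof eventually_elim
    case (elim \<omega>)
    have m: "U i \<in> borel_measurable (\<kappa> \<omega>)" for i
      using seq(1) sets[OF elim(3)] by (simp cong: measurable_cong_sets)
    have "(\<integral>\<^sup>+x. (SUP i. U i) x \<partial>\<kappa> \<omega>) = (SUP i. \<integral>\<^sup>+x. U i x \<partial>\<kappa> \<omega>)"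
      unfolding SUP_apply by (rule nn_integral_monotone_convergence_SUP[OF \<open>incseq U\<close> m])
    with elim show ?case by simp
  qed
qed

section \<open>Convergence to equilibria\<close>

lemma lipschitz_antiderivative:
  fixes w :: "real \<Rightarrow> real"
  assumes L: "0 \<le> L" and w: "\<And>s t. s \<in> {0..1} \<Longrightarrow> t \<in> {0..1} \<Longrightarrow> \<bar>w t - w s\<bar> \<le> L * \<bar>t - s\<bar>"
  shows "\<exists>W. \<forall>a\<in>{0..1}. \<forall>b\<in>{0..1}. \<bar>W b - W a - w a * (b - a)\<bar> \<le> L * (b - a)\<^sup>2"
proof -
  have "L-lipschitz_on {0..1} w"
    by (rule lipschitz_onI) (use w L in \<open>auto simp: dist_real_def\<close>)
  then have cont: "continuous_on {0..1} w" by (rule lipschitz_on_continuous_on)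
  define W where "W x = integral {0..x} w" for x
  have der: "(W has_real_derivative w x) (at x within {0..1})" if "x \<in> {0..1}" for x
    unfolding W_def[abs_def] by (rule integral_has_real_derivative[OF cont that])
  have mvt: "\<exists>z\<in>{a<..<b}. W b - W a = w z * (b - a)" if "0 \<le> a" "a < b" "b \<le> 1" for a b
  proof (rule mvt_simple[OF that(2)])
    fix x assume "a \<le> x" "x \<le> b"
    then have "(W has_derivative (*) (w x)) (at x within {0..1})"
      using der[of x] that by (auto dest: has_field_derivative_imp_has_derivative)
    then show "(W has_derivative (*) (w x)) (at x within {a..b})"
      by (rule has_derivative_subset) (use that in auto)
  qed
  have "\<bar>W b - W a - w a * (b - a)\<bar> \<le> L * (b - a)\<^sup>2" if a: "a \<in> {0..1}" and b: "b \<in> {0..1}" for a b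
  proof -
    have "\<exists>z. z \<in> {0..1} \<and> \<bar>z - a\<bar> \<le> \<bar>b - a\<bar> \<and> W b - W a = w z * (b - a)"
    proof (cases a b rule: linorder_cases)
      case less
      then obtain z where "z \<in> {a<..<b}" "W b - W a = w z * (b - a)" using mvt[of a b] a b by auto
      then show ?thesis using a b by (intro exI[of _ z]) auto
    next
      case equal
      then show ?thesis using a by auto
    next
      case greater
      then obtain z where "z \<in> {b<..<a}" "W a - W b = w z * (a - b)" using mvt[of b a] a b by auto
      then show ?thesis using a b by (intro exI[of _ z]) (auto simp: algebra_simps)
    qed
    then obtain z where z: "z \<in> {0..1}" "\<bar>z - a\<bar> \<le> \<bar>b - a\<bar>" "W b - W a = w z * (b - a)" by blast
    have "\<bar>W b - W a - w a * (b - a)\<bar> = \<bar>w z - w a\<bar> * \<bar>b - a\<bar>"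
      unfolding z(3) by (simp add: abs_mult[symmetric] algebra_simps)
    also have "\<dots> \<le> (L * \<bar>b - a\<bar>) * \<bar>b - a\<bar>"
      using w[OF a z(1)] mult_left_mono[OF z(2) L] by (intro mult_right_mono) auto
    also have "\<dots> = L * (b - a)\<^sup>2" by (simp add: power2_eq_square)
    finally show ?thesis .
  qed
  then show ?thesis by blast
qed

lemma compact_strategies: "compact (strategies :: (real ^ ('m::finite option)) set)"
proof -
  have "strategies = (\<Inter>a. {p. 0 \<le> p $ a}) \<inter> {p::real ^ ('m option). (\<Sum>a\<in>UNIV. p $ a) = 1}"
    by (auto simp: strategies_def)
  moreover have "closed \<dots>"
    by (intro closed_Int closed_INT ballI closed_Collect_le closed_Collect_eq continuous_intros)
  ultimately have "closed (strategies :: (real ^ ('m option)) set)" by simp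
  moreover have "bounded (strategies :: (real ^ ('m option)) set)"
  proof (rule boundedI)
    fix p :: "real ^ ('m option)" assume "p \<in> strategies"
    then have "(\<Sum>a\<in>UNIV. \<bar>p $ a\<bar>) = 1" by (simp add: strategies_def)
    then show "norm p \<le> 1" using norm_le_l1_cart[of p] by simp
  qed
  ultimately show ?thesis by (simp add: compact_eq_bounded_closed)
qed

lemma convex_strategies: "convex strategies"
  by (rule convexI) (auto simp: strategies_def sum.distrib sum_distrib_left[symmetric])

lemma strategies_nonempty: "(strategies :: (real ^ ('m::finite option)) set) \<noteq> {}"
proof -
  have "(axis None 1 :: real ^ ('m option)) \<in> strategies"
    by (auto simp: strategies_def axis_def)
  then show ?thesis by blast
qed

context unobservable_queues
begin

text \<open>
  Each component of \<open>u\<close> is a Lipschitz function of the same component of the strategy alone, hence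
  integrates to a function of that component; the potential is the sum of these.
\<close>

lemma utility_has_potential:
  "\<exists>\<Phi> K. potential_field strategies \<Phi> u K"
proof -
  obtain K where K: "0 \<le> K" "\<And>p q. p \<in> strategies \<Longrightarrow> q \<in> strategies \<Longrightarrow> norm (u q - u p) \<le> K * norm (q - p)"
    using utility_lipschitz by blast
  define w where "w m s = u (isolated m s) $ Some m" for m s
  have "\<exists>W. \<forall>a\<in>{0..1}. \<forall>b\<in>{0..1}. \<bar>W b - W a - w m a * (b - a)\<bar> \<le> (2 * K) * (b - a)\<^sup>2" for m
  proof (rule lipschitz_antiderivative)
    fix s t :: real assume st: "s \<in> {0..1}" "t \<in> {0..1}"
    have "\<bar>w m t - w m s\<bar> = \<bar>(u (isolated m t) - u (isolated m s)) $ Some m\<bar>" by (simp add: w_def)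
    also have "\<dots> \<le> norm (u (isolated m t) - u (isolated m s))" by (rule component_le_norm_cart)
    also have "\<dots> \<le> K * norm (isolated m t - isolated m s)"
      using st by (intro K(2) isolated_strategy) auto
    also have "\<dots> \<le> K * (2 * \<bar>t - s\<bar>)"
    proof (intro mult_left_mono K(1))
      have "norm (isolated m t - isolated m s) \<le> (\<Sum>a\<in>UNIV. \<bar>(isolated m t - isolated m s) $ a\<bar>)"
        by (rule norm_le_l1_cart)
      also have "\<dots> = (\<Sum>a\<in>{Some m, None}. \<bar>(isolated m t - isolated m s) $ a\<bar>)"
        by (intro sum.mono_neutral_right) (auto simp: isolated_def)
      also have "\<dots> = 2 * \<bar>t - s\<bar>" by (simp add: isolated_def)
      finally show "norm (isolated m t - isolated m s) \<le> 2 * \<bar>t - s\<bar>" .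
    qed
    finally show "\<bar>w m t - w m s\<bar> \<le> 2 * K * \<bar>t - s\<bar>" by (simp add: mult_ac)
  qed (use K in auto)
  then obtain W where W: "\<And>m a b. a \<in> {0..1} \<Longrightarrow> b \<in> {0..1} \<Longrightarrow> \<bar>W m b - W m a - w m a * (b - a)\<bar> \<le> (2 * K) * (b - a)\<^sup>2"
    by metis
  define \<Phi> where "\<Phi> p = (\<Sum>m\<in>UNIV. W m (p $ Some m))" for p :: "real ^ ('m option)"
  have "potential_field strategies \<Phi> u (2 * K)"
  proof
    fix p q :: "real ^ ('m option)" assume p: "p \<in> strategies" and q: "q \<in> strategies"
    have unit: "p $ a \<in> {0..1}" "q $ a \<in> {0..1}" for a
      using p q strategy_component_le_1[OF p, of a] strategy_component_le_1[OF q, of a] by (auto simp: strategies_def)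
    have "u p \<bullet> (q - p) = (\<Sum>a\<in>UNIV. u p $ a * (q $ a - p $ a))" by (simp add: inner_vec_def)
    also have "\<dots> = (\<Sum>m\<in>UNIV. u p $ Some m * (q $ Some m - p $ Some m))"
      by (simp add: UNIV_option_conv sum.reindex utility_None[OF p])
    also have "\<dots> = (\<Sum>m\<in>UNIV. w m (p $ Some m) * (q $ Some m - p $ Some m))"
      by (simp add: w_def utility_isolated[OF p, symmetric])
    finally have "\<bar>\<Phi> q - \<Phi> p - u p \<bullet> (q - p)\<bar>
        = \<bar>\<Sum>m\<in>UNIV. W m (q $ Some m) - W m (p $ Some m) - w m (p $ Some m) * (q $ Some m - p $ Some m)\<bar>"
      by (simp add: \<Phi>_def sum_subtractf)
    also have "\<dots> \<le> (\<Sum>m\<in>UNIV. \<bar>W m (q $ Some m) - W m (p $ Some m) - w m (p $ Some m) * (q $ Some m - p $ Some m)\<bar>)"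
      by (rule sum_abs)
    also have "\<dots> \<le> (\<Sum>m\<in>UNIV. (2 * K) * (q $ Some m - p $ Some m)\<^sup>2)"
      by (intro sum_mono W unit)
    also have "\<dots> = (2 * K) * (\<Sum>m\<in>UNIV. (q $ Some m - p $ Some m)\<^sup>2)" by (simp add: sum_distrib_left)
    also have "\<dots> \<le> (2 * K) * (norm (q - p))\<^sup>2"
    proof (intro mult_left_mono)
      have "(\<Sum>m\<in>UNIV. (q $ Some m - p $ Some m)\<^sup>2) \<le> (\<Sum>a\<in>UNIV. (q $ a - p $ a)\<^sup>2)"
        by (simp add: UNIV_option_conv sum.reindex)
      also have "\<dots> = (norm (q - p))\<^sup>2"
        unfolding power2_norm_eq_inner by (simp add: inner_vec_def power2_eq_square)
      finally show "(\<Sum>m\<in>UNIV. (q $ Some m - p $ Some m)\<^sup>2) \<le> (norm (q - p))\<^sup>2" .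
    qed (use K in auto)
    finally show "\<bar>\<Phi> q - \<Phi> p - u p \<bullet> (q - p)\<bar> \<le> 2 * K * (norm (q - p))\<^sup>2" .
    have "K * norm (q - p) \<le> 2 * K * norm (q - p)" using K(1) by (intro mult_right_mono) auto
    with K(2)[OF p q] show "norm (u q - u p) \<le> 2 * K * norm (q - p)" by linarith
  qed (use K(1) compact_strategies convex_strategies strategies_nonempty in auto)
  then show ?thesis by blast
qed

lemma equilibrium_iff_critical:
  assumes "potential_field strategies \<Phi> u K"
  shows "potential_field.critical strategies u = {p \<in> strategies. is_equilibrium H F \<nu> p}"
  unfolding potential_field.critical_def[OF assms]
  by (auto simp: is_equilibrium_def is_arg_max_def inner_diff_right not_less)

text \<open>
  Given the past, the cycle sum has mean \<open>mean_length p *\<^sub>R u p\<close>, where \<open>p\<close> is the current strategy. As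
  cycles have length at least \<open>1\<close>, this mean is at least as large along any uphill field as \<open>u p\<close> is,
  and the result on projected ascent applies.
\<close>

theorem cycle_algorithm_converges:
  fixes M :: "'w measure" and P G :: "nat \<Rightarrow> 'w \<Rightarrow> real ^ ('m option)" and \<gamma> :: "nat \<Rightarrow> real"
  assumes M: "prob_space M"
    and p1: "p1 \<in> strategies"
    and gamma_pos: "\<And>n. 1 \<le> n \<Longrightarrow> 0 < \<gamma> n"
    and gamma_sum: "filterlim (\<lambda>N. \<Sum>n=1..N. \<gamma> n) at_top sequentially"
    and gamma_sq: "summable (\<lambda>n. (\<gamma> n)\<^sup>2)"
    and G_meas: "\<And>n. 1 \<le> n \<Longrightarrow> G n \<in> borel_measurable M"
    and P_init: "\<And>\<omega>. \<omega> \<in> space M \<Longrightarrow> P 1 \<omega> = p1"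
    and P_step: "\<And>n \<omega>. 1 \<le> n \<Longrightarrow> \<omega> \<in> space M \<Longrightarrow>
           P (Suc n) \<omega> = closest_point strategies (P n \<omega> + \<gamma> n *\<^sub>R G n \<omega>)"
    and G_law: "\<And>n B. 1 \<le> n \<Longrightarrow> B \<in> sets borel \<Longrightarrow>
           AE \<omega> in M. real_cond_exp M (past M P G n) (\<lambda>\<omega>'. indicat_real B (G n \<omega>')) \<omega>
             = measure (cycle_law H F \<nu> (P n \<omega>)) B"
  shows "{p \<in> strategies. is_equilibrium H F \<nu> p} \<noteq> {}"
    and "AE \<omega> in M. (\<lambda>n. infdist (P n \<omega>) {p \<in> strategies. is_equilibrium H F \<nu> p}) \<longlonglongrightarrow> 0"
proof -
  interpret prob_space M by (rule M)
  obtain \<Phi> K where pot: "potential_field strategies \<Phi> u K" using utility_has_potential by blast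
  interpret potential_field strategies \<Phi> u K by (rule pot)
  note crit = equilibrium_iff_critical[OF pot]
  show "{p \<in> strategies. is_equilibrium H F \<nu> p} \<noteq> {}"
    using critical_nonempty by (simp add: crit)
  have closed: "closed (strategies :: (real ^ 'm option) set)" by (rule compact_imp_closed[OF compact_strategies])
  have P_in: "P n \<omega> \<in> strategies" if "1 \<le> n" "\<omega> \<in> space M" for n \<omega>
    using that(1)
  proof (induction n rule: dec_induct)
    case base
    then show ?case using P_init that(2) p1 by simp
  next
    case (step n)
    then show ?case using P_step that(2) closest_point_in_set[OF closed strategies_nonempty] by simp
  qed
  have cp_meas: "closest_point strategies \<in> borel_measurable (borel :: (real ^ 'm option) measure)"
    by (rule borel_measurable_continuous_onI[OF continuous_on_closest_point[OF convex_strategies closed strategies_nonempty]])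
  have P_meas: "P n \<in> borel_measurable M" if "1 \<le> n" for n
    using that
  proof (induction n rule: dec_induct)
    case base
    have "(\<lambda>_. p1) \<in> borel_measurable M" by simp
    then show ?case using P_init by (simp cong: measurable_cong)
  next
    case (step n)
    note [measurable] = step.IH G_meas[OF step(1)] cp_meas
    have "(\<lambda>\<omega>. closest_point strategies (P n \<omega> + \<gamma> n *\<^sub>R G n \<omega>)) \<in> borel_measurable M" by measurable
    then show ?case using P_step[OF step(1)] by (simp cong: measurable_cong)
  qed
  have space_past: "space (past M P G n) = space M" for n
    by (auto simp: past_def intro!: space_measure_of)
  have past_sets: "sets (past M P G n) = sigma_sets (space M)
    ({P i -` A \<inter> space M | i A. 1 \<le> i \<and> i \<le> n \<and> A \<in> sets borel} \<union>
     {G i -` A \<inter> space M | i A. 1 \<le> i \<and> i < n \<and> A \<in> sets borel})" for n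
    unfolding past_def by (rule sets_measure_of) auto
  have sub: "subalgebra M (past M P G n)" for n
    unfolding subalgebra_def past_sets space_past
    by (intro conjI refl sets.sigma_sets_subset) (auto intro: measurable_sets[OF P_meas] measurable_sets[OF G_meas])
  have sfs: "sigma_finite_subalgebra M (past M P G n)" for n
    by (intro finite_measure_subalgebra_is_sigma_finite finite_measure_subalgebra.intro
        finite_measure_subalgebra_axioms.intro sub) unfold_locales
  have P_past: "P n \<in> borel_measurable (past M P G n)" if "1 \<le> n" for n
  proof (rule measurableI)
    fix A :: "(real ^ 'm option) set" assume "A \<in> sets borel"
    then show "P n -` A \<inter> space (past M P G n) \<in> sets (past M P G n)"
      unfolding past_sets space_past using that by (intro sigma_sets.Basic) auto
  qed simp
  have law: "AE \<omega> in M. nn_cond_exp M (past M P G n) (\<lambda>\<omega>'. \<phi> (G n \<omega>')) \<omega> = (\<integral>\<^sup>+g. \<phi> g \<partial>cycle_law H F \<nu> (P n \<omega>))"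
    if n: "1 \<le> n" and "\<phi> \<in> borel_measurable borel" for n \<phi>
    by (rule sigma_finite_subalgebra.nn_cond_exp_conditional_law[OF sfs G_meas[OF n] prob_space_cycle_law
          sets_cycle_law G_law[OF n] that(2)])
  obtain C where C: "0 \<le> C" "\<And>p. p \<in> strategies \<Longrightarrow> (\<integral>\<^sup>+g. ennreal ((norm g)\<^sup>2) \<partial>cycle_law H F \<nu> p) \<le> ennreal C"
    using cycle_law_second_moment by blast
  have moment: "(\<integral>\<^sup>+\<omega>. indicator A (P n \<omega>) * ennreal ((norm (G n \<omega>))\<^sup>2) \<partial>M)
      \<le> ennreal C * emeasure M {\<omega>\<in>space M. P n \<omega> \<in> A}" if n: "1 \<le> n" and A: "A \<in> sets borel" for n A
  proof -
    interpret sigma_finite_subalgebra M "past M P G n" by (rule sfs)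
    note [measurable] = G_meas[OF n] P_past[OF n] P_meas[OF n] A
    have "(\<integral>\<^sup>+\<omega>. indicator A (P n \<omega>) * ennreal ((norm (G n \<omega>))\<^sup>2) \<partial>M)
        = (\<integral>\<^sup>+\<omega>. indicator A (P n \<omega>) * nn_cond_exp M (past M P G n) (\<lambda>\<omega>. ennreal ((norm (G n \<omega>))\<^sup>2)) \<omega> \<partial>M)"
      by (rule nn_cond_exp_intg[symmetric]) measurable
    also have "\<dots> \<le> (\<integral>\<^sup>+\<omega>. ennreal C * indicator {\<omega>\<in>space M. P n \<omega> \<in> A} \<omega> \<partial>M)"
    proof (rule nn_integral_mono_AE)
      have "(\<lambda>g::real ^ 'm option. ennreal ((norm g)\<^sup>2)) \<in> borel_measurable borel" by measurable
      from law[OF n this] AE_space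
      show "AE \<omega> in M. indicator A (P n \<omega>) * nn_cond_exp M (past M P G n) (\<lambda>\<omega>. ennreal ((norm (G n \<omega>))\<^sup>2)) \<omega>
          \<le> ennreal C * indicator {\<omega>\<in>space M. P n \<omega> \<in> A} \<omega>"
      proof eventually_elim
        case (elim \<omega>)
        then show ?case using C(2)[OF P_in[OF n elim(2)]] by (simp add: indicator_def)
      qed
    qed
    also have "\<dots> = ennreal C * emeasure M {\<omega>\<in>space M. P n \<omega> \<in> A}"
      by (rule nn_integral_cmult_indicator) measurable
    finally show ?thesis .
  qed
  have mean: "(\<integral>\<omega>. k (P n \<omega>) \<partial>M) \<le> (\<integral>\<omega>. h (P n \<omega>) \<bullet> G n \<omega> \<partial>M)"
    if n: "1 \<le> n" and [measurable]: "h \<in> borel_measurable borel" "k \<in> borel_measurable borel"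
      and bh: "bounded (h ` strategies)" and bk: "bounded (k ` strategies)"
      and hk: "\<And>x. x \<in> strategies \<Longrightarrow> 0 \<le> k x \<and> k x \<le> h x \<bullet> u x" for n h k
  proof -
    interpret sigma_finite_subalgebra M "past M P G n" by (rule sfs)
    note [measurable] = G_meas[OF n] P_past[OF n] P_meas[OF n]
    obtain B where B: "\<And>x. x \<in> strategies \<Longrightarrow> norm (h x) \<le> B" using bh by (auto simp: bounded_iff)
    obtain B' where B': "\<And>x. x \<in> strategies \<Longrightarrow> norm (k x) \<le> B'" using bk by (auto simp: bounded_iff)
    have B0: "0 \<le> B" using B[OF p1] norm_ge_zero[of "h p1"] by linarith
    have intG2: "integrable M (\<lambda>\<omega>. (norm (G n \<omega>))\<^sup>2)"
    proof (rule integrableI_nonneg)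
      have "(\<integral>\<^sup>+\<omega>. ennreal ((norm (G n \<omega>))\<^sup>2) \<partial>M) \<le> ennreal C"
        using moment[OF n, of UNIV] by (simp add: emeasure_space_1)
      then show "(\<integral>\<^sup>+\<omega>. ennreal ((norm (G n \<omega>))\<^sup>2) \<partial>M) < \<infinity>" by (rule le_less_trans) simp
    qed auto
    define R where "R a = real_cond_exp M (past M P G n) (\<lambda>\<omega>. G n \<omega> $ a)" for a
    have R: "AE \<omega> in M. \<forall>a. R a \<omega> = mean_length (P n \<omega>) * u (P n \<omega>) $ a"
    proof (subst AE_all_countable, intro allI)
      fix a
      have "(\<lambda>g::real ^ 'm option. ennreal (g $ a)) \<in> borel_measurable borel"
        "(\<lambda>g::real ^ 'm option. ennreal (- (g $ a))) \<in> borel_measurable borel" by measurable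
      from law[OF n this(1)] law[OF n this(2)] AE_space
      show "AE \<omega> in M. R a \<omega> = mean_length (P n \<omega>) * u (P n \<omega>) $ a"
      proof eventually_elim
        case (elim \<omega>)
        note p = P_in[OF n elim(3)]
        show ?case
          unfolding R_def real_cond_exp_def elim integral_cycle_law(2)[OF p, of a, symmetric]
          by (rule real_lebesgue_integral_def[OF integral_cycle_law(1)[OF p], symmetric])
      qed
    qed
    have int: "integrable M (\<lambda>\<omega>. h (P n \<omega>) $ a * G n \<omega> $ a)" for a
    proof (rule Bochner_Integration.integrable_bound)
      show "integrable M (\<lambda>\<omega>. B * (1 + (norm (G n \<omega>))\<^sup>2))" using intG2 by simp
      show "AE \<omega> in M. norm (h (P n \<omega>) $ a * G n \<omega> $ a) \<le> norm (B * (1 + (norm (G n \<omega>))\<^sup>2))"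
      proof (intro AE_I2)
        fix \<omega> assume \<omega>: "\<omega> \<in> space M"
        have "\<bar>G n \<omega> $ a\<bar> \<le> norm (G n \<omega>)" by (rule component_le_norm_cart)
        also have "\<dots> \<le> 1 + (norm (G n \<omega>))\<^sup>2"
          using sum_squares_bound[of "norm (G n \<omega>)" 1] norm_ge_zero[of "G n \<omega>"]
          by (simp del: norm_ge_zero)
        finally have "\<bar>G n \<omega> $ a\<bar> \<le> 1 + (norm (G n \<omega>))\<^sup>2" .
        then have "\<bar>h (P n \<omega>) $ a\<bar> * \<bar>G n \<omega> $ a\<bar> \<le> B * (1 + (norm (G n \<omega>))\<^sup>2)"
          using order_trans[OF component_le_norm_cart B[OF P_in[OF n \<omega>]]] B0 by (intro mult_mono) auto
        then show "norm (h (P n \<omega>) $ a * G n \<omega> $ a) \<le> norm (B * (1 + (norm (G n \<omega>))\<^sup>2))"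
          using B0 by (simp add: abs_mult)
      qed
    qed measurable
    have intR: "integrable M (\<lambda>\<omega>. h (P n \<omega>) $ a * R a \<omega>)"
      and eqR: "(\<integral>\<omega>. h (P n \<omega>) $ a * R a \<omega> \<partial>M) = (\<integral>\<omega>. h (P n \<omega>) $ a * G n \<omega> $ a \<partial>M)" for a
      unfolding R_def by (rule real_cond_exp_intg[OF int]; measurable)+
    have "(\<integral>\<omega>. k (P n \<omega>) \<partial>M) \<le> (\<integral>\<omega>. (\<Sum>a\<in>UNIV. h (P n \<omega>) $ a * R a \<omega>) \<partial>M)"
    proof (rule integral_mono_AE)
      show "integrable M (\<lambda>\<omega>. k (P n \<omega>))"
        by (rule integrable_const_bound[of _ B']) (use B' P_in[OF n] in auto)
      show "integrable M (\<lambda>\<omega>. \<Sum>a\<in>UNIV. h (P n \<omega>) $ a * R a \<omega>)" using intR by simp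
      show "AE \<omega> in M. k (P n \<omega>) \<le> (\<Sum>a\<in>UNIV. h (P n \<omega>) $ a * R a \<omega>)"
        using R AE_space
      proof eventually_elim
        case (elim \<omega>)
        note p = P_in[OF n elim(2)]
        have "(\<Sum>a\<in>UNIV. h (P n \<omega>) $ a * R a \<omega>) = mean_length (P n \<omega>) * (h (P n \<omega>) \<bullet> u (P n \<omega>))"
          using elim(1) by (simp add: inner_vec_def sum_distrib_left mult_ac)
        moreover have "1 * (h (P n \<omega>) \<bullet> u (P n \<omega>)) \<le> mean_length (P n \<omega>) * (h (P n \<omega>) \<bullet> u (P n \<omega>))"
          using hk[OF p] mean_length_ge_1[OF p] by (intro mult_right_mono) auto
        ultimately show ?case using hk[OF p] by linarith
      qed
    qed
    also have "\<dots> = (\<Sum>a\<in>UNIV. \<integral>\<omega>. h (P n \<omega>) $ a * R a \<omega> \<partial>M)"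
      by (rule Bochner_Integration.integral_sum) (rule intR)
    also have "\<dots> = (\<integral>\<omega>. (\<Sum>a\<in>UNIV. h (P n \<omega>) $ a * G n \<omega> $ a) \<partial>M)"
      unfolding eqR by (rule Bochner_Integration.integral_sum[symmetric]) (rule int)
    finally show ?thesis by (simp add: inner_vec_def)
  qed
  have "AE \<omega> in M. (\<lambda>n. infdist (P (Suc n) \<omega>) critical) \<longlonglongrightarrow> 0"
  proof (rule projected_stochastic_ascent[where G = "\<lambda>n. G (Suc n)" and \<gamma> = "\<lambda>n. \<gamma> (Suc n)" and C = C])
    show "\<not> summable (\<lambda>n. \<gamma> (Suc n))"
    proof
      assume s: "summable (\<lambda>n. \<gamma> (Suc n))"
      have "(\<Sum>n=1..N. \<gamma> n) \<le> (\<Sum>n. \<gamma> (Suc n))" for N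
      proof -
        have "(\<Sum>n=1..N. \<gamma> n) = (\<Sum>n<N. \<gamma> (Suc n))"
          by (induction N) auto
        also have "\<dots> \<le> (\<Sum>n. \<gamma> (Suc n))"
          by (rule sum_le_suminf[OF s]) (auto intro!: less_imp_le[OF gamma_pos])
        finally show ?thesis .
      qed
      moreover have "\<exists>N. (\<Sum>n. \<gamma> (Suc n)) < (\<Sum>n=1..N. \<gamma> n)"
        using gamma_sum unfolding filterlim_at_top_dense by (auto simp: eventually_sequentially)
      ultimately show False by (meson not_less)
    qed
    show "summable (\<lambda>n. (\<gamma> (Suc n))\<^sup>2)" using gamma_sq by (subst summable_Suc_iff)
  qed (use M G_meas P_meas P_in P_step gamma_pos C(1) moment mean in auto)
  then have "AE \<omega> in M. (\<lambda>n. infdist (P n \<omega>) critical) \<longlonglongrightarrow> 0"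
    by eventually_elim (rule LIMSEQ_imp_Suc)
  then show "AE \<omega> in M. (\<lambda>n. infdist (P n \<omega>) {p \<in> strategies. is_equilibrium H F \<nu> p}) \<longlonglongrightarrow> 0"
    by (simp add: crit)
qed

end

theorem proposition8:
  fixes lam :: real and \<mu> :: "'m::finite \<Rightarrow> real"
    and H :: "real measure" and F :: "'m \<Rightarrow> real measure" and \<nu> :: "'m \<Rightarrow> real \<Rightarrow> real"
    and M :: "'w measure" and P G :: "nat \<Rightarrow> 'w \<Rightarrow> real ^ ('m option)"
    and p1 :: "real ^ ('m option)" and \<gamma> :: "nat \<Rightarrow> real"
  assumes lam: "0 < lam"
    and H_prob: "prob_space H" and H_sets: "sets H = sets borel" and H_nonneg: "AE t in H. 0 \<le> t"
    and H_cont: "continuous_on UNIV (cdf H)" and H_mean: "has_bochner_integral H (\<lambda>t. t) (1 / lam)"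
    and F_prob: "\<And>m. prob_space (F m)" and F_sets: "\<And>m. sets (F m) = sets borel" and F_nonneg: "\<And>m. AE y in F m. 0 \<le> y"
    and F_mean: "\<And>m. has_bochner_integral (F m) (\<lambda>y. y) (1 / \<mu> m)"
    and stable: "\<And>m. lam < \<mu> m"
    and moment4: "\<And>m. integrable (F m) (\<lambda>y. y ^ 4)"
    and lipschitz: "\<And>m. \<exists>C. C-lipschitz_on {0..} (\<nu> m)"
    and p1: "p1 \<in> strategies"
    and gamma_pos: "\<And>n. 1 \<le> n \<Longrightarrow> 0 < \<gamma> n"
    and gamma_sum: "filterlim (\<lambda>N. \<Sum>n=1..N. \<gamma> n) at_top sequentially"
    and gamma_sq: "summable (\<lambda>n. (\<gamma> n)\<^sup>2)"
    and M_prob: "prob_space M"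
    and G_meas: "\<And>n. 1 \<le> n \<Longrightarrow> G n \<in> borel_measurable M"
    and P_init: "\<And>\<omega>. \<omega> \<in> space M \<Longrightarrow> P 1 \<omega> = p1"
    and P_step: "\<And>n \<omega>. 1 \<le> n \<Longrightarrow> \<omega> \<in> space M \<Longrightarrow>
           P (Suc n) \<omega> = closest_point strategies (P n \<omega> + \<gamma> n *\<^sub>R G n \<omega>)"
    and G_law: "\<And>n B. 1 \<le> n \<Longrightarrow> B \<in> sets borel \<Longrightarrow>
           AE \<omega> in M. real_cond_exp M (past M P G n) (\<lambda>\<omega>'. indicat_real B (G n \<omega>')) \<omega>
             = measure (cycle_law H F \<nu> (P n \<omega>)) B"
  shows "\<exists>S. S \<noteq> {} \<and> S \<subseteq> {p \<in> strategies. is_equilibrium H F \<nu> p} \<and>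
           (AE \<omega> in M. (\<lambda>n. INF x\<in>S. norm (P n \<omega> - x)) \<longlonglongrightarrow> 0)"
proof -
  interpret unobservable_queues lam \<mu> H F \<nu>
    by (intro unobservable_queues.intro parallel_queues.intro unobservable_queues_axioms.intro) (fact lam H_prob H_sets H_nonneg H_mean F_prob F_sets F_nonneg F_mean stable moment4 lipschitz)+
  let ?S = "{p \<in> strategies. is_equilibrium H F \<nu> p}"
  note conv = cycle_algorithm_converges[OF M_prob p1 gamma_pos gamma_sum gamma_sq G_meas P_init P_step G_law]
  have ne: "?S \<noteq> {}" by (rule conv(1))
  have "AE \<omega> in M. (\<lambda>n. infdist (P n \<omega>) ?S) \<longlonglongrightarrow> 0" by (rule conv(2))
  then have "AE \<omega> in M. (\<lambda>n. INF x\<in>?S. norm (P n \<omega> - x)) \<longlonglongrightarrow> 0"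
    by (simp only: infdist_notempty[OF ne] dist_norm)
  with ne show ?thesis by (intro exI[of _ ?S] conjI subset_refl)
qed

end
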